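(* Let $k\ge 6$ be an integer and let $G$ be a finite simple $3$-connected non-bipartite graph. If the minimum degree of $G$ is at least $k$, then $G$ contains $k$ cycles of consecutive lengths (i.e. there is an integer $\ell$ such that $G$ contains a cycle of length $\ell+i$ for each $i\in\{0,1,\dots,k-1\}$), unless $G$ is the complete graph $K_{k+1}$.
   Context: All graphs are finite, simple and undirected. The length of a cycle is its number of edges. *)

theory Defs
  imports "Graph_Theory.Graph_Theory"
begin

text \<open>A finite simple undirected graph is a \<^const>\<open>graph\<close>: a finite symmetric digraph
  without loops and parallel arcs, each undirected edge being a pair of opposite arcs. Hence the
  degree of a vertex is its out-degree.\<close>

definition min_degree :: "('a, 'b) pre_digraph \<Rightarrow> nat" where
  "min_degree G = Min (out_degree G ` verts G)"

definition vertex_connected :: "nat \<Rightarrow> ('a, 'b) pre_digraph \<Rightarrow> bool" where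
  "vertex_connected n G \<longleftrightarrow>
     n < card (verts G) \<and>
     (\<forall>X \<subseteq> verts G. card X < n \<longrightarrow> connected (G \<restriction> (verts G - X)))"

definition bipartite :: "('a, 'b) pre_digraph \<Rightarrow> bool" where
  "bipartite G \<longleftrightarrow>
     (\<exists>A B. A \<union> B = verts G \<and> A \<inter> B = {} \<and>
        (\<forall>(u, v) \<in> arcs_ends G. u \<in> A \<and> v \<in> B \<or> u \<in> B \<and> v \<in> A))"

text \<open>In a symmetric digraph, going back and forth along one edge is a
  \<^const>\<open>pre_digraph.cycle\<close> of length 2, which is not a cycle of the undirected graph.\<close>

definition has_cycle_of_length :: "('a, 'b) pre_digraph \<Rightarrow> nat \<Rightarrow> bool" where
  "has_cycle_of_length G l \<longleftrightarrow> 3 \<le> l \<and> (\<exists>p. pre_digraph.cycle G p \<and> length p = l)"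

end

theory Submission
  imports Defs "HOL-Library.Set_Algebras"
begin

text \<open>
  A set of lengths is admissible if it contains an arithmetic progression of \<open>k\<close> terms with difference
  1 or 2. The main tool is that if adding the edge \<open>xy\<close> makes a graph 2-connected and every
  vertex other than \<open>x\<close> and \<open>y\<close> has degree at least \<open>k + 1\<close>, then the graph has paths from \<open>x\<close> to \<open>y\<close> of
  \<open>k\<close> admissible lengths. In a minimal counterexample, take a maximal dense structure at \<open>x\<close>: a clique,
  a clique completely joined to neighbours of \<open>x\<close>, or a complete bipartite graph. Contract it and
  apply the induction hypothesis to a component of the rest. The degree lost by the contraction is
  made up for by the interval of path lengths available inside the structure.

  If the graph contains a triangle, the same contraction argument with a clique or a diamond split
  into two parts yields the cycles. Otherwise choose an odd cycle \<open>C\<close> and a connected set \<open>D\<close> disjoint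
  from it such that \<open>D\<close> is as large as possible. Three-connectivity and parity force \<open>C\<close> to be
  induced and to be the whole complement of \<open>D\<close>, and a vertex that does not separate \<open>D\<close> has at most two
  neighbours on \<open>C\<close>, at distance 2. So \<open>D\<close>, or an end piece of \<open>D\<close> at a cut vertex, still has
  large minimum degree. Its admissible paths are closed up by arcs of \<open>C\<close>, where the two complementary
  arcs between two vertices have lengths of different parity and fill the gaps.
\<close>

subsection \<open>Paths\<close>

definition path_in :: "('a \<Rightarrow> 'a \<Rightarrow> bool) \<Rightarrow> 'a set \<Rightarrow> 'a list \<Rightarrow> bool" where
  "path_in E S xs \<longleftrightarrow> xs \<noteq> [] \<and> distinct xs \<and> set xs \<subseteq> S \<and> successively E xs"

definition path_lengths :: "('a \<Rightarrow> 'a \<Rightarrow> bool) \<Rightarrow> 'a set \<Rightarrow> 'a \<Rightarrow> 'a \<Rightarrow> nat set" where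
  "path_lengths E S a b = {n. \<exists>xs. path_in E S xs \<and> hd xs = a \<and> last xs = b \<and> length xs = Suc n}"

lemma path_lengthsI:
  "path_in E S xs \<Longrightarrow> length xs = Suc n \<Longrightarrow> n \<in> path_lengths E S (hd xs) (last xs)"
  unfolding path_lengths_def by auto

lemma path_lengthsE:
  assumes "n \<in> path_lengths E S a b"
  obtains xs where "path_in E S xs" "hd xs = a" "last xs = b" "length xs = Suc n"
  using assms unfolding path_lengths_def by auto

lemma path_lengths_endpoints:
  assumes "n \<in> path_lengths E S a b" shows "a \<in> S" "b \<in> S"
  using assms hd_in_set last_in_set by (fastforce elim!: path_lengthsE simp: path_in_def)+

lemma path_lengths_refl: "a \<in> S \<Longrightarrow> 0 \<in> path_lengths E S a a"
  using path_lengthsI[of E S "[a]" 0] by (auto simp: path_in_def)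

lemma path_lengths_0D: "0 \<in> path_lengths E S a b \<Longrightarrow> a = b"
  by (auto elim!: path_lengthsE simp: length_Suc_conv)

lemma path_lengths_sameD:
  assumes "n \<in> path_lengths E S a a" shows "n = 0"
proof -
  obtain xs where xs: "path_in E S xs" "hd xs = a" "last xs = a" "length xs = Suc n"
    using assms by (rule path_lengthsE)
  then obtain ys where "xs = a # ys" "a \<notin> set ys" by (cases xs) (auto simp: path_in_def)
  then show ?thesis using xs(3,4) by (cases "ys = []") auto
qed

lemma path_lengths_mono: "n \<in> path_lengths E S a b \<Longrightarrow> S \<subseteq> T \<Longrightarrow> n \<in> path_lengths E T a b"
  unfolding path_lengths_def path_in_def by blast

lemma path_lengths_edge: "E a b \<Longrightarrow> a \<noteq> b \<Longrightarrow> 1 \<in> path_lengths E {a, b} a b"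
  using path_lengthsI[of E "{a, b}" "[a, b]" 1] by (auto simp: path_in_def)

lemma path_lengths_edge_nonempty:
  assumes "a = b \<or> E a b" "a \<in> S" "b \<in> S" shows "path_lengths E S a b \<noteq> {}"
proof (cases "a = b")
  case True
  then show ?thesis using path_lengths_refl[of a S E] assms(2) by auto
next
  case False
  then show ?thesis using path_lengths_mono[OF path_lengths_edge[of E a b], of S] assms by auto
qed

lemma path_lengths_Cons:
  assumes "n \<in> path_lengths E S a b" "E v a" "v \<notin> S"
  shows "Suc n \<in> path_lengths E (insert v S) v b"
proof -
  obtain xs where xs: "path_in E S xs" "hd xs = a" "last xs = b" "length xs = Suc n"
    using assms(1) by (rule path_lengthsE)
  have "path_in E (insert v S) (v # xs)"
    using xs assms unfolding path_in_def by (auto simp: successively_Cons)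
  from path_lengthsI[OF this, of "Suc n"] xs show ?thesis
    by (auto simp: path_in_def)
qed

lemma path_lengths_rev:
  assumes "symp E" "n \<in> path_lengths E S a b" shows "n \<in> path_lengths E S b a"
proof -
  obtain xs where xs: "path_in E S xs" "hd xs = a" "last xs = b" "length xs = Suc n"
    using assms(2) by (rule path_lengthsE)
  have "successively (\<lambda>u v. E v u) xs"
    using xs(1) assms(1) unfolding path_in_def
    by (auto intro: successively_mono dest: sympD)
  then have "path_in E S (rev xs)"
    using xs(1) unfolding path_in_def by auto
  from path_lengthsI[OF this, of n] xs show ?thesis
    by (auto simp: path_in_def hd_rev last_rev)
qed

lemma path_lengths_join:
  assumes "n \<in> path_lengths E S a b" "m \<in> path_lengths E T b c" "S \<inter> T \<subseteq> {b}"
  shows "n + m \<in> path_lengths E (S \<union> T) a c"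
proof -
  obtain xs where xs: "path_in E S xs" "hd xs = a" "last xs = b" "length xs = Suc n"
    using assms(1) by (rule path_lengthsE)
  obtain ys where ys: "path_in E T ys" "hd ys = b" "last ys = c" "length ys = Suc m"
    using assms(2) by (rule path_lengthsE)
  obtain zs where zs: "ys = b # zs" using ys unfolding path_in_def by (cases ys) auto
  have "b \<notin> set zs" using ys zs unfolding path_in_def by auto
  then have "set xs \<inter> set zs = {}"
    using xs(1) ys(1) zs assms(3) unfolding path_in_def by auto
  then have "path_in E (S \<union> T) (xs @ zs)"
    using xs ys zs unfolding path_in_def
    by (auto simp: successively_append_iff successively_Cons)
  from path_lengthsI[OF this, of "n + m"] xs ys zs show ?thesis
    by (auto simp: path_in_def split: if_splits)
qed

lemma path_lengths_snoc:
  assumes "n \<in> path_lengths E S a b" "E b v" "v \<notin> S"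
  shows "Suc n \<in> path_lengths E (insert v S) a v"
proof -
  have "b \<in> S" using path_lengths_endpoints[OF assms(1)] by blast
  with path_lengths_join[OF assms(1) path_lengths_edge[of E, OF assms(2)]] assms(3)
  show ?thesis by (auto intro: path_lengths_mono)
qed

lemma path_lengths_penultimate:
  assumes "n \<in> path_lengths E S a b" "a \<noteq> b"
  obtains b' m where "E b' b" "b' \<in> S" "b' \<noteq> b" "n = Suc m" "m \<in> path_lengths E (S - {b}) a b'"
proof -
  obtain xs where xs: "path_in E S xs" "hd xs = a" "last xs = b" "length xs = Suc n"
    using assms(1) by (rule path_lengthsE)
  define ys where "ys = butlast xs"
  have snoc: "xs = ys @ [b]" using xs unfolding ys_def path_in_def by auto
  have nonempty: "ys \<noteq> []" using snoc xs assms(2) by auto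
  obtain m where m: "n = Suc m" using xs snoc nonempty by (cases n) auto
  have path: "path_in E (S - {b}) ys"
    using xs(1) snoc nonempty unfolding path_in_def by (auto simp: successively_append_iff)
  have "m \<in> path_lengths E (S - {b}) (hd ys) (last ys)"
    by (rule path_lengthsI[OF path]) (use xs snoc m in auto)
  moreover have "hd ys = a" using xs(2) snoc nonempty by auto
  moreover have "E (last ys) b" using xs(1) snoc nonempty unfolding path_in_def
    by (auto simp: successively_append_iff)
  moreover have "last ys \<in> S - {b}"
    using path last_in_set[OF nonempty] unfolding path_in_def by blast
  ultimately show ?thesis using that m by auto
qed

lemma path_lengths_prefix:
  assumes "path_in E S xs" "v \<in> set xs"
  obtains n where "n \<in> path_lengths E (set xs) (hd xs) v"
proof -
  obtain ys zs where split: "xs = ys @ v # zs" using split_list[OF assms(2)] by blast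
  have "path_in E (set xs) (ys @ [v])"
    using assms(1) unfolding split path_in_def
    by (auto simp: successively_append_iff successively_Cons)
  from path_lengthsI[OF this, of "length ys"] have "length ys \<in> path_lengths E (set xs) (hd xs) v"
    unfolding split by (cases ys) auto
  then show ?thesis by (rule that)
qed

subsection \<open>Boundaries and connectivity\<close>

definition boundary :: "('a \<Rightarrow> 'a \<Rightarrow> bool) \<Rightarrow> 'a set \<Rightarrow> 'a set \<Rightarrow> 'a set" where
  "boundary E V D = {v \<in> V - D. \<exists>d\<in>D. E d v}"

definition connected_in :: "('a \<Rightarrow> 'a \<Rightarrow> bool) \<Rightarrow> 'a set \<Rightarrow> bool" where
  "connected_in E S \<longleftrightarrow> (\<forall>D. D \<noteq> {} \<longrightarrow> D \<subset> S \<longrightarrow> boundary E S D \<noteq> {})"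

definition component :: "('a \<Rightarrow> 'a \<Rightarrow> bool) \<Rightarrow> 'a set \<Rightarrow> 'a set \<Rightarrow> bool" where
  "component E S P \<longleftrightarrow> P \<noteq> {} \<and> P \<subseteq> S \<and> connected_in E P \<and> boundary E S P = {}"

lemma boundary_iff [simp]: "v \<in> boundary E V D \<longleftrightarrow> v \<in> V \<and> v \<notin> D \<and> (\<exists>d\<in>D. E d v)"
  unfolding boundary_def by blast

lemma boundary_nonemptyI: "d \<in> D \<Longrightarrow> v \<in> V - D \<Longrightarrow> E d v \<Longrightarrow> boundary E V D \<noteq> {}"
  unfolding boundary_def by blast

lemma boundary_subsetD:
  "boundary E V D \<subseteq> B \<Longrightarrow> d \<in> D \<Longrightarrow> v \<in> V \<Longrightarrow> E d v \<Longrightarrow> v \<in> D \<union> B"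
  unfolding boundary_def by blast

lemma connected_in_boundaryE:
  assumes "connected_in E S" "D \<noteq> {}" "D \<subseteq> S" "D \<noteq> S"
  obtains d v where "d \<in> D" "v \<in> S - D" "E d v"
proof -
  have "boundary E S D \<noteq> {}" using assms unfolding connected_in_def by blast
  then show ?thesis using that unfolding boundary_def by blast
qed

lemma connected_in_singleton [simp]: "connected_in E {v}"
  unfolding connected_in_def by blast

lemma connected_in_path:
  assumes "connected_in E S" "a \<in> S" "b \<in> S"
  shows "path_lengths E S a b \<noteq> {}"
proof -
  define D where "D = {w. path_lengths E S a w \<noteq> {}}"
  have "a \<in> D" unfolding D_def using path_lengths_refl assms by fast
  have "D \<subseteq> S" unfolding D_def using path_lengths_endpoints by fast
  have "D = S"
  proof (rule ccontr)
    assume "D \<noteq> S"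
    have "D \<noteq> {}" using \<open>a \<in> D\<close> by blast
    then obtain d e where de: "d \<in> D" "e \<in> S - D" "E d e"
      using \<open>D \<subseteq> S\<close> \<open>D \<noteq> S\<close> by (rule connected_in_boundaryE[OF assms(1)])
    obtain n xs where xs: "path_in E S xs" "hd xs = a" "last xs = d" "length xs = Suc n"
      using de(1) unfolding D_def path_lengths_def by auto
    have "set xs \<subseteq> D"
    proof
      fix v assume "v \<in> set xs"
      then obtain m where "m \<in> path_lengths E (set xs) a v"
        using path_lengths_prefix[OF xs(1)] xs(2) by metis
      moreover have "set xs \<subseteq> S" using xs(1) unfolding path_in_def by blast
      ultimately have "m \<in> path_lengths E S a v" by (rule path_lengths_mono)
      then show "v \<in> D" unfolding D_def by blast
    qed
    then have "path_in E S (xs @ [e])" using xs de unfolding path_in_def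
      by (auto simp: successively_append_iff)
    from path_lengthsI[OF this, of "Suc n"] have "e \<in> D"
      using xs unfolding D_def path_in_def by auto
    then show False using de by blast
  qed
  then have "b \<in> D" using assms by simp
  then show ?thesis unfolding D_def by simp
qed

lemma ex_component:
  assumes "symp E" "v \<in> S"
  obtains P where "v \<in> P" "component E S P"
proof -
  define closed where "closed = {P. v \<in> P \<and> P \<subseteq> S \<and> (\<forall>p\<in>P. \<forall>w\<in>S. E p w \<longrightarrow> w \<in> P)}"
  define P where "P = \<Inter>closed"
  have "S \<in> closed" using assms unfolding closed_def by auto
  then have P: "P \<in> closed" unfolding P_def closed_def by auto
  have least: "P \<subseteq> Q" if "Q \<in> closed" for Q using that unfolding P_def by auto
  have "connected_in E P" unfolding connected_in_def
  proof (intro allI impI notI)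
    fix D assume D: "D \<noteq> {}" "D \<subset> P" and sep: "boundary E P D = {}"
    have no_edge: "\<not> E d e" "\<not> E e d" if "d \<in> D" "e \<in> P - D" for d e
      using sep that sympD[OF assms(1)] unfolding boundary_def by blast+
    have "D \<in> closed \<or> P - D \<in> closed" using D(2) P no_edge unfolding closed_def by blast
    then show False using least D by blast
  qed
  moreover have "boundary E S P = {}" using P unfolding closed_def boundary_def by blast
  ultimately show ?thesis using that[of P] P unfolding closed_def component_def by blast
qed

lemma componentD:
  assumes "component E S P" shows "P \<noteq> {}" "P \<subseteq> S" "connected_in E P"
  using assms unfolding component_def by auto

lemma component_closed: "component E S P \<Longrightarrow> p \<in> P \<Longrightarrow> v \<in> S \<Longrightarrow> E p v \<Longrightarrow> v \<in> P"
  unfolding component_def boundary_def by blast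

lemma component_boundary: "component E S P \<Longrightarrow> boundary E V P \<subseteq> boundary E V S"
  unfolding component_def by (auto simp: boundary_def)

lemma component_boundary_Diff: "component E (V - S) P \<Longrightarrow> boundary E V P \<subseteq> S"
  unfolding component_def by (auto simp: boundary_def)

lemma connected_in_Un:
  assumes sym: "symp E" and A: "connected_in E A" "a \<in> A" and B: "connected_in E B" "b \<in> B"
    and ab: "a = b \<or> E a b"
  shows "connected_in E (A \<union> B)"
  unfolding connected_in_def
proof (intro allI impI)
  fix D assume D: "D \<noteq> {}" "D \<subset> A \<union> B"
  have split: "boundary E (A \<union> B) D \<noteq> {}"
    if X: "connected_in E X" "X \<subseteq> A \<union> B" "D \<inter> X \<noteq> {}" "D \<inter> X \<noteq> X" for X
  proof -
    obtain d v where "d \<in> D \<inter> X" "v \<in> X - D \<inter> X" "E d v"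
      using connected_in_boundaryE[OF X(1,3) _ X(4)] by blast
    then show ?thesis using X(2) by (intro boundary_nonemptyI[of d _ v]) auto
  qed
  consider "D \<inter> A \<noteq> {}" "D \<inter> A \<noteq> A" | "D \<inter> B \<noteq> {}" "D \<inter> B \<noteq> B"
    | "a \<in> D" "b \<notin> D" | "a \<notin> D" "b \<in> D"
    using D A(2) B(2) by blast
  then show "boundary E (A \<union> B) D \<noteq> {}"
  proof cases
    case 1 then show ?thesis using split[OF A(1)] by blast
  next
    case 2 then show ?thesis using split[OF B(1)] by blast
  next
    case 3 then show ?thesis using ab B(2) by (auto simp: boundary_def)
  next
    case 4 then show ?thesis using ab A(2) sympD[OF sym, of a b] by (auto simp: boundary_def)
  qed
qed

lemma connected_in_insert:
  assumes "symp E" "connected_in E A" "a \<in> A" "E a b" shows "connected_in E (insert b A)"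
  using connected_in_Un[OF assms(1-3), of "{b}" b] assms(4) by simp

lemma connected_in_attach:
  assumes sym: "symp E" and K: "connected_in E K" and X: "\<And>x. x \<in> X \<Longrightarrow> \<exists>a\<in>K. E x a"
  shows "connected_in E (K \<union> X)"
  unfolding connected_in_def
proof (intro allI impI)
  fix D assume D: "D \<noteq> {}" "D \<subset> K \<union> X"
  consider "D \<inter> K \<noteq> {}" "D \<inter> K \<noteq> K" | "D \<inter> K = {}" | "K \<subseteq> D" by blast
  then show "boundary E (K \<union> X) D \<noteq> {}"
  proof cases
    case 1
    then obtain d v where "d \<in> D \<inter> K" "v \<in> K - D \<inter> K" "E d v"
      using connected_in_boundaryE[OF K 1(1) _ 1(2)] by blast
    then show ?thesis by (intro boundary_nonemptyI[of d _ v]) auto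
  next
    case 2
    then obtain d where d: "d \<in> D" "d \<in> X" using D by blast
    then obtain a where "a \<in> K" "E d a" using X by blast
    then show ?thesis using d(1) 2 by (intro boundary_nonemptyI[of d _ a]) auto
  next
    case 3
    then obtain v where v: "v \<in> X" "v \<notin> D" using D by blast
    then show ?thesis using X[OF v(1)] 3 sympD[OF sym, of v] by (auto simp: boundary_def)
  qed
qed

lemma connected_in_remove:
  assumes sym: "symp E" and K: "connected_in E K" "c \<in> K - P" and P: "boundary E K (K \<inter> P) \<subseteq> {c}"
  shows "connected_in E (K - P)"
proof -
  have leave: "boundary E (K - P) S \<noteq> {}" if S: "S \<noteq> {}" "S \<subseteq> K - P" "c \<notin> S" for S
  proof -
    have "S \<subseteq> K" "S \<noteq> K" using S K(2) by auto
    then obtain s v where sv: "s \<in> S" "v \<in> K - S" "E s v"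
      by (rule connected_in_boundaryE[OF K(1) S(1)])
    have "v \<notin> P"
    proof
      assume "v \<in> P"
      then have "s \<in> boundary E K (K \<inter> P)" using sv S(2) sympD[OF sym sv(3)] by auto
      then show False using P S(3) sv(1) by blast
    qed
    then show ?thesis using sv by (intro boundary_nonemptyI[of s _ v]) auto
  qed
  show ?thesis unfolding connected_in_def
  proof (intro allI impI)
    fix S assume S: "S \<noteq> {}" "S \<subset> K - P"
    show "boundary E (K - P) S \<noteq> {}"
    proof (cases "c \<in> S")
      case False
      then show ?thesis using leave[of S] S by blast
    next
      case True
      then have "boundary E (K - P) (K - P - S) \<noteq> {}" using leave[of "K - P - S"] S by blast
      then obtain t v where "t \<in> K - P - S" "v \<in> S" "E t v" unfolding boundary_def by blast
      then show ?thesis using sympD[OF sym] by (intro boundary_nonemptyI[of v _ t]) auto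
    qed
  qed
qed

lemma connected_in_path_set:
  assumes "symp E" "path_in E S xs" shows "connected_in E (set xs)"
  using assms(2)
proof (induction xs)
  case (Cons v xs)
  show ?case
  proof (cases "xs = []")
    case False
    then have "path_in E S xs" "E v (hd xs)" using Cons.prems
      by (auto simp: path_in_def successively_Cons)
    then show ?thesis
      using connected_in_insert[OF assms(1) Cons.IH, of "hd xs" v] False sympD[OF assms(1)] by auto
  qed simp
qed (simp add: path_in_def)

subsection \<open>Neighbours\<close>

definition nbrs :: "('a \<Rightarrow> 'a \<Rightarrow> bool) \<Rightarrow> 'a set \<Rightarrow> 'a \<Rightarrow> 'a set" where
  "nbrs E S v = {w \<in> S. E v w}"

lemma nbrs_iff [simp]: "w \<in> nbrs E S v \<longleftrightarrow> w \<in> S \<and> E v w"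
  unfolding nbrs_def by auto

lemma finite_nbrs [simp]: "finite S \<Longrightarrow> finite (nbrs E S v)"
  unfolding nbrs_def by auto

lemma nbrs_empty [simp]: "nbrs E {} v = {}"
  by auto

lemma nbrs_eq_empty_iff: "nbrs E S v = {} \<longleftrightarrow> (\<forall>w\<in>S. \<not> E v w)"
  by auto

lemma card_nbrs_eq_0: "\<not> (\<exists>w\<in>S. E v w) \<Longrightarrow> card (nbrs E S v) = 0"
  using nbrs_eq_empty_iff[of E S v] by simp

lemma card_nbrs_le: "finite S \<Longrightarrow> card (nbrs E S v) \<le> card S"
  by (rule card_mono) auto

lemma card_nbrs_less: "finite S \<Longrightarrow> w \<in> S \<Longrightarrow> \<not> E v w \<Longrightarrow> card (nbrs E S v) < card S"
  by (intro psubset_card_mono) auto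

lemma adjacent_if_card_nbrs_ge: "finite S \<Longrightarrow> card S \<le> card (nbrs E S v) \<Longrightarrow> w \<in> S \<Longrightarrow> E v w"
  using card_nbrs_less by (metis not_le)

lemma card_nbrs_Un_disjoint:
  assumes "finite S" "finite T" "S \<inter> T = {}"
  shows "card (nbrs E (S \<union> T) v) = card (nbrs E S v) + card (nbrs E T v)"
proof -
  have "nbrs E (S \<union> T) v = nbrs E S v \<union> nbrs E T v" "nbrs E S v \<inter> nbrs E T v = {}"
    using assms(3) by auto
  then show ?thesis using assms by (simp add: card_Un_disjoint)
qed

lemma card_nbrs_insert:
  assumes "finite S" "a \<notin> S"
  shows "card (nbrs E (insert a S) v) = of_bool (E v a) + card (nbrs E S v)"
proof -
  have "nbrs E (insert a S) v = (if E v a then insert a (nbrs E S v) else nbrs E S v)" by auto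
  then show ?thesis using assms by simp
qed

lemma card_nbrs_singleton [simp]: "card (nbrs E {a} v) = of_bool (E v a)"
  using card_nbrs_insert[of "{}" a] by simp

lemma card_nbrs_pair_le_1: "\<not> (E v a \<and> E v b) \<Longrightarrow> card (nbrs E {a, b} v) \<le> 1"
  by (cases "a = b") (auto simp: card_nbrs_insert)

lemma card_nbrs_le_boundary:
  assumes "finite V" "P \<subseteq> V" "p \<in> P" "boundary E V P \<subseteq> B" "finite B"
  shows "card (nbrs E V p) \<le> card (nbrs E P p) + card (nbrs E B p)"
proof -
  have "nbrs E V p \<subseteq> nbrs E P p \<union> nbrs E B p"
    using boundary_subsetD[OF assms(4,3)] by (auto simp: nbrs_def)
  then have "card (nbrs E V p) \<le> card (nbrs E P p \<union> nbrs E B p)"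
    using assms by (intro card_mono) (auto dest: finite_subset)
  also have "\<dots> \<le> card (nbrs E P p) + card (nbrs E B p)" by (rule card_Un_le)
  finally show ?thesis .
qed

subsection \<open>Progressions\<close>

definition progression :: "nat \<Rightarrow> nat \<Rightarrow> nat set \<Rightarrow> bool" where
  "progression d n L \<longleftrightarrow> (\<exists>a. \<forall>i<n. a + d * i \<in> L)"

definition admissible :: "nat \<Rightarrow> nat set \<Rightarrow> bool" where
  "admissible n L \<longleftrightarrow> progression 1 n L \<or> progression 2 n L"

lemma progressionI: "(\<And>i. i < n \<Longrightarrow> a + d * i \<in> L) \<Longrightarrow> progression d n L"
  unfolding progression_def by blast

lemma progression_le: "progression d n L \<Longrightarrow> m \<le> n \<Longrightarrow> progression d m L"
  unfolding progression_def by (meson order_less_le_trans)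

lemma progression_singleton: "a \<in> L \<Longrightarrow> n \<le> 1 \<Longrightarrow> progression d n L"
  by (intro progressionI[of _ a]) (auto simp: less_Suc_eq_le dest: less_le_trans)

lemma progression_mono: "progression d n L \<Longrightarrow> L \<subseteq> M \<Longrightarrow> progression d n M"
  unfolding progression_def by blast

lemma progression_add:
  assumes "progression d n A" "b \<in> B" shows "progression d n (A + B)"
proof -
  obtain a where a: "\<And>i. i < n \<Longrightarrow> a + d * i \<in> A" using assms(1) unfolding progression_def by blast
  have "a + b + d * i \<in> A + B" if "i < n" for i
    using set_plus_intro[OF a[OF that] assms(2)] by (simp add: ac_simps)
  then show ?thesis by (rule progressionI)
qed

lemma progression_sum_same:
  assumes "progression d p A" "progression d q B" "1 \<le> p" "1 \<le> q"
    and sum: "\<And>a b. a \<in> A \<Longrightarrow> b \<in> B \<Longrightarrow> a + b \<in> M"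
  shows "progression d (p + q - 1) M"
proof -
  obtain a b where a: "\<And>i. i < p \<Longrightarrow> a + d * i \<in> A" and b: "\<And>i. i < q \<Longrightarrow> b + d * i \<in> B"
    using assms(1,2) unfolding progression_def by blast
  have "a + b + d * i \<in> M" if "i < p + q - 1" for i
  proof -
    define u where "u = min i (p - 1)"
    have "u < p" "i - u < q" "i = u + (i - u)" using that assms(3,4) unfolding u_def by auto
    then show ?thesis using sum[OF a[of u] b[of "i - u"]]
      by (metis add.assoc add.left_commute distrib_left)
  qed
  then show ?thesis by (rule progressionI)
qed

lemma progression_sum:
  assumes "progression 1 p A" "progression d q B" "1 \<le> d" "d \<le> p" "1 \<le> q"
    and sum: "\<And>a b. a \<in> A \<Longrightarrow> b \<in> B \<Longrightarrow> a + b \<in> M"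
  shows "progression 1 (p + d * (q - 1)) M"
proof -
  obtain a b where a: "\<And>i. i < p \<Longrightarrow> a + i \<in> A" and b: "\<And>i. i < q \<Longrightarrow> b + d * i \<in> B"
    using assms(1,2) unfolding progression_def by auto
  have "a + b + 1 * i \<in> M" if i: "i < p + d * (q - 1)" for i
  proof -
    define v where "v = min (i div d) (q - 1)"
    have "v < q" using assms(5) unfolding v_def by auto
    have "d * v \<le> i"
      unfolding v_def
      by (metis min.cobounded1 mult.commute mult_le_mono1 order_trans times_div_less_eq_dividend)
    moreover have "i - d * v < p"
    proof (cases "i div d \<le> q - 1")
      case True
      then have "i - d * v = i mod d" unfolding v_def by (simp add: minus_mult_div_eq_mod)
      then show ?thesis using assms(3,4)
        by (metis mod_less_divisor less_le_trans less_eq_Suc_le One_nat_def)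
    next
      case False
      then show ?thesis using i assms(3,4) unfolding v_def by (simp add: less_diff_conv2)
    qed
    ultimately show ?thesis using sum[OF a b[OF \<open>v < q\<close>], of "i - d * v"] by (simp add: algebra_simps)
  qed
  then show ?thesis by (rule progressionI)
qed

lemma admissible_step_1I: "(\<And>i. i < n \<Longrightarrow> a + i \<in> L) \<Longrightarrow> admissible n L"
  unfolding admissible_def progression_def by auto

lemma admissible_step_2I: "(\<And>i. i < n \<Longrightarrow> a + 2 * i \<in> L) \<Longrightarrow> admissible n L"
  unfolding admissible_def progression_def by auto

lemma admissible_mono: "admissible n L \<Longrightarrow> L \<subseteq> M \<Longrightarrow> admissible n M"
  unfolding admissible_def progression_def by blast

lemma admissible_le: "admissible n L \<Longrightarrow> m \<le> n \<Longrightarrow> admissible m L"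
  unfolding admissible_def using progression_le by blast

lemma admissible_singleton: "a \<in> L \<Longrightarrow> n \<le> 1 \<Longrightarrow> admissible n L"
  unfolding admissible_def using progression_singleton by blast

lemma admissible_nonempty: "admissible n L \<Longrightarrow> 1 \<le> n \<Longrightarrow> L \<noteq> {}"
  unfolding admissible_def progression_def by (auto dest!: spec[of _ 0])

lemma admissible_not_subset_0: "admissible n L \<Longrightarrow> 2 \<le> n \<Longrightarrow> \<not> L \<subseteq> {0}"
  unfolding admissible_def progression_def by (auto dest!: spec[of _ 1])

text \<open>Steps of different size only occur if one of the two summands has at least two terms of step 1.\<close>

lemma admissible_sum_mixed:
  assumes "progression 1 p A" "progression 2 q B" "1 \<le> p" "1 \<le> q"
    and "\<And>a b. a \<in> A \<Longrightarrow> b \<in> B \<Longrightarrow> a + b \<in> M"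
  shows "admissible (p + q - 1) M"
proof (cases "p = 1")
  case True
  have "progression 2 p A" using assms(1) True unfolding progression_def by simp
  then show ?thesis using progression_sum_same[OF _ assms(2-5)] unfolding admissible_def by blast
next
  case False
  then have "progression 1 (p + 2 * (q - 1)) M"
    using assms(3) by (intro progression_sum[OF assms(1,2) _ _ assms(4,5)]) auto
  then show ?thesis using assms(4) unfolding admissible_def by (auto elim: progression_le)
qed

lemma admissible_sum:
  assumes "admissible p A" "admissible q B" "1 \<le> p" "1 \<le> q"
    and sum: "\<And>a b. a \<in> A \<Longrightarrow> b \<in> B \<Longrightarrow> a + b \<in> M"
  shows "admissible (p + q - 1) M"
proof -
  obtain d e where "progression d p A" "progression e q B" "d = 1 \<or> d = 2" "e = 1 \<or> e = 2"
    using assms(1,2) unfolding admissible_def by blast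
  then consider "progression d p A" "progression d q B" "d = 1 \<or> d = 2"
    | "progression 1 p A" "progression 2 q B" | "progression 1 q B" "progression 2 p A"
    by blast
  then show ?thesis
  proof cases
    case 1
    then show ?thesis using progression_sum_same[OF 1(1,2) assms(3-5)] unfolding admissible_def
      by blast
  next
    case 2
    then show ?thesis by (rule admissible_sum_mixed) (use assms(3-5) in auto)
  next
    case 3
    have "b + a \<in> M" if "b \<in> B" "a \<in> A" for a b using sum[OF that(2,1)] by (simp add: add.commute)
    then have "admissible (q + p - 1) M" by (rule admissible_sum_mixed[OF 3 assms(4,3)])
    then show ?thesis by (simp add: add.commute)
  qed
qed

lemma admissible_sum_interval:
  assumes "progression 1 m A" "admissible c B" "2 \<le> m" "1 \<le> c"
    and sum: "\<And>a b. a \<in> A \<Longrightarrow> b \<in> B \<Longrightarrow> a + b \<in> M"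
  shows "progression 1 (m + c - 1) M"
proof -
  obtain d where d: "progression d c B" "d = 1 \<or> d = 2"
    using assms(2) unfolding admissible_def by blast
  have "progression 1 (m + d * (c - 1)) M"
    by (rule progression_sum[OF assms(1) d(1) _ _ assms(4) sum]) (use d(2) assms(3) in auto)
  then show ?thesis using d(2) assms(4) by (auto elim: progression_le)
qed

lemma admissible_sum_gap_3:
  assumes "admissible c L" "4 \<le> c" and sum: "\<And>a. a \<in> L \<Longrightarrow> b + a \<in> M" "\<And>a. a \<in> L \<Longrightarrow> b + 3 + a \<in> M"
  shows "progression 1 (c + 2) M"
proof -
  have gap: "progression 3 2 {b, b + 3}" by (rule progressionI[of _ b]) (auto simp: less_2_cases_iff)
  show ?thesis
    using assms(1) unfolding admissible_def
  proof
    assume "progression 1 c L"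
    then have "progression 1 (c + 3 * (2 - 1)) M"
      by (rule progression_sum[OF _ gap]) (use assms(2) sum in \<open>auto simp: ac_simps\<close>)
    then show ?thesis by (rule progression_le) simp
  next
    assume "progression 2 c L"
    then obtain a where a: "\<And>i. i < c \<Longrightarrow> a + 2 * i \<in> L" unfolding progression_def by blast
    have "a + b + 2 + 1 * i \<in> M" if i: "i < c + 2" for i
    proof (cases "even i")
      case True
      then obtain j where j: "i = 2 * j" by blast
      then have "Suc j < c" using i assms(2) by auto
      moreover have "b + (a + 2 * Suc j) = a + b + 2 + 1 * i" using j by simp
      ultimately show ?thesis using sum(1)[OF a[of "Suc j"]] by metis
    next
      case False
      then obtain j where j: "i = 2 * j + 1" by (rule oddE)
      then have "j < c" using i assms(2) by auto
      moreover have "b + 3 + (a + 2 * j) = a + b + 2 + 1 * i" using j by simp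
      ultimately show ?thesis using sum(2)[OF a[of j]] by metis
    qed
    then show ?thesis by (rule progressionI)
  qed
qed

lemma admissible_shift:
  assumes "admissible n L" "\<And>a. a \<in> L \<Longrightarrow> a + c \<in> M" shows "admissible n M"
proof (cases "n = 0")
  case False
  have "admissible (n + 1 - 1) M"
    by (rule admissible_sum[OF assms(1) admissible_singleton[of c "{c}"]]) (use False assms(2) in auto)
  then show ?thesis by simp
qed (auto simp: admissible_def progression_def)

subsection \<open>Rooted graphs\<close>

locale adjacency =
  fixes E :: "'a \<Rightarrow> 'a \<Rightarrow> bool"
  assumes sym: "symp E" and irrefl: "irreflp E"
begin

lemma E_sym: "E a b \<Longrightarrow> E b a"
  using sym by (rule sympD)

lemma E_irrefl [simp]: "\<not> E a a"
  using irrefl by (rule irreflpD)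

lemma ex_union_of_components:
  assumes t: "t \<in> boundary E V R"
    and closed: "\<And>P. component E R P \<Longrightarrow> t \<in> boundary E V P \<Longrightarrow> boundary E V P \<subseteq> insert t S"
  obtains W
    where "W \<subseteq> R" "t \<in> boundary E V W" "boundary E V W \<subseteq> insert t S" "t \<notin> boundary E V (R - W)"
proof -
  define W where "W = \<Union>{P. component E R P \<and> t \<in> boundary E V P}"
  have "W \<subseteq> R" unfolding W_def using componentD(2) by blast
  have attached: "r \<in> W" if r: "r \<in> R" "E r t" for r
  proof -
    obtain P where P: "r \<in> P" "component E R P" using ex_component[OF sym r(1)] .
    then have "t \<in> boundary E V P" using r(2) t componentD(2)[OF P(2)] by auto
    then show ?thesis using P unfolding W_def by blast
  qed
  have "t \<in> boundary E V W" using t attached \<open>W \<subseteq> R\<close> unfolding boundary_def by blast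
  moreover have "boundary E V W \<subseteq> insert t S" using closed unfolding W_def boundary_def by blast
  moreover have "t \<notin> boundary E V (R - W)" using attached unfolding boundary_def by blast
  ultimately show ?thesis using that \<open>W \<subseteq> R\<close> by blast
qed

end

text \<open>Adding the edge \<open>xy\<close> makes the graph 2-connected.\<close>

definition rooted :: "('a \<Rightarrow> 'a \<Rightarrow> bool) \<Rightarrow> 'a set \<Rightarrow> 'a \<Rightarrow> 'a \<Rightarrow> bool" where
  "rooted E V x y \<longleftrightarrow> finite V \<and> x \<in> V \<and> y \<in> V \<and> x \<noteq> y \<and>
     (\<forall>D c. D \<noteq> {} \<longrightarrow> D \<subseteq> V - {x, y} \<longrightarrow> \<not> boundary E V D \<subseteq> {c})"

text \<open>All \<open>k\<close> paths end in the same neighbour of \<open>T\<close>; without this the induction could not reroute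
  their ends.\<close>

definition linked :: "('a \<Rightarrow> 'a \<Rightarrow> bool) \<Rightarrow> 'a set \<Rightarrow> 'a set \<Rightarrow> 'a set \<Rightarrow> nat \<Rightarrow> bool" where
  "linked E P U T k \<longleftrightarrow>
     (\<exists>p\<in>P. (\<exists>t\<in>T. E p t) \<and> admissible k (\<Union>u\<in>U. path_lengths E (insert u P) u p))"

definition rooted_graph :: "('a \<Rightarrow> 'a \<Rightarrow> bool) \<Rightarrow> 'a set \<Rightarrow> 'a \<Rightarrow> 'a \<Rightarrow> nat \<Rightarrow> bool" where
  "rooted_graph E V x y k \<longleftrightarrow> adjacency E \<and> rooted E V x y \<and> V \<noteq> {x, y} \<and>
     (k \<le> 1 \<or> (\<forall>v\<in>V - {x, y}. k + 1 \<le> card (nbrs E V v)))"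

lemma rooted_commute: "rooted E V x y \<longleftrightarrow> rooted E V y x"
  unfolding rooted_def by (auto simp: insert_commute)

lemma rooted_boundary: "rooted E V x y \<Longrightarrow> D \<noteq> {} \<Longrightarrow> D \<subseteq> V - {x, y} \<Longrightarrow> \<not> boundary E V D \<subseteq> {c}"
  unfolding rooted_def by blast

context adjacency
begin

lemma rooted_path_avoiding:
  assumes rooted: "rooted E V x y" and P: "P \<subseteq> V - {x, y}" "boundary E V P \<subseteq> {x, c}"
    and c: "c \<in> V - {x} - P"
  shows "path_lengths E (V - insert x P) c y \<noteq> {}"
proof -
  have "c \<in> V - insert x P" using c by auto
  then obtain K where K: "c \<in> K" "component E (V - insert x P) K"
    by (rule ex_component[OF sym])
  have "y \<in> K"
  proof (rule ccontr)
    assume "y \<notin> K"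
    then have "K \<union> P \<noteq> {}" "K \<union> P \<subseteq> V - {x, y}" using K(1) componentD(2)[OF K(2)] P(1) by auto
    moreover have "boundary E V (K \<union> P) \<subseteq> {x}"
    proof
      fix v assume "v \<in> boundary E V (K \<union> P)"
      then obtain d where d: "d \<in> K \<union> P" "v \<in> V" "v \<notin> K" "v \<notin> P" "E d v"
        unfolding boundary_def by blast
      have "v = x" if "d \<in> K" using component_closed[OF K(2) that _ d(5)] d(2-4) by auto
      moreover have "v = x" if "d \<in> P" using boundary_subsetD[OF P(2) that d(2,5)] d(3,4) K(1) by auto
      ultimately show "v \<in> {x}" using d(1) by blast
    qed
    ultimately show False using rooted_boundary[OF rooted, of "K \<union> P" x] by blast
  qed
  then have "path_lengths E K c y \<noteq> {}"
    using connected_in_path[OF componentD(3)[OF K(2)] K(1)] by blast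
  then show ?thesis using componentD(2)[OF K(2)] path_lengths_mono[of _ E K] by blast
qed

lemma linked_if_le_1:
  assumes rooted: "rooted E V x y" and "V \<noteq> {x, y}" "k \<le> 1"
  shows "linked E (V - {x, y}) {x} {y} k"
proof -
  have "x \<in> V" "y \<in> V" using rooted unfolding rooted_def by auto
  then obtain v where "v \<in> V - {x, y}" using assms(2) by blast
  then obtain P where "component E (V - {x, y}) P" by (rule ex_component[OF sym])
  then have P: "P \<noteq> {}" "P \<subseteq> V - {x, y}" "connected_in E P" and closed: "boundary E V P \<subseteq> {x, y}"
    unfolding component_def boundary_def by auto
  have "boundary E V P \<inter> {y} \<noteq> {}" "boundary E V P \<inter> {x} \<noteq> {}"
    using rooted_boundary[OF rooted P(1,2)] closed by blast+
  then obtain p q where p: "p \<in> P" "E p y" and q: "q \<in> P" "E x q" using E_sym by auto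
  obtain n where "n \<in> path_lengths E P q p" using connected_in_path[OF P(3) q(1) p(1)] by blast
  then have "Suc n \<in> path_lengths E (insert x P) x p"
    by (rule path_lengths_Cons) (use q P(2) in auto)
  then have "Suc n \<in> path_lengths E (insert x (V - {x, y})) x p"
    by (rule path_lengths_mono) (use P(2) in auto)
  then show ?thesis
    unfolding linked_def using p P(2) assms(3) admissible_singleton by fastforce
qed

lemma admissible_linked_reverse:
  assumes "linked E P {c} T k" and heads: "\<And>b. b \<in> T \<Longrightarrow> path_lengths E A x b \<noteq> {}"
    and disjoint: "A \<inter> insert c P = {}"
  shows "admissible k (path_lengths E (A \<union> insert c P) x c)"
proof -
  obtain p b where p: "p \<in> P" "b \<in> T" "E p b"
    and adm: "admissible k (path_lengths E (insert c P) c p)"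
    using assms(1) unfolding linked_def by auto
  obtain m where m: "m \<in> path_lengths E A x b" using heads[OF p(2)] by blast
  then have "b \<in> A" by (rule path_lengths_endpoints)
  show ?thesis
  proof (rule admissible_shift[OF adm, where c = "m + 1"])
    fix j assume "j \<in> path_lengths E (insert c P) c p"
    then have "j \<in> path_lengths E (insert c P) p c" by (rule path_lengths_rev[OF sym])
    then have "Suc j \<in> path_lengths E (insert b (insert c P)) b c"
      by (rule path_lengths_Cons) (use E_sym[OF p(3)] \<open>b \<in> A\<close> disjoint in auto)
    then have "m + Suc j \<in> path_lengths E (A \<union> insert b (insert c P)) x c"
      by (rule path_lengths_join[OF m]) (use disjoint in auto)
    then show "j + (m + 1) \<in> path_lengths E (A \<union> insert c P) x c"
      using \<open>b \<in> A\<close> by (simp add: insert_absorb add.commute)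
  qed
qed

end

subsection \<open>Contracting two sets to the roots of a smaller graph\<close>

locale contraction = adjacency E for E :: "'a \<Rightarrow> 'a \<Rightarrow> bool" +
  fixes P U T :: "'a set" and u t :: 'a
  assumes disjoint: "U \<inter> P = {}" "T \<inter> P = {}" "U \<inter> T = {}" and u: "u \<in> U" and t: "t \<in> T"
begin

definition fibre :: "'a \<Rightarrow> 'a set" where
  "fibre v = (if v = u then U else if v = t then T else {v})"

definition contracted :: "'a \<Rightarrow> 'a \<Rightarrow> bool" where
  "contracted a b \<longleftrightarrow> (a \<in> P \<or> b \<in> P) \<and> (\<exists>v\<in>fibre a. \<exists>w\<in>fibre b. E v w)"

lemma representatives: "u \<notin> P" "t \<notin> P" "u \<noteq> t"
  using disjoint u t by auto

lemma fibre_simps [simp]: "fibre u = U" "fibre t = T" "v \<in> P \<Longrightarrow> fibre v = {v}"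
  using representatives unfolding fibre_def by auto

lemma adjacency_contracted: "adjacency contracted"
proof
  show "symp contracted" using E_sym unfolding contracted_def by (intro sympI) blast
  show "irreflp contracted" unfolding contracted_def by (intro irreflpI) auto
qed

lemma card_nbrs_contracted:
  assumes "finite P" "p \<in> P"
  shows "card (nbrs contracted (P \<union> {u, t}) p) =
    card (nbrs E P p) + of_bool (\<exists>v\<in>U. E p v) + of_bool (\<exists>v\<in>T. E p v)"
proof -
  have "card (nbrs contracted (P \<union> {u, t}) p) =
      card (nbrs contracted P p) + (of_bool (contracted p u) + of_bool (contracted p t))"
    using assms representatives by (subst card_nbrs_Un_disjoint) (auto simp: card_nbrs_insert)
  moreover have "nbrs contracted P p = nbrs E P p"
    using assms by (auto simp: contracted_def nbrs_def)
  ultimately show ?thesis using assms by (simp add: contracted_def)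
qed

lemma rooted_contracted:
  assumes P: "finite P" "connected_in E P"
    and meets: "p \<in> P" "v \<in> U" "E p v" "q \<in> P" "w \<in> T" "E q w"
    and no_cutvertex: "\<And>D c. D \<noteq> {} \<Longrightarrow> D \<subseteq> P \<Longrightarrow> c \<in> P - D \<Longrightarrow> \<not> boundary E (P \<union> U \<union> T) D \<subseteq> {c}"
  shows "rooted contracted (P \<union> {u, t}) u t"
  unfolding rooted_def
proof (intro conjI allI impI notI)
  fix D c assume D: "D \<noteq> {}" "D \<subseteq> P \<union> {u, t} - {u, t}"
    and sep: "boundary contracted (P \<union> {u, t}) D \<subseteq> {c}"
  have "D \<subseteq> P" using D by auto
  have only_c: "b = c" if "a \<in> D" "b \<in> P \<union> {u, t} - D" "contracted a b" for a b
    using sep that unfolding boundary_def by blast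
  consider "c \<in> P - D" | "D = P" | "c \<notin> P - D" "D \<noteq> P" by blast
  then show False
  proof cases
    case 1
    obtain a b where ab: "a \<in> D" "b \<in> P \<union> U \<union> T - D" "b \<noteq> c" "E a b"
      using no_cutvertex[OF D(1) \<open>D \<subseteq> P\<close> 1] unfolding boundary_def by blast
    have "a \<in> P" using ab(1) \<open>D \<subseteq> P\<close> by blast
    define b' where "b' = (if b \<in> P then b else if b \<in> U then u else t)"
    have "contracted a b'" "b' \<in> P \<union> {u, t} - D"
      using ab \<open>a \<in> P\<close> \<open>D \<subseteq> P\<close> representatives unfolding b'_def contracted_def by auto
    then have "b' = c" using only_c ab(1) by blast
    then show False using 1 ab(3) representatives unfolding b'_def by (auto split: if_splits)
  next
    case 2
    have "contracted p u" "contracted q t" using meets unfolding contracted_def by auto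
    then have "u = c" "t = c" using only_c meets(1,4) 2 representatives by auto
    then show False using representatives by simp
  next
    case 3
    then obtain a b where "a \<in> D" "b \<in> P - D" "E a b"
      using D(1) \<open>D \<subseteq> P\<close> by (rule_tac connected_in_boundaryE[OF P(2)]) auto
    then have "contracted a b" "b \<in> P - D" using \<open>D \<subseteq> P\<close> unfolding contracted_def by auto
    then show False using only_c \<open>a \<in> D\<close> 3 by blast
  qed
qed (use P representatives in auto)

lemma path_lengths_contracted:
  assumes "p \<in> P" "n \<in> path_lengths contracted (insert u P) u p"
  obtains v where "v \<in> U" "n \<in> path_lengths E (insert v P) v p"
proof -
  obtain xs
    where xs: "path_in contracted (insert u P) xs" "hd xs = u" "last xs = p" "length xs = Suc n"
    using assms(2) by (rule path_lengthsE)
  obtain ys where ys: "xs = u # ys" using xs(1,2) unfolding path_in_def by (cases xs) auto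
  have nonempty: "ys \<noteq> []" using ys xs(3) assms(1) representatives by auto
  have inP: "set ys \<subseteq> P" using xs(1) ys unfolding path_in_def by auto
  have steps: "contracted u (hd ys)" "successively contracted ys"
    using xs(1) ys nonempty unfolding path_in_def by (auto simp: successively_Cons)
  have "hd ys \<in> P" using inP nonempty hd_in_set by blast
  then obtain v where v: "v \<in> U" "E v (hd ys)" using steps(1) unfolding contracted_def by auto
  have "successively E ys"
    using steps(2) by (rule successively_mono) (use inP in \<open>auto simp: contracted_def\<close>)
  then have "path_in E (insert v P) (v # ys)"
    using xs(1) ys inP v nonempty disjoint unfolding path_in_def by (auto simp: successively_Cons)
  from path_lengthsI[OF this, of n] show ?thesis using that[OF v(1)] xs ys nonempty by auto
qed

lemma linked_contracted:
  assumes "linked contracted P {u} {t} k" shows "linked E P U T k"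
proof -
  obtain p where p: "p \<in> P" "contracted p t"
    and lengths: "admissible k (path_lengths contracted (insert u P) u p)"
    using assms unfolding linked_def by auto
  have "path_lengths contracted (insert u P) u p \<subseteq> (\<Union>v\<in>U. path_lengths E (insert v P) v p)"
    using path_lengths_contracted[OF p(1)] by blast
  moreover have "\<exists>v\<in>T. E p v" using p unfolding contracted_def by auto
  ultimately show ?thesis unfolding linked_def using p(1) admissible_mono[OF lengths] by blast
qed

end

text \<open>The induction hypothesis of the linking theorem.\<close>

locale linking_below = adjacency E for E :: "'a \<Rightarrow> 'a \<Rightarrow> bool" +
  fixes N :: nat
  assumes linking: "\<And>(E' :: 'a \<Rightarrow> 'a \<Rightarrow> bool) V x y k.
    card V < N \<Longrightarrow> rooted_graph E' V x y k \<Longrightarrow> linked E' (V - {x, y}) {x} {y} k"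
begin

lemma linked_region:
  assumes "finite V" and P: "P \<subseteq> V" "connected_in E P" "card P + 2 < N"
    and UT: "U \<union> T \<union> L \<subseteq> V" "U \<inter> P = {}" "T \<inter> P = {}" "U \<inter> T = {}"
    and meets: "boundary E V P \<inter> U \<noteq> {}" "boundary E V P \<inter> T \<noteq> {}"
    and closed: "boundary E V P \<subseteq> U \<union> T \<union> L"
    and no_cutvertex: "\<And>D c. D \<noteq> {} \<Longrightarrow> D \<subseteq> P \<Longrightarrow> c \<in> P - D \<Longrightarrow> \<not> boundary E V D \<subseteq> insert c L"
    and degree: "\<And>p. p \<in> P \<Longrightarrow> k \<le> 1 \<or> k + 1 + card (nbrs E (U \<union> T \<union> L) p) \<le>
      card (nbrs E V p) + of_bool (\<exists>v\<in>U. E p v) + of_bool (\<exists>v\<in>T. E p v)"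
  shows "linked E P U T k"
proof -
  have fin: "finite P" "finite (U \<union> T \<union> L)" using assms(1) P(1) UT(1) finite_subset by blast+
  obtain p u q t where pu: "p \<in> P" "u \<in> U" "E p u" and qt: "q \<in> P" "t \<in> T" "E q t"
    using meets unfolding boundary_def by blast
  interpret contraction E P U T u t
    by unfold_locales (use UT pu qt in auto)
  have "rooted contracted (P \<union> {u, t}) u t"
  proof (rule rooted_contracted[OF fin(1) P(2) pu qt])
    fix D c assume D: "D \<noteq> {}" "D \<subseteq> P" "c \<in> P - D"
    obtain d v where dv: "d \<in> D" "v \<in> V - D" "v \<noteq> c" "v \<notin> L" "E d v"
      using no_cutvertex[OF D] unfolding boundary_def by blast
    then have "v \<in> P \<union> U \<union> T" using boundary_subsetD[OF closed, of d v] D(2) by blast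
    then show "\<not> boundary E (P \<union> U \<union> T) D \<subseteq> {c}" using dv unfolding boundary_def by blast
  qed
  moreover have "k \<le> 1 \<or> k + 1 \<le> card (nbrs contracted (P \<union> {u, t}) v)" if "v \<in> P" for v
    using degree[OF that] card_nbrs_le_boundary[OF assms(1) P(1) that closed fin(2)]
      card_nbrs_contracted[OF fin(1) that] by linarith
  moreover have "P \<union> {u, t} \<noteq> {u, t}" "P \<union> {u, t} - {u, t} = P" using representatives pu(1) by auto
  ultimately have "rooted_graph contracted (P \<union> {u, t}) u t k"
    unfolding rooted_graph_def using adjacency_contracted by auto
  moreover have "card (P \<union> {u, t}) < N" using P(3) fin(1) representatives by simp
  ultimately have "linked contracted P {u} {t} k"
    using linking \<open>P \<union> {u, t} - {u, t} = P\<close> by metis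
  then show ?thesis by (rule linked_contracted)
qed

end

subsection \<open>A minimal counterexample\<close>

locale minimal_unlinked = linking_below E "card V" for E :: "'a \<Rightarrow> 'a \<Rightarrow> bool" and V :: "'a set" +
  fixes x y :: 'a and k :: nat
  assumes rooted: "rooted E V x y" and nontrivial: "V \<noteq> {x, y}"
    and unlinked: "\<not> linked E (V - {x, y}) {x} {y} k"
begin

lemma finite_V [simp]: "finite V" and roots [simp]: "x \<in> V" "y \<in> V" "x \<noteq> y" "y \<noteq> x"
  using rooted unfolding rooted_def by auto

lemma boundary_not_singleton: "D \<noteq> {} \<Longrightarrow> D \<subseteq> V - {x, y} \<Longrightarrow> \<not> boundary E V D \<subseteq> {c}"
  using rooted by (rule rooted_boundary)

lemma k_ge_2: "2 \<le> k"
  using linked_if_le_1[OF rooted nontrivial, of k] unlinked by fastforce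

lemma not_admissible_to_neighbour:
  assumes "E y' y" "A \<subseteq> V - {y}" shows "\<not> admissible k (path_lengths E A x y')"
proof
  assume adm: "admissible k (path_lengths E A x y')"
  then obtain n where "n \<in> path_lengths E A x y'" using admissible_nonempty k_ge_2 by fastforce
  then have "y' \<in> A" by (rule path_lengths_endpoints)
  moreover have "y' \<noteq> x" using admissible_not_subset_0[OF adm k_ge_2] path_lengths_sameD by fastforce
  moreover have "insert x (V - {x, y}) = V - {y}" by auto
  then have "path_lengths E A x y' \<subseteq> path_lengths E (insert x (V - {x, y})) x y'"
    using path_lengths_mono[of _ E A x y'] assms(2) by auto
  from admissible_mono[OF adm this] have "admissible k (path_lengths E (insert x (V - {x, y})) x y')" .
  ultimately show False using unlinked assms unfolding linked_def by auto
qed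

lemma not_admissible_before_tail:
  assumes "A \<subseteq> V - {y}" and tail: "m \<in> path_lengths E S c y" "S \<subseteq> V" "S \<inter> A \<subseteq> {c}"
  shows "\<not> admissible k (path_lengths E A x c)"
proof
  assume adm: "admissible k (path_lengths E A x c)"
  then obtain n where "n \<in> path_lengths E A x c" using admissible_nonempty k_ge_2 by fastforce
  then have "c \<noteq> y" using path_lengths_endpoints(2) assms(1) by fastforce
  then obtain y' j where y': "E y' y" "y' \<in> S" "y' \<noteq> y" "j \<in> path_lengths E (S - {y}) c y'"
    using path_lengths_penultimate[OF tail(1)] by metis
  have "admissible k (path_lengths E (A \<union> (S - {y})) x y')"
    using adm by (rule admissible_shift[where c = j]) (rule path_lengths_join, use y' tail(3) in auto)
  then show False using not_admissible_to_neighbour[OF y'(1), of "A \<union> (S - {y})"] assms(1) tail(2)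
    by auto
qed

lemma not_admissible_before_edge:
  assumes "A \<subseteq> V - {y}" "E p t" "t \<notin> A" and tail: "path_lengths E (V - A) t y \<noteq> {}"
  shows "\<not> admissible k (path_lengths E A x p)"
proof
  assume adm: "admissible k (path_lengths E A x p)"
  then obtain n where "n \<in> path_lengths E A x p" using admissible_nonempty k_ge_2 by fastforce
  then have "p \<in> A" by (rule path_lengths_endpoints)
  obtain m where "m \<in> path_lengths E (V - A) t y" using tail by blast
  then have "Suc m \<in> path_lengths E (insert p (V - A)) p y"
    by (rule path_lengths_Cons) (use \<open>p \<in> A\<close> assms(2) in auto)
  then show False
    using not_admissible_before_tail[OF assms(1)] adm \<open>p \<in> A\<close> assms(1) by auto
qed

lemma card_add_2_less:
  assumes "P \<subseteq> V" "{a, b, c} \<subseteq> V - P" "distinct [a, b, c]"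
  shows "card P + 2 < card V"
proof -
  have "finite P" using assms(1) finite_subset[OF _ finite_V] by blast
  then have "card P + 3 = card (P \<union> {a, b, c})"
    using assms(2,3) by (subst card_Un_disjoint) auto
  also have "\<dots> \<le> card V" by (rule card_mono) (use assms in auto)
  finally show ?thesis by simp
qed

lemma linked_if_closed:
  assumes P: "P \<subseteq> V - {x, y}" "connected_in E P" "card P + 2 < card V"
    and UT: "U \<union> T \<subseteq> V - P" "U \<inter> T = {}"
    and meets: "boundary E V P \<inter> U \<noteq> {}" "boundary E V P \<inter> T \<noteq> {}"
    and closed: "boundary E V P \<subseteq> U \<union> T"
    and single: "\<And>p. p \<in> P \<Longrightarrow> card (nbrs E U p) \<le> 1" "\<And>p. p \<in> P \<Longrightarrow> card (nbrs E T p) \<le> 1"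
    and degree: "\<And>p. p \<in> P \<Longrightarrow> k + 1 \<le> card (nbrs E V p)"
  shows "linked E P U T k"
proof (rule linked_region[where L = "{}", OF finite_V])
  show "\<not> boundary E V D \<subseteq> insert c {}" if "D \<noteq> {}" "D \<subseteq> P" for D c
    using boundary_not_singleton[OF that(1)] that(2) P(1) by auto
  have "finite (U \<union> T)" using UT(1) finite_subset[OF _ finite_V] by blast
  then have "card (nbrs E (U \<union> T \<union> {}) p) \<le> of_bool (\<exists>v\<in>U. E p v) + of_bool (\<exists>v\<in>T. E p v)"
    if "p \<in> P" for p
    using single[OF that] card_nbrs_eq_0[of U E p] card_nbrs_eq_0[of T E p] UT(2)
    by (simp add: card_nbrs_Un_disjoint)
  then show "k \<le> 1 \<or> k + 1 + card (nbrs E (U \<union> T \<union> {}) p) \<le>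
      card (nbrs E V p) + of_bool (\<exists>v\<in>U. E p v) + of_bool (\<exists>v\<in>T. E p v)" if "p \<in> P" for p
    using degree[OF that] that by fastforce
qed (use P UT meets closed in auto)

lemma linked_pair:
  assumes P: "P \<noteq> {}" "P \<subseteq> V - {x, y}" "connected_in E P" and ab: "a \<in> V - P" "b \<in> V - P" "a \<noteq> b"
    and closed: "boundary E V P \<subseteq> {a, b}" and "V - P - {a, b} \<noteq> {}"
    and degree: "\<And>p. p \<in> P \<Longrightarrow> k + 1 \<le> card (nbrs E V p)"
  shows "linked E P {a} {b} k"
proof -
  obtain c where "c \<in> V - P - {a, b}" using assms(8) by blast
  then have "card P + 2 < card V" using P ab by (intro card_add_2_less[of P a b c]) auto
  moreover have "boundary E V P \<inter> {a} \<noteq> {}" "boundary E V P \<inter> {b} \<noteq> {}"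
    using closed boundary_not_singleton[OF P(1,2), of a] boundary_not_singleton[OF P(1,2), of b]
    by blast+
  ultimately show ?thesis using P ab closed degree by (intro linked_if_closed) auto
qed

lemma boundary_not_pair_x:
  assumes D: "D \<noteq> {}" "D \<subseteq> V - {x, y}" and c: "c \<in> V - D" "c \<noteq> x" and "V - D - {x, c} \<noteq> {}"
    and degree: "\<And>d. d \<in> D \<Longrightarrow> k + 1 \<le> card (nbrs E V d)"
  shows "\<not> boundary E V D \<subseteq> {x, c}"
proof
  assume sep: "boundary E V D \<subseteq> {x, c}"
  obtain d where "d \<in> D" using D(1) by blast
  then obtain P where P: "component E D P" by (rule ex_component[OF sym])
  note sub = componentD(2)[OF P]
  have closed: "boundary E V P \<subseteq> {x, c}" using component_boundary[OF P] sep by blast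
  have "linked E P {x} {c} k"
    by (rule linked_pair[OF componentD(1)[OF P] _ componentD(3)[OF P] _ _ _ closed])
      (use D c assms(5) sub degree in auto)
  then obtain p where p: "p \<in> P" "E p c" and adm: "admissible k (path_lengths E (insert x P) x p)"
    unfolding linked_def by auto
  have "path_lengths E (V - insert x P) c y \<noteq> {}"
    by (rule rooted_path_avoiding[OF rooted _ closed]) (use sub D c in auto)
  then have "\<not> admissible k (path_lengths E (insert x P) x p)"
    by (intro not_admissible_before_edge[OF _ p(2)]) (use sub D c in auto)
  then show False using adm by contradiction
qed

lemma boundary_not_pair_y:
  assumes D: "D \<noteq> {}" "D \<subseteq> V - {x, y}" and c: "c \<in> V - D" "c \<noteq> x" "c \<noteq> y"
    and degree: "\<And>d. d \<in> D \<Longrightarrow> k + 1 \<le> card (nbrs E V d)"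
  shows "\<not> boundary E V D \<subseteq> {y, c}"
proof
  assume sep: "boundary E V D \<subseteq> {y, c}"
  obtain d where "d \<in> D" using D(1) by blast
  then obtain P where P: "component E D P" by (rule ex_component[OF sym])
  note sub = componentD(2)[OF P]
  have closed: "boundary E V P \<subseteq> {y, c}" using component_boundary[OF P] sep by blast
  have "linked E P {c} {y} k"
  proof (rule linked_pair[OF componentD(1)[OF P] _ componentD(3)[OF P]])
    have "x \<in> V - P - {c, y}" using D c sub by auto
    then show "V - P - {c, y} \<noteq> {}" by blast
  qed (use D c sub degree closed in auto)
  then obtain p where p: "p \<in> P" "E p y" and adm: "admissible k (path_lengths E (insert c P) c p)"
    unfolding linked_def by auto
  have "path_lengths E (V - insert y P) c x \<noteq> {}"
    by (rule rooted_path_avoiding[OF rooted[unfolded rooted_commute[of E V x y]] _ closed])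
      (use sub D c in auto)
  then obtain m where m: "m \<in> path_lengths E (V - insert y P) x c"
    using path_lengths_rev[OF sym] by blast
  have "admissible k (path_lengths E ((V - insert y P) \<union> insert c P) x p)"
    using adm by (rule admissible_shift[where c = m])
      (use path_lengths_join[OF m, of _ "insert c P" p] in \<open>auto simp: add.commute\<close>)
  then show False
    using not_admissible_to_neighbour[OF p(2), of "(V - insert y P) \<union> insert c P"] sub D(2) c by auto
qed

lemma boundary_not_triple:
  assumes a: "a \<in> V" "a \<noteq> x" "a \<noteq> y" and D: "D \<noteq> {}" "D \<subseteq> V - {x, y, a}" "connected_in E D"
    and c: "c \<in> V - D" "c \<notin> {x, a, y}"
    and no_common: "\<And>d. d \<in> D \<Longrightarrow> \<not> (E d x \<and> E d a)"
    and degree: "\<And>d. d \<in> D \<Longrightarrow> k + 1 \<le> card (nbrs E V d)"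
    and head: "path_lengths E A x a \<noteq> {}" "A \<subseteq> V - {y}" "A \<inter> insert c D = {}"
    and tail: "path_lengths E (V - A - D) c y \<noteq> {}"
  shows "\<not> boundary E V D \<subseteq> {x, a, c}"
proof
  assume closed: "boundary E V D \<subseteq> {x, a, c}"
  have Dxy: "D \<subseteq> V - {x, y}" using D by auto
  have "c \<in> V - D - {x, a}" using c by auto
  then have "\<not> boundary E V D \<subseteq> {x, a}"
    using boundary_not_pair_x[OF D(1) Dxy _ a(2)] degree a D(2) by blast
  then have meets_c: "boundary E V D \<inter> {c} \<noteq> {}" using closed by blast
  have meets_xa: "boundary E V D \<inter> {x, a} \<noteq> {}"
    using boundary_not_singleton[OF D(1) Dxy, of c] closed by blast
  have "card D + 2 < card V"
    by (rule card_add_2_less[of _ x a c]) (use D a c in auto)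
  then have "linked E D {c} {x, a} k"
    using D a c meets_c meets_xa closed no_common degree
    by (intro linked_if_closed[OF Dxy D(3)] card_nbrs_pair_le_1) auto
  moreover have "x \<in> A" using head(1) path_lengths_endpoints(1)[of _ E A x a] by blast
  then have "path_lengths E A x b \<noteq> {}" if "b \<in> {x, a}" for b
    using that head(1) path_lengths_refl[of x A E] by auto
  ultimately have "admissible k (path_lengths E (A \<union> insert c D) x c)"
    by (rule admissible_linked_reverse[OF _ _ head(3)])
  moreover have "A \<union> insert c D \<subseteq> V - {y}" using head(2) c D(2) by auto
  moreover obtain r where "r \<in> path_lengths E (V - A - D) c y" using tail by blast
  ultimately show False
    using not_admissible_before_tail[of "A \<union> insert c D" r "V - A - D" c] by blast
qed

subsection \<open>Hubs\<close>

text \<open>A hub is a dense set at \<open>x\<close>, to be contracted to its exits \<open>U\<close>. The contraction costs a light vertex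
  at most \<open>l\<close> neighbours, which the \<open>l + 1\<close> common path lengths inside \<open>Q\<close> make up for.\<close>

definition hub :: "'a set \<Rightarrow> 'a set \<Rightarrow> nat \<Rightarrow> bool" where
  "hub Q U l \<longleftrightarrow> Q \<subseteq> V - {y} \<and> x \<in> Q \<and> U \<subseteq> Q - {x} \<and>
     admissible (l + 1) (\<Inter>u\<in>U. path_lengths E Q x u)"

definition light :: "'a set \<Rightarrow> 'a set \<Rightarrow> nat \<Rightarrow> 'a \<Rightarrow> bool" where
  "light Q U l p \<longleftrightarrow> card (nbrs E Q p) \<le> l + of_bool (\<exists>u\<in>U. E p u)"

definition pendant :: "'a set \<Rightarrow> 'a set \<Rightarrow> 'a set \<Rightarrow> 'a \<Rightarrow> bool" where
  "pendant Q U D c \<longleftrightarrow> connected_in E D \<and> D \<subseteq> V - Q - {y} \<and> c \<in> boundary E V D - Q \<and>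
     boundary E V D \<subseteq> insert c (Q - U) \<and> path_lengths E (V - Q - D) c y \<noteq> {}"

lemma hubD:
  assumes "hub Q U l"
  shows "Q \<subseteq> V - {y}" "x \<in> Q" "U \<subseteq> Q" "x \<notin> U" "finite Q"
  using assms finite_subset[of Q V] unfolding hub_def by auto

lemma pendantD:
  assumes "pendant Q U D c"
  shows "D \<noteq> {}" "D \<subseteq> V - Q - {y}" "connected_in E D" "c \<in> V - Q - D" "boundary E V D \<subseteq> insert c (Q - U)"
    "c \<in> boundary E V D" "path_lengths E (V - Q - D) c y \<noteq> {}"
  using assms unfolding pendant_def by auto

lemma hub_region_absurd:
  assumes hub: "hub Q U l" and P: "P \<subseteq> V - Q - {y}" "connected_in E P"
    and t: "t \<in> boundary E V P - Q" and meets_U: "boundary E V P \<inter> U \<noteq> {}"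
    and closed: "boundary E V P \<subseteq> insert t Q"
    and no_cutvertex: "\<And>D c. D \<noteq> {} \<Longrightarrow> D \<subseteq> P \<Longrightarrow> c \<in> P - D \<Longrightarrow> \<not> boundary E V D \<subseteq> insert c (Q - U)"
    and degree: "\<And>p. p \<in> P \<Longrightarrow> k + 1 \<le> card (nbrs E V p)"
    and light: "\<And>p. p \<in> P \<Longrightarrow> light Q U l p"
    and tail: "path_lengths E (V - Q - P) t y \<noteq> {}"
  shows False
proof -
  note Q = hubD[OF hub]
  define k' where "k' = max 1 (k - l)"
  have Q_exits: "U \<union> {t} \<union> (Q - U) = insert t Q" using Q by auto
  obtain u where u: "u \<in> U" using meets_U by blast
  have "card P + 2 < card V"
    by (rule card_add_2_less[of _ x u t]) (use P Q t u in auto)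
  have "linked E P U {t} k'"
  proof (rule linked_region[where L = "Q - U", OF finite_V _ P(2)])
    show "k' \<le> 1 \<or> k' + 1 + card (nbrs E (U \<union> {t} \<union> (Q - U)) p) \<le>
        card (nbrs E V p) + of_bool (\<exists>v\<in>U. E p v) + of_bool (\<exists>v\<in>{t}. E p v)" if "p \<in> P" for p
    proof -
      have "card (nbrs E (insert t Q) p) = of_bool (\<exists>v\<in>{t}. E p v) + card (nbrs E Q p)"
        using t Q(5) by (simp add: card_nbrs_insert)
      moreover have "k' \<le> 1 \<or> k' + l = k" unfolding k'_def by auto
      ultimately show ?thesis
        using degree[OF that] light[OF that] unfolding light_def Q_exits by linarith
    qed
    show "boundary E V P \<subseteq> U \<union> {t} \<union> (Q - U)" unfolding Q_exits by (rule closed)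
  qed (use P Q t meets_U no_cutvertex \<open>card P + 2 < card V\<close> in auto)
  then obtain p where p: "p \<in> P" "E p t" "admissible k' (\<Union>u\<in>U. path_lengths E (insert u P) u p)"
    unfolding linked_def by auto
  have "admissible (k' + (l + 1) - 1) (path_lengths E (Q \<union> P) x p)"
  proof (rule admissible_sum[OF p(3)])
    show "admissible (l + 1) (\<Inter>u\<in>U. path_lengths E Q x u)" using hub unfolding hub_def by blast
    fix n m assume n: "n \<in> (\<Union>u\<in>U. path_lengths E (insert u P) u p)"
      and m: "m \<in> (\<Inter>u\<in>U. path_lengths E Q x u)"
    obtain v where v: "v \<in> U" "n \<in> path_lengths E (insert v P) v p" using n by blast
    have "m + n \<in> path_lengths E (Q \<union> insert v P) x p"
      by (rule path_lengths_join[OF _ v(2)]) (use m v(1) P(1) in auto)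
    moreover have "Q \<union> insert v P = Q \<union> P" using v(1) Q(3) by auto
    ultimately show "n + m \<in> path_lengths E (Q \<union> P) x p" by (simp add: add.commute)
  qed (auto simp: k'_def)
  then have "admissible k (path_lengths E (Q \<union> P) x p)" by (rule admissible_le) (simp add: k'_def)
  moreover have "V - (Q \<union> P) = V - Q - P" by auto
  ultimately show False
    using not_admissible_before_edge[OF _ p(2), of "Q \<union> P"] Q(1) P(1) t tail by auto
qed

lemma ex_pendant:
  assumes P: "P \<subseteq> R" "connected_in E P" and R: "R \<subseteq> V - Q - {y}"
    and t: "t \<in> boundary E V P - Q - R" and tail: "path_lengths E (V - Q - R) t y \<noteq> {}"
    and D: "D \<noteq> {}" "D \<subseteq> P" "c \<in> P - D" and closed: "boundary E V D \<subseteq> insert c (Q - U)"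
  obtains C where "C \<subseteq> D" "pendant Q U C c"
proof -
  obtain d where "d \<in> D" using D(1) by blast
  then obtain C where C: "component E D C" by (rule ex_component[OF sym])
  note sub = componentD(2)[OF C]
  have closed_C: "boundary E V C \<subseteq> insert c (Q - U)" using component_boundary[OF C] closed by blast
  have "C \<subseteq> P" "C \<noteq> P" using sub D by auto
  then obtain e f where "e \<in> C" "f \<in> P - C" "E e f"
    by (rule connected_in_boundaryE[OF P(2) componentD(1)[OF C]])
  moreover from this have "f = c" using boundary_subsetD[OF closed_C, of e f] P(1) R by blast
  ultimately have c: "c \<in> boundary E V C - Q" using P(1) R D(3) sub by auto
  obtain p where p: "p \<in> P" "E p t" using t by auto
  have "connected_in E (insert t P)" by (rule connected_in_insert[OF sym P(2) p])
  moreover have "boundary E (insert t P) (insert t P \<inter> C) \<subseteq> {c}"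
  proof
    fix v assume "v \<in> boundary E (insert t P) (insert t P \<inter> C)"
    then obtain e where "e \<in> C" "E e v" "v \<in> insert t P" "v \<notin> C" unfolding boundary_def by blast
    then show "v \<in> {c}" using boundary_subsetD[OF closed_C, of e v] P(1) R t by auto
  qed
  ultimately have "connected_in E (insert t P - C)"
    using D(3) sub by (intro connected_in_remove[OF sym, of _ c]) auto
  then obtain n where n: "n \<in> path_lengths E (insert t P - C) c t"
    using connected_in_path[of E "insert t P - C" c t] D(3) sub t P(1) D(2) by auto
  obtain m where m: "m \<in> path_lengths E (V - Q - R) t y" using tail by blast
  have "n + m \<in> path_lengths E ((insert t P - C) \<union> (V - Q - R)) c y"
    by (rule path_lengths_join[OF n m]) (use P(1) in auto)
  then have "n + m \<in> path_lengths E (V - Q - C) c y"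
    by (rule path_lengths_mono) (use P(1) R t sub D(2) in auto)
  then have "pendant Q U C c"
    unfolding pendant_def using componentD(3)[OF C] sub D(2) P(1) R c closed_C by auto
  then show ?thesis using that sub by blast
qed

lemma region_absurd:
  assumes hub: "hub Q U l" and R: "R \<subseteq> V - Q - {y}"
    and t: "t \<in> boundary E V R - Q" and closed: "boundary E V R \<subseteq> insert t Q"
    and degree: "\<And>p. p \<in> R \<Longrightarrow> k + 1 \<le> card (nbrs E V p)"
    and light: "\<And>p. p \<in> R \<Longrightarrow> light Q U l p"
    and tail: "path_lengths E (V - Q - R) t y \<noteq> {}"
    and no_pendant: "\<And>D c. D \<subseteq> R \<Longrightarrow> c \<noteq> y \<Longrightarrow> \<not> pendant Q U D c"
    and no_block: "\<And>W. t = y \<Longrightarrow> W \<subseteq> R \<Longrightarrow> y \<in> boundary E V W \<Longrightarrow> boundary E V W \<subseteq> insert y (Q - U) \<Longrightarrow>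
      y \<in> boundary E V (R - W) "
  shows False
proof (cases "\<exists>P. component E R P \<and> t \<in> boundary E V P \<and> boundary E V P \<inter> U \<noteq> {}")
  case True
  then obtain P where P: "component E R P" "t \<in> boundary E V P" "boundary E V P \<inter> U \<noteq> {}" by blast
  note sub = componentD(2)[OF P(1)]
  show False
  proof (rule hub_region_absurd[OF hub _ componentD(3)[OF P(1)] _ P(3)])
    fix D c assume D: "D \<noteq> {}" "D \<subseteq> P" "c \<in> P - D"
    show "\<not> boundary E V D \<subseteq> insert c (Q - U)"
    proof
      assume sep: "boundary E V D \<subseteq> insert c (Q - U)"
      have "t \<in> boundary E V P - Q - R" using t P(2) by auto
      then obtain C where "C \<subseteq> D" "pendant Q U C c"
        by (rule ex_pendant[OF sub componentD(3)[OF P(1)] R _ tail D sep])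
      then show False using no_pendant[of C c] D sub R by auto
    qed
  next
    obtain m where "m \<in> path_lengths E (V - Q - R) t y" using tail by blast
    then have "m \<in> path_lengths E (V - Q - P) t y" by (rule path_lengths_mono) (use sub in auto)
    then show "path_lengths E (V - Q - P) t y \<noteq> {}" by blast
  qed (use sub R t P(2) closed component_boundary[OF P(1), of V] degree light in auto)
next
  case no_exit: False
  have closed_component: "boundary E V P \<subseteq> insert t (Q - U)"
    if "component E R P" "t \<in> boundary E V P" for P
    using no_exit that component_boundary[OF that(1), of V] closed by blast
  obtain r where r: "r \<in> R" "E r t" using t by auto
  obtain P where P: "r \<in> P" "component E R P" using ex_component[OF sym r(1)] .
  note sub = componentD(2)[OF P(2)]
  have t_P: "t \<in> boundary E V P" using P(1) r t sub by auto
  obtain m where "m \<in> path_lengths E (V - Q - R) t y" using tail by blast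
  then have "m \<in> path_lengths E (V - Q - P) t y" by (rule path_lengths_mono) (use sub in auto)
  then have "pendant Q U P t"
    unfolding pendant_def using componentD(3)[OF P(2)] sub R t t_P closed_component[OF P(2) t_P]
    by auto
  then have ty: "t = y" using no_pendant[OF sub] by blast
  obtain W
    where "W \<subseteq> R" "t \<in> boundary E V W" "boundary E V W \<subseteq> insert t (Q - U)" "t \<notin> boundary E V (R - W)"
    using ex_union_of_components[of t V R "Q - U"] t closed_component by blast
  then show False using no_block[OF ty] unfolding ty by blast
qed

text \<open>A vertex that is not light would enlarge a maximal hub, unless all other neighbours of \<open>y\<close> lie in the
  hub. The component containing it is then left through it instead of through \<open>y\<close>.\<close>

lemma maximal_hub_absurd:
  assumes hub: "hub Q U l" and outside: "\<exists>z\<in>V - Q. E z y"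
    and degree: "\<And>p. p \<in> V - Q - {y} \<Longrightarrow> k + 1 \<le> card (nbrs E V p)"
    and maximal: "\<And>w. w \<in> V - Q - {y} \<Longrightarrow> \<not> light Q U l w \<Longrightarrow> nbrs E V y \<subseteq> insert w Q"
    and no_last: "\<And>w. w \<in> V - Q - {y} \<Longrightarrow> \<not> light Q U l w \<Longrightarrow> E w y \<Longrightarrow> nbrs E V y \<subseteq> insert w Q \<Longrightarrow>
      \<not> nbrs E V w \<subseteq> insert y Q"
    and no_pendant: "\<And>D c. c \<noteq> y \<Longrightarrow> \<not> pendant Q U D c"
    and no_block: "\<And>W. W \<subseteq> V - Q - {y} \<Longrightarrow> y \<in> boundary E V W \<Longrightarrow> boundary E V W \<subseteq> insert y (Q - U) \<Longrightarrow>
      y \<in> boundary E V (V - Q - {y} - W)"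
  shows False
proof (cases "\<exists>w\<in>V - Q - {y}. \<not> light Q U l w")
  case False
  show False
  proof (rule region_absurd[OF hub subset_refl])
    show "y \<in> boundary E V (V - Q - {y}) - Q" using outside hubD(1)[OF hub] by auto
    show "path_lengths E (V - Q - (V - Q - {y})) y y \<noteq> {}"
      using hubD(1)[OF hub] by (intro path_lengths_edge_nonempty) auto
  qed (use False degree no_pendant no_block in auto)
next
  case True
  then obtain w where w: "w \<in> V - Q - {y}" "\<not> light Q U l w" by blast
  have y_nbrs: "nbrs E V y \<subseteq> insert w Q" by (rule maximal[OF w])
  then have "E w y" using outside E_sym by (auto simp: subset_iff)
  then obtain v where v: "v \<in> V" "E w v" "v \<noteq> y" "v \<notin> Q"
    using no_last[OF w _ y_nbrs] unfolding nbrs_def by blast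
  let ?R = "V - Q - {y, w}"
  show False
  proof (rule region_absurd[OF hub, of ?R w])
    show "w \<in> boundary E V ?R - Q" using w v E_sym[OF v(2)] by auto
    show "boundary E V ?R \<subseteq> insert w Q" using y_nbrs E_sym by (auto simp: subset_iff)
    show "path_lengths E (V - Q - ?R) w y \<noteq> {}"
      using w \<open>E w y\<close> hubD(1)[OF hub] by (intro path_lengths_edge_nonempty) auto
    show "light Q U l p" if "p \<in> ?R" for p
    proof (rule ccontr)
      assume "\<not> light Q U l p"
      then have "w \<in> insert p Q" using maximal[of p] that w E_sym[OF \<open>E w y\<close>] by auto
      then show False using w that by auto
    qed
  qed (use degree no_pendant w in auto)
qed

end

subsection \<open>Cliques at the root\<close>

lemma pairwise_successively: "pairwise E Q \<Longrightarrow> distinct xs \<Longrightarrow> set xs \<subseteq> Q \<Longrightarrow> successively E xs"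
proof (induction xs)
  case (Cons v xs)
  then show ?case by (cases xs) (auto simp: pairwise_def)
qed simp

lemma ex_distinct_list:
  assumes "n \<le> card A"
  obtains xs where "distinct xs" "set xs \<subseteq> A" "length xs = n"
proof -
  obtain B where B: "B \<subseteq> A" "card B = n" "finite B"
    using obtain_subset_with_card_n[OF assms] by metis
  obtain xs where "set xs = B" "distinct xs" using finite_distinct_list[OF B(3)] by blast
  then show ?thesis using that[of xs] B distinct_card by fastforce
qed

lemma clique_path_lengths:
  assumes "pairwise E Q" "finite Q" "x \<in> Q" "u \<in> Q" "u \<noteq> x" "1 \<le> n" "n < card Q"
  shows "n \<in> path_lengths E Q x u"
proof -
  have "card (Q - {x, u}) = card Q - 2" using assms by (subst card_Diff_subset) auto
  then have "n - 1 \<le> card (Q - {x, u})" using assms by simp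
  then obtain xs where xs: "distinct xs" "set xs \<subseteq> Q - {x, u}" "length xs = n - 1"
    by (rule ex_distinct_list)
  have "path_in E Q (x # xs @ [u])"
    unfolding path_in_def using xs assms pairwise_successively[OF assms(1), of "x # xs @ [u]"] by auto
  from path_lengthsI[OF this, of n] show ?thesis using xs(3) assms(6) by simp
qed

context adjacency
begin

lemma pairwise_insert_nbr: "pairwise E Q \<Longrightarrow> \<forall>q\<in>Q. E w q \<Longrightarrow> pairwise E (insert w Q)"
  using E_sym unfolding pairwise_def by blast

end

context minimal_unlinked
begin

lemma hub_clique:
  assumes "Q \<subseteq> V - {y}" "x \<in> Q" "pairwise E Q" "2 \<le> card Q"
  shows "hub Q (Q - {x}) (card Q - 2)"
proof -
  have "finite Q" using assms(1) finite_subset[OF _ finite_V] by blast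
  then have "1 + i \<in> (\<Inter>u\<in>Q - {x}. path_lengths E Q x u)" if "i < card Q - 2 + 1" for i
    using that assms(2-4) by (auto intro!: clique_path_lengths)
  then have "admissible (card Q - 2 + 1) (\<Inter>u\<in>Q - {x}. path_lengths E Q x u)"
    by (rule admissible_step_1I)
  then show ?thesis unfolding hub_def using assms by auto
qed

lemma light_clique:
  assumes "finite Q" "3 \<le> card Q" "q \<in> Q" "\<not> E w q"
  shows "light Q (Q - {x}) (card Q - 2) w"
proof (cases "\<exists>u\<in>Q - {x}. E w u")
  case True
  then show ?thesis using card_nbrs_less[of Q q E w] assms unfolding light_def by simp
next
  case False
  then have "nbrs E Q w \<subseteq> {x}" by auto
  then have "card (nbrs E Q w) \<le> 1" using card_mono[of "{x}"] by fastforce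
  then show ?thesis using assms(2) unfolding light_def by simp
qed

lemma maximal_clique_absurd:
  assumes Q: "Q \<subseteq> V - {y}" "x \<in> Q" "pairwise E Q" "3 \<le> card Q" and outside: "\<exists>z\<in>V - Q. E z y"
    and maximal: "\<And>w. w \<in> V - Q - {y} \<Longrightarrow> \<forall>q\<in>Q. E w q \<Longrightarrow> nbrs E V y \<subseteq> insert w Q"
    and degree: "\<And>v. v \<in> V - Q - {y} \<Longrightarrow> k + 1 \<le> card (nbrs E V v)"
  shows False
proof -
  have finQ: "finite Q" using Q(1) finite_subset[OF _ finite_V] by blast
  have complete: "\<forall>q\<in>Q. E w q" if "\<not> light Q (Q - {x}) (card Q - 2) w" for w
    using light_clique[OF finQ Q(4)] that by blast
  have "card (Q - {x}) \<noteq> 0" using Q(2,4) finQ by simp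
  then have "Q - {x} \<noteq> {}" by force
  then obtain u where u: "u \<in> Q" "u \<noteq> x" by blast
  have not_sep: "\<not> boundary E V D \<subseteq> {x, c}" if "D \<noteq> {}" "D \<subseteq> V - Q - {y}" "c \<in> V - Q - D" for D c
  proof (rule boundary_not_pair_x)
    have "u \<in> V - D - {x, c}" using u Q(1) that by auto
    then show "V - D - {x, c} \<noteq> {}" by blast
  qed (use that Q degree in auto)
  have hub: "hub Q (Q - {x}) (card Q - 2)" using Q by (intro hub_clique) auto
  have x_only: "Q - (Q - {x}) = {x}" using Q(2) by auto
  show False
  proof (rule maximal_hub_absurd[OF hub outside degree])
    show "nbrs E V y \<subseteq> insert w Q" if "w \<in> V - Q - {y}" "\<not> light Q (Q - {x}) (card Q - 2) w" for w
      using maximal[OF that(1) complete[OF that(2)]] .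
    show "\<not> pendant Q (Q - {x}) D c" for D c
      using not_sep[of D c] pendantD[of Q "Q - {x}" D c] unfolding x_only by auto
    show "y \<in> boundary E V (V - Q - {y} - W)"
      if "W \<subseteq> V - Q - {y}" "y \<in> boundary E V W" "boundary E V W \<subseteq> insert y (Q - (Q - {x}))" for W
      using not_sep[of W y] that Q(1) unfolding x_only by auto
    show "\<not> nbrs E V w \<subseteq> insert y Q"
      if w: "w \<in> V - Q - {y}" "\<not> light Q (Q - {x}) (card Q - 2) w" "E w y" for w
    proof
      assume "nbrs E V w \<subseteq> insert y Q"
      then have "card (nbrs E V w) \<le> card (insert y Q)" using finQ by (intro card_mono) auto
      then have "k \<le> card Q" using degree[OF w(1)] finQ
        by (auto simp: card_insert_if split: if_splits)
      then have "1 + i \<in> path_lengths E (insert w Q) x w" if "i < k" for i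
        using w(1) finQ Q(2) that pairwise_insert_nbr[OF Q(3) complete[OF w(2)]]
        by (intro clique_path_lengths) auto
      then have "admissible k (path_lengths E (insert w Q) x w)" by (rule admissible_step_1I)
      then show False using not_admissible_to_neighbour[OF w(3), of "insert w Q"] w(1) Q(1) by auto
    qed
  qed
qed

lemma clique_absurd:
  assumes K: "K \<subseteq> V - {y}" "x \<in> K" "pairwise E K" "3 \<le> card K" and z: "z \<in> V - K" "E z y"
    and degree: "\<And>v. v \<in> V - K - {y} \<Longrightarrow> k + 1 \<le> card (nbrs E V v)"
  shows False
proof -
  define cliques where
    "cliques = {Q. K \<subseteq> Q \<and> Q \<subseteq> V - {y} \<and> pairwise E Q \<and> (\<exists>z\<in>V - Q. E z y)}"
  have "finite cliques" by (rule finite_subset[of _ "Pow V"]) (auto simp: cliques_def)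
  moreover have "K \<in> cliques" using K z unfolding cliques_def by blast
  ultimately obtain Q where "Q \<in> cliques" and maximal: "\<And>Q'. Q' \<in> cliques \<Longrightarrow> Q \<subseteq> Q' \<Longrightarrow> Q = Q'"
    using finite_has_maximal2[of cliques K] by metis
  then have Q: "K \<subseteq> Q" "Q \<subseteq> V - {y}" "pairwise E Q" "\<exists>z\<in>V - Q. E z y"
    unfolding cliques_def by auto
  show False
  proof (rule maximal_clique_absurd[OF Q(2) _ Q(3) _ Q(4)])
    show "3 \<le> card Q" using K(4) card_mono[OF _ Q(1)] Q(2) finite_subset[of Q V] by force
    show "nbrs E V y \<subseteq> insert w Q" if w: "w \<in> V - Q - {y}" "\<forall>q\<in>Q. E w q" for w
    proof
      fix v assume "v \<in> nbrs E V y"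
      then have v: "v \<in> V" "E v y" using E_sym by auto
      show "v \<in> insert w Q"
      proof (rule ccontr)
        assume "v \<notin> insert w Q"
        then have "insert w Q \<in> cliques"
          using v w Q pairwise_insert_nbr[OF Q(3) w(2)] unfolding cliques_def by blast
        then show False using maximal w(1) by blast
      qed
    qed
  qed (use K Q degree in auto)
qed

end

subsection \<open>Triangles at the roots\<close>

locale minimal_counterexample = minimal_unlinked +
  assumes degree: "\<And>v. v \<in> V - {x, y} \<Longrightarrow> k + 1 \<le> card (nbrs E V v)"
begin

lemma ex_fourth_vertex:
  assumes "b \<in> V - {x, y}" shows "V - {x, y, b} \<noteq> {}"
proof
  assume "V - {x, y, b} = {}"
  then have "nbrs E V b \<subseteq> {x, y}" by auto
  then have "card (nbrs E V b) \<le> card {x, y}" by (rule card_mono[rotated]) simp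
  then show False using degree[OF assms] k_ge_2 by simp
qed

lemma ex_triangle_at_y:
  "\<exists>u\<in>V - {x}. \<exists>v\<in>V - {x}. E u y \<and> E v y \<and> E u v"
proof (rule ccontr)
  assume "\<not> ?thesis"
  then have no_triangle: "\<not> (E u y \<and> E v y \<and> E u v)" if "u \<in> V - {x}" "v \<in> V - {x}" for u v
    using that by blast
  have "V - {x, y} \<noteq> {}" using nontrivial by auto
  from boundary_not_singleton[OF this, of x] obtain b where b: "b \<in> V - {x, y}" "E b y"
    unfolding boundary_def by blast
  obtain v where "v \<in> V - {x, y, b}" using ex_fourth_vertex[OF b(1)] by blast
  then obtain P where P: "component E (V - {x, y, b}) P" by (rule ex_component[OF sym])
  note P_props = componentD[OF P]
  note closed = component_boundary_Diff[OF P]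
  have "P \<subseteq> V - {x, y}" using P_props(2) by auto
  note not_singleton = boundary_not_singleton[OF P_props(1) this]
  have "\<not> boundary E V P \<subseteq> {y, b}"
    by (rule boundary_not_pair_y) (use P_props(1,2) b degree in auto)
  then have "linked E P {x} {y, b} k"
    using not_singleton[of x] closed P_props b no_triangle[of _ b] degree
    by (intro linked_if_closed card_nbrs_pair_le_1 card_add_2_less[of P x y b]) auto
  then obtain p t
    where p: "p \<in> P" "t \<in> {y, b}" "E p t" "admissible k (path_lengths E (insert x P) x p)"
    unfolding linked_def by auto
  have "path_lengths E (V - insert x P) t y \<noteq> {}"
    using p(2) b P_props(2) by (intro path_lengths_edge_nonempty) auto
  moreover have "insert x P \<subseteq> V - {y}" "t \<notin> insert x P" using p(2) P_props(2) b by auto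
  ultimately show False
    using not_admissible_before_edge[OF _ p(3)] p(4) by blast
qed

lemma nbrs_x_not_singleton: "nbrs E (V - {y}) x \<noteq> {b}"
proof
  assume nbrs_x: "nbrs E (V - {y}) x = {b}"
  then have b: "b \<in> V - {x, y}" "E x b" by auto
  obtain v where "v \<in> V - {x, y, b}" using ex_fourth_vertex[OF b(1)] by blast
  then obtain P where P: "component E (V - {x, y, b}) P" by (rule ex_component[OF sym])
  have "boundary E V P \<subseteq> {y, b}"
  proof
    fix v assume v: "v \<in> boundary E V P"
    then obtain p where p: "p \<in> P" "E p v" by auto
    then have "p \<notin> nbrs E (V - {y}) x" using componentD(2)[OF P] unfolding nbrs_x by auto
    then have "\<not> E p x" using p(1) componentD(2)[OF P] E_sym[of p x] by auto
    then show "v \<in> {y, b}" using v p(2) component_boundary_Diff[OF P] by blast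
  qed
  moreover have "\<not> boundary E V P \<subseteq> {y, b}"
    by (rule boundary_not_pair_y) (use componentD[OF P] b degree in auto)
  ultimately show False by contradiction
qed

lemma diamond_absurd:
  assumes uv: "u \<in> V - {x, y}" "v \<in> V - {x, y}" "E x u" "E x v" "E u v" "E u y"
    and y_nbrs: "nbrs E V y \<subseteq> {x, u, v}"
    and no_triangle: "\<And>p. p \<in> V - {x, y, u, v} \<Longrightarrow> \<not> (E p x \<and> E p v)"
  shows False
proof (cases "V - {x, y, u, v} = {}")
  case True
  then have "nbrs E V u \<subseteq> {x, y, v}" by auto
  then have "card (nbrs E V u) \<le> card {x, y, v}" by (rule card_mono[rotated]) simp
  then have "k \<le> 2" using degree[OF uv(1)] by (auto simp: card_insert_if split: if_splits)
  moreover have "pairwise E {x, u, v}" using uv E_sym unfolding pairwise_def by blast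
  moreover have "u \<noteq> v" using uv(5) by auto
  then have "card {x, u, v} = 3" using uv(1,2) by auto
  ultimately have "1 + i \<in> path_lengths E {x, u, v} x u" if "i < k" for i
    using that uv by (intro clique_path_lengths) auto
  then have "admissible k (path_lengths E {x, u, v} x u)" by (rule admissible_step_1I)
  then show False using not_admissible_to_neighbour[OF uv(6), of "{x, u, v}"] uv by auto
next
  case False
  then obtain p where "p \<in> V - {x, y, u, v}" by blast
  then obtain P where P: "component E (V - {x, y, u, v}) P" by (rule ex_component[OF sym])
  note P_props = componentD[OF P]
  have "y \<notin> boundary E V P" using y_nbrs E_sym[of _ y] P_props(2) by fastforce
  then have closed: "boundary E V P \<subseteq> {u} \<union> {x, v}" using component_boundary_Diff[OF P] by blast
  have "P \<subseteq> V - {x, y}" using P_props(2) by auto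
  note not_singleton = boundary_not_singleton[OF P_props(1) this]
  have "u \<noteq> v" using uv(5) by auto
  then have "u \<in> V - P - {x, v}" using uv(1) P_props(2) by auto
  then have "\<not> boundary E V P \<subseteq> {x, v}"
    by (intro boundary_not_pair_x) (use P_props(1,2) uv degree in auto)
  then have "linked E P {u} {x, v} k"
    using not_singleton[of u] closed P_props uv no_triangle degree
    by (intro linked_if_closed card_nbrs_pair_le_1 card_add_2_less[of P x u v]) auto
  moreover have "path_lengths E {x, v} x b \<noteq> {}" if "b \<in> {x, v}" for b
    using that uv(4) by (intro path_lengths_edge_nonempty) auto
  moreover have "{x, v} \<inter> insert u P = {}" using uv P_props(2) \<open>u \<noteq> v\<close> by auto
  ultimately have "admissible k (path_lengths E ({x, v} \<union> insert u P) x u)"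
    by (rule admissible_linked_reverse)
  moreover have "{x, v} \<union> insert u P \<subseteq> V - {y}" using uv P_props(2) by auto
  ultimately show False using not_admissible_to_neighbour[OF uv(6)] by blast
qed

lemma no_triangle_at_x:
  assumes ab: "a \<in> V - {y}" "b \<in> V - {y}" "E x a" "E x b"
  shows "\<not> E a b"
proof
  assume "E a b"
  have y_nbrs: "nbrs E V y \<subseteq> {x, c, d}"
    if "c \<in> V - {y}" "d \<in> V - {y}" "E x c" "E x d" "E c d" for c d
  proof
    fix z assume z: "z \<in> nbrs E V y"
    have "x \<noteq> c" "x \<noteq> d" "c \<noteq> d" using that(3-5) by auto
    then have "card {x, c, d} = 3" "pairwise E {x, c, d}"
      using that E_sym unfolding pairwise_def by auto
    then show "z \<in> {x, c, d}"
      using clique_absurd[of "{x, c, d}" z] that z degree E_sym by auto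
  qed
  obtain u v where uv: "u \<in> V - {x}" "v \<in> V - {x}" "E u y" "E v y" "E u v"
    using ex_triangle_at_y by blast
  have "u \<in> {a, b}" "v \<in> {a, b}"
    using y_nbrs[OF ab \<open>E a b\<close>] uv E_sym[OF uv(3)] E_sym[OF uv(4)] by auto
  then have "{u, v} = {a, b}" using uv(5) by auto
  then have xuv: "u \<noteq> y" "v \<noteq> y" "E x u" "E x v" using ab by (auto simp: doubleton_eq_iff)
  show False
  proof (rule diamond_absurd[of u v])
    show "nbrs E V y \<subseteq> {x, u, v}" using y_nbrs[of u v] uv xuv by auto
    show "\<not> (E p x \<and> E p v)" if "p \<in> V - {x, y, u, v}" for p
    proof
      assume "E p x \<and> E p v"
      then have "u \<in> {x, p, v}" using y_nbrs[of p v] that uv xuv E_sym[of p x] E_sym[OF uv(3)] by auto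
      then show False using that uv by auto
    qed
  qed (use uv xuv in auto)
qed

end

subsection \<open>Separations at a hub\<close>

context minimal_counterexample
begin

lemma boundary_not_pair:
  assumes "D \<noteq> {}" "D \<subseteq> V - {x, y}" "V - D - {x, y} \<noteq> {}" "z \<in> {x, y}" "c \<in> V - D"
  shows "\<not> boundary E V D \<subseteq> {z, c}"
proof -
  have deg: "k + 1 \<le> card (nbrs E V d)" if "d \<in> D" for d using degree assms(2) that by blast
  have y_outside: "y \<in> V - D - {x, c}" if "c \<noteq> y" using that assms(2) by auto
  consider "c \<in> {x, y}" | "z = x" "c \<notin> {x, y}" | "z = y" "c \<notin> {x, y}" using assms(4) by blast
  then show ?thesis
  proof cases
    case 1
    then have "{z, c} \<subseteq> {x, y}" using assms(4) by blast
    then show ?thesis using boundary_not_pair_x[OF assms(1,2), of y] assms(2,3) deg by auto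
  next
    case 2
    then show ?thesis using boundary_not_pair_x[OF assms(1,2,5)] y_outside deg by blast
  next
    case 3
    then show ?thesis using boundary_not_pair_y[OF assms(1,2,5)] deg by blast
  qed
qed

lemma linked_losing_root:
  assumes P: "P \<noteq> {}" "P \<subseteq> V - {x, y, a}" "connected_in E P" and a: "a \<in> V - {x, y}"
    and z: "z \<in> {x, y}" "{u, t, z} = {x, y, a}" "distinct [u, t, z]"
    and closed: "boundary E V P \<subseteq> {x, y, a}"
  shows "linked E P {u} {t} (k - 1)"
proof -
  have not_pair: "\<not> boundary E V D \<subseteq> {z, c}" if "D \<noteq> {}" "D \<subseteq> P" "c \<in> V - D" for D c
  proof (rule boundary_not_pair[OF that(1) _ _ z(1) that(3)])
    have "a \<in> V - D - {x, y}" using a P(2) that(2) by auto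
    then show "V - D - {x, y} \<noteq> {}" by blast
  qed (use P(2) that in auto)
  have "{x, y, a} \<subseteq> V - P" using P(2) a by auto
  then have ends: "u \<in> V - P" "t \<in> V - P" unfolding z(2)[symmetric] by auto
  have closed': "boundary E V P \<subseteq> {u} \<union> {t} \<union> {z}" using closed z(2) by auto
  show ?thesis
  proof (rule linked_region[where L = "{z}", OF finite_V _ P(3) _ _ _ _ _ _ _ closed'])
    show "card P + 2 < card V" using P a by (intro card_add_2_less[of P x y a]) auto
    show "boundary E V P \<inter> {u} \<noteq> {}" using not_pair[OF P(1) subset_refl ends(2)] closed' by blast
    show "boundary E V P \<inter> {t} \<noteq> {}" using not_pair[OF P(1) subset_refl ends(1)] closed' by blast
    show "\<not> boundary E V D \<subseteq> insert c {z}" if "D \<noteq> {}" "D \<subseteq> P" "c \<in> P - D" for D c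
      using not_pair[OF that(1,2), of c] that(3) P(2) by (auto simp: insert_commute)
    show "k - 1 \<le> 1 \<or> k - 1 + 1 + card (nbrs E ({u} \<union> {t} \<union> {z}) p) \<le>
        card (nbrs E V p) + of_bool (\<exists>v\<in>{u}. E p v) + of_bool (\<exists>v\<in>{t}. E p v)" if "p \<in> P" for p
    proof -
      have "card (nbrs E ({u} \<union> {t} \<union> {z}) p) = of_bool (E p u) + of_bool (E p t) + of_bool (E p z)"
        using z(3) by (subst card_nbrs_Un_disjoint, simp, simp, simp)+ simp
      then have "card (nbrs E ({u} \<union> {t} \<union> {z}) p) \<le>
          of_bool (\<exists>v\<in>{u}. E p v) + of_bool (\<exists>v\<in>{t}. E p v) + 1"
        by simp
      moreover have "p \<in> V - {x, y}" using that P(2) by blast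
      ultimately show ?thesis using degree[of p] k_ge_2 by linarith
    qed
  qed (use P(2) ends z(1,3) in auto)
qed

lemma triple_separation_absurd:
  assumes a: "a \<in> V - {x, y}"
    and D: "D \<noteq> {}" "D \<subseteq> V - {x, y, a}" "connected_in E D" "boundary E V D \<subseteq> {x, y, a}"
    and Z: "Z \<noteq> {}" "Z \<subseteq> V - {x, y, a} - D" "connected_in E Z" "boundary E V Z \<subseteq> {x, y, a}"
    and k: "3 \<le> k"
  shows False
proof -
  have "linked E Z {x} {a} (k - 1)"
    by (rule linked_losing_root[OF Z(1) _ Z(3) a _ _ _ Z(4), of y]) (use a Z(2) in auto)
  then obtain p where p: "p \<in> Z" "E p a"
    and adm_Z: "admissible (k - 1) (path_lengths E (insert x Z) x p)"
    unfolding linked_def by auto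
  have adm_a: "admissible (k - 1) (path_lengths E (insert a (insert x Z)) x a)"
    by (rule admissible_shift[OF adm_Z, where c = 1])
      (use path_lengths_snoc[of _ E "insert x Z" x p a] p(2) Z(2) a in auto)
  have "linked E D {a} {y} (k - 1)"
    by (rule linked_losing_root[OF D(1-3) a _ _ _ D(4), of x]) (use a in auto)
  then obtain q where q: "q \<in> D" "E q y"
    and adm_D: "admissible (k - 1) (path_lengths E (insert a D) a q)"
    unfolding linked_def by auto
  have "insert a (insert x Z) \<inter> insert a D \<subseteq> {a}" using Z(2) D(2) by auto
  then have "admissible (k - 1 + (k - 1) - 1) (path_lengths E (insert a (insert x Z) \<union> insert a D) x q)"
    using k by (intro admissible_sum[OF adm_a adm_D] path_lengths_join) auto
  then have "admissible k (path_lengths E (insert a (insert x Z) \<union> insert a D) x q)"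
    by (rule admissible_le) (use k in auto)
  moreover have "insert a (insert x Z) \<union> insert a D \<subseteq> V - {y}" using a D(2) Z(2) by auto
  ultimately show False using not_admissible_to_neighbour[OF q(2)] by blast
qed

lemma ex_pendant_at_y:
  assumes W: "W \<subseteq> V - Q - {y}" "y \<in> boundary E V W" "boundary E V W \<subseteq> insert y (Q - U)" and "y \<notin> Q"
  obtains D where "pendant Q U D y"
proof -
  obtain w where w: "w \<in> W" "E w y" using W(2) by auto
  obtain D where D: "w \<in> D" "component E W D" using ex_component[OF sym w(1)] .
  note sub = componentD(2)[OF D(2)]
  have "pendant Q U D y"
    unfolding pendant_def
  proof (intro conjI)
    show "boundary E V D \<subseteq> insert y (Q - U)" using component_boundary[OF D(2)] W(3) by blast
    show "y \<in> boundary E V D - Q" using D(1) w(2) sub W(1) \<open>y \<notin> Q\<close> by auto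
    show "path_lengths E (V - Q - D) y y \<noteq> {}"
      using sub W(1) \<open>y \<notin> Q\<close> by (intro path_lengths_edge_nonempty) auto
  qed (use componentD(3)[OF D(2)] sub W(1) in auto)
  then show ?thesis by (rule that)
qed

lemma wide_pendant_absurd:
  assumes pendant: "pendant Q U D c" and U: "U \<subseteq> V - {x, y}" "U \<subseteq> Q" "U \<noteq> {}"
    and T: "T = (Q - U - {x}) \<inter> boundary E V D" and hub: "hub Q T l"
    and light: "\<And>d. d \<in> D \<Longrightarrow> light Q T l d"
  shows False
proof -
  note D = pendantD[OF pendant] and Q = hubD[OF hub]
  have not_pair: "\<not> boundary E V C \<subseteq> {x, b}" if "C \<noteq> {}" "C \<subseteq> D" "b \<in> V - C" for C b
  proof (rule boundary_not_pair[OF that(1)])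
    show "V - C - {x, y} \<noteq> {}" using U D(2) that(2) by blast
  qed (use that D(2) Q in auto)
  have degree_D: "k + 1 \<le> card (nbrs E V d)" if "d \<in> D" for d
    using that D(2) Q(2) by (intro degree) auto
  have "T \<noteq> {}"
  proof
    assume "T = {}"
    then have "boundary E V D \<subseteq> {x, c}" using D(5) unfolding T by blast
    then show False using not_pair[OF D(1) subset_refl] D(4) by blast
  qed
  show False
  proof (rule hub_region_absurd[OF hub D(2,3) _ _ _ _ _ light D(7)])
    show "\<not> boundary E V C \<subseteq> insert b (Q - T)" if C: "C \<noteq> {}" "C \<subseteq> D" "b \<in> D - C" for C b
    proof
      assume sep: "boundary E V C \<subseteq> insert b (Q - T)"
      have "boundary E V C \<subseteq> {x, b}"
      proof
        fix v assume v: "v \<in> boundary E V C"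
        show "v \<in> {x, b}"
        proof (rule ccontr)
          assume "v \<notin> {x, b}"
          then have "v \<in> Q - T - {x}" using sep v by blast
          moreover from this have "v \<in> boundary E V D" using v C(2) D(2) by auto
          ultimately show False using D(4,5) unfolding T by blast
        qed
      qed
      then show False using not_pair[OF C(1,2)] C(3) D(2) by blast
    qed
    show "boundary E V D \<inter> T \<noteq> {}" using \<open>T \<noteq> {}\<close> unfolding T by blast
  qed (use D(4-6) degree_D in blast)+
qed

lemma narrow_pendant_absurd:
  assumes pendant: "pendant Q U D c" "c \<noteq> y" and Q: "Q \<subseteq> V - {y}" "Q - U = {x, a}" "a \<noteq> x"
    and no_common: "\<And>d. d \<in> D \<Longrightarrow> \<not> (E d x \<and> E d a)" and "path_lengths E Q x a \<noteq> {}"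
  shows False
proof -
  note D = pendantD[OF pendant(1)]
  have ends: "x \<in> Q" "a \<in> Q" using Q(2) by blast+
  have degree_D: "k + 1 \<le> card (nbrs E V d)" if "d \<in> D" for d
    using that D(2) ends(1) by (intro degree) auto
  have "\<not> boundary E V D \<subseteq> {x, a, c}"
    by (rule boundary_not_triple[OF _ Q(3) _ D(1) _ D(3) _ _ no_common degree_D assms(7) Q(1) _ D(7)])
      (use D(2,4) ends Q(1) pendant(2) in auto)
  then show False using D(5) Q(2) by (auto simp: insert_commute)
qed

lemma narrow_block_absurd:
  assumes Q: "Q \<subseteq> V - {y}" "Q - U = {x, a}" "a \<noteq> x" "U \<subseteq> Q" "U \<noteq> {}"
    and W: "W \<subseteq> V - Q - {y}" "y \<in> boundary E V W" "boundary E V W \<subseteq> insert y (Q - U)"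
      "y \<notin> boundary E V (V - Q - {y} - W)"
    and k: "\<And>z. z \<in> U \<Longrightarrow> E z y \<Longrightarrow> 3 \<le> k"
  shows False
proof -
  define Z where "Z = V - {x, y, a} - W"
  have ends: "x \<in> Q" "a \<in> Q" "x \<notin> U" "a \<notin> U" using Q(2) by blast+
  have a: "a \<in> V - {x, y}" using ends Q by blast
  have "U \<subseteq> Z" using Q(1,4) W(1) ends unfolding Z_def by blast
  then have "Z \<noteq> {}" using Q(5) by blast
  have closed_W: "boundary E V W \<subseteq> {x, y, a}" using W(3) Q(2) by blast
  have closed_Z: "boundary E V Z \<subseteq> {x, y, a}"
  proof
    fix v assume "v \<in> boundary E V Z"
    then obtain z where z: "z \<in> Z" "v \<in> V" "v \<notin> Z" "E z v" unfolding boundary_def by blast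
    show "v \<in> {x, y, a}"
    proof (rule ccontr)
      assume "v \<notin> {x, y, a}"
      then have "v \<in> W" using z unfolding Z_def by auto
      then show False using boundary_subsetD[OF closed_W _ _ E_sym[OF z(4)]] z(1) unfolding Z_def
        by blast
    qed
  qed
  have "\<not> boundary E V Z \<subseteq> {x, a}"
    by (rule boundary_not_pair[OF \<open>Z \<noteq> {}\<close>]) (use a in \<open>auto simp: Z_def\<close>)
  then have "y \<in> boundary E V Z" using closed_Z by blast
  then obtain z where z: "z \<in> Z" "E z y" by auto
  then have "z \<in> U" using W(4) Q(2) roots(2) unfolding Z_def boundary_def by blast
  then have "3 \<le> k" using k z(2) by blast
  obtain w where "w \<in> W" using W(2) by auto
  then obtain D where D: "component E W D" by (rule ex_component[OF sym])
  obtain Z' where Z': "component E Z Z'" using z(1) by (rule ex_component[OF sym])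
  show False
  proof (rule triple_separation_absurd[OF a componentD(1)[OF D] _ componentD(3)[OF D] _
        componentD(1)[OF Z'] _ componentD(3)[OF Z'] _ \<open>3 \<le> k\<close>])
    show "boundary E V D \<subseteq> {x, y, a}" using component_boundary[OF D] closed_W by blast
    show "boundary E V Z' \<subseteq> {x, y, a}" using component_boundary[OF Z'] closed_Z by blast
    show "Z' \<subseteq> V - {x, y, a} - D"
      using componentD(2)[OF Z'] componentD(2)[OF D] unfolding Z_def by auto
  qed (use componentD(2)[OF D] W(1) ends in auto)
qed

end

subsection \<open>Books at the root\<close>

context adjacency
begin

lemma alternating_path_lengths:
  assumes "finite B" "finite C" "B \<inter> C = {}" "s \<notin> B \<union> C" "\<forall>b\<in>B. E s b" "\<forall>b\<in>B. \<forall>c\<in>C. E b c"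
    "1 \<le> p" "p \<le> card B" "p \<le> r" "r \<le> card C" "c \<in> C" "p = r \<or> pairwise E C"
  shows "p + r \<in> path_lengths E (insert s (B \<union> C)) s c"
  using assms
proof (induction p arbitrary: s B C r)
  case (Suc p)
  have "B \<noteq> {}" using Suc.prems(8) by auto
  then obtain b where b: "b \<in> B" by blast
  have extend: "Suc (Suc n) \<in> path_lengths E (insert s (B \<union> C)) s c"
    if "n \<in> path_lengths E S d c" "d \<in> C" "S \<subseteq> (B - {b}) \<union> C" for n d S
  proof -
    have "Suc n \<in> path_lengths E (insert b S) b c"
      by (rule path_lengths_Cons[OF that(1)]) (use that Suc.prems(3,6) b in auto)
    then have "Suc (Suc n) \<in> path_lengths E (insert s (insert b S)) s c"
      by (rule path_lengths_Cons) (use that Suc.prems(4,5) b in auto)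
    then show ?thesis by (rule path_lengths_mono) (use that(3) b in auto)
  qed
  show ?case
  proof (cases "r = 1")
    case True
    then have "p = 0" using Suc.prems(9) by simp
    then show ?thesis using extend[OF path_lengths_refl[of c C E]] Suc.prems(11) True by auto
  next
    case False
    have "card (C - {c}) \<noteq> 0" using Suc.prems(2,9-11) False by simp
    then have "C - {c} \<noteq> {}" by force
    then obtain d where d: "d \<in> C" "d \<noteq> c" by blast
    show ?thesis
    proof (cases "p = 0")
      case True
      have "r - 1 \<in> path_lengths E C d c"
        by (rule clique_path_lengths) (use Suc.prems(2,7,9-12) True False d in auto)
      from extend[OF this d(1)] show ?thesis using True Suc.prems(9) by auto
    next
      case p: False
      have "p + (r - 1) \<in> path_lengths E (insert d ((B - {b}) \<union> (C - {d}))) d c"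
      proof (rule Suc.IH)
        show "\<forall>b\<in>B - {b}. E d b" using Suc.prems(6) d(1) E_sym by blast
        show "p = r - 1 \<or> pairwise E (C - {d})"
          using Suc.prems(12) pairwise_subset[of E C "C - {d}"] by auto
      qed (use Suc.prems p b d in auto)
      from extend[OF this d(1)] show ?thesis
        using p Suc.prems(9) d(1) Suc.prems(3) by (auto simp: algebra_simps)
    qed
  qed
qed simp

lemma book_path_lengths:
  assumes "finite B" "finite C" "B \<inter> C = {}" "s \<notin> B \<union> C" "\<forall>b\<in>B. E s b" "\<forall>b\<in>B. \<forall>c\<in>C. E b c"
    "pairwise E C" "B \<noteq> {}" "card B \<le> card C" "c \<in> C" "2 \<le> n" "n \<le> card B + card C"
  shows "n \<in> path_lengths E (insert s (B \<union> C)) s c"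
proof -
  define p where "p = min (card B) (n div 2)"
  have "1 \<le> card B" using assms by (simp add: Suc_leI card_gt_0_iff)
  then have "1 \<le> p" "p \<le> card B" "p \<le> n - p" "n - p \<le> card C" "p + (n - p) = n"
    using assms unfolding p_def by (auto simp: min_def)
  then show ?thesis using alternating_path_lengths[OF assms(1-6), of p "n - p" c] assms by auto
qed

end

context minimal_unlinked
begin

definition book :: "'a set \<Rightarrow> 'a set \<Rightarrow> bool" where
  "book B C \<longleftrightarrow> B \<noteq> {} \<and> B \<subseteq> V - {x, y} \<and> (\<forall>b\<in>B. E x b) \<and> C \<subseteq> V - {x, y} \<and> pairwise E C \<and>
     (\<forall>b\<in>B. \<forall>c\<in>C. E b c) \<and> card B \<le> card C \<and> 2 \<le> card C \<and> (\<exists>z\<in>V - insert x (B \<union> C). E z y)"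

end

locale maximal_book = minimal_counterexample +
  fixes B C :: "'a set"
  assumes book: "book B C"
    and maximal: "\<And>B' C'. book B' C' \<Longrightarrow> card B' + card C' \<le> card B + card C"
begin

lemma B: "B \<noteq> {}" "B \<subseteq> V - {x, y}" "b \<in> B \<Longrightarrow> E x b" "finite B" "1 \<le> card B"
proof -
  show "finite B" using book finite_subset[of B V] unfolding book_def by auto
  then show "1 \<le> card B" using book unfolding book_def by (simp add: Suc_leI card_gt_0_iff)
qed (use book in \<open>auto simp: book_def\<close>)

lemma C: "C \<subseteq> V - {x, y}" "pairwise E C" "finite C" "card B \<le> card C" "2 \<le> card C"
  using book finite_subset[of C V] unfolding book_def by auto

lemma complete: "b \<in> B \<Longrightarrow> c \<in> C \<Longrightarrow> E b c"
  using book unfolding book_def by blast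

lemma no_common_nbr: "w \<in> V - {x, y} \<Longrightarrow> b \<in> B \<Longrightarrow> \<not> (E w x \<and> E w b)"
  using no_triangle_at_x[of w b] B(2,3) E_sym by blast

lemma not_adjacent_C: "c \<in> C \<Longrightarrow> \<not> E x c"
  using no_common_nbr[of c] B(1) C(1) complete E_sym by blast

lemma disjoint: "B \<inter> C = {}"
  using B(3) not_adjacent_C by blast

definition Q :: "'a set" where
  "Q = insert x (B \<union> C)"

lemma Q: "Q \<subseteq> V - {y}" "x \<in> Q" "C \<subseteq> Q - {x}" "B \<subseteq> Q - {x}" "Q - C = insert x B"
  using B(2) C(1) disjoint unfolding Q_def by auto

lemma outside: "\<exists>z\<in>V - Q. E z y"
  using book unfolding book_def Q_def by blast

lemma card_nbrs_Q: "card (nbrs E Q w) = of_bool (E w x) + card (nbrs E B w) + card (nbrs E C w)"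
  using B(2,4) C(1,3) disjoint unfolding Q_def
  by (subst card_nbrs_insert) (auto simp: card_nbrs_Un_disjoint)

lemma path_lengths_C: "c \<in> C \<Longrightarrow> 2 \<le> n \<Longrightarrow> n \<le> card B + card C \<Longrightarrow> n \<in> path_lengths E Q x c"
  unfolding Q_def using B C complete disjoint by (intro book_path_lengths) auto

lemma path_lengths_B:
  assumes b: "b \<in> B" "2 \<le> card B" and n: "3 \<le> n" "n \<le> card B + card C"
  shows "n \<in> path_lengths E Q x b"
proof -
  have "card (B - {b}) = card B - 1" using b(1) B(4) by simp
  moreover from this have "card (B - {b}) \<noteq> 0" using b(2) by simp
  then have "B - {b} \<noteq> {}" by force
  moreover obtain c where c: "c \<in> C" using C(5) by fastforce
  ultimately have "n - 1 \<in> path_lengths E (insert x (B - {b} \<union> C)) x c"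
    using B C complete disjoint b n by (intro book_path_lengths) auto
  then have "Suc (n - 1) \<in> path_lengths E (insert b (insert x (B - {b} \<union> C))) x b"
    by (rule path_lengths_snoc) (use E_sym[OF complete[OF b(1) c]] b B(2) disjoint in auto)
  then show ?thesis
    using n(1) b(1) by (auto elim!: path_lengths_mono simp: Q_def)
qed

lemma hub_C: "hub Q C (card B + card C - 2)"
proof -
  have "2 + i \<in> (\<Inter>c\<in>C. path_lengths E Q x c)" if "i < card B + card C - 2 + 1" for i
    using that B(5) C(5) path_lengths_C by auto
  then have "admissible (card B + card C - 2 + 1) (\<Inter>c\<in>C. path_lengths E Q x c)"
    by (rule admissible_step_1I)
  then show ?thesis unfolding hub_def using Q by blast
qed

lemma hub_B:
  assumes "U \<subseteq> B" "2 \<le> card B" shows "hub Q U (card B + card C - 3)"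
proof -
  have "3 + i \<in> (\<Inter>b\<in>U. path_lengths E Q x b)" if "i < card B + card C - 3 + 1" for i
    using that assms C(4) path_lengths_B by auto
  then have "admissible (card B + card C - 3 + 1) (\<Inter>b\<in>U. path_lengths E Q x b)"
    by (rule admissible_step_1I)
  then show ?thesis unfolding hub_def using Q assms(1) by blast
qed

lemma heavy_vertex_cases:
  assumes w: "w \<in> V - Q - {y}" and heavy: "\<not> light Q C (card B + card C - 2) w"
  obtains "\<not> E w x" "\<And>q. q \<in> B \<union> C \<Longrightarrow> E w q" | "E w x" "card B = 1" "\<And>q. q \<in> C \<Longrightarrow> E w q"
proof -
  have w': "w \<in> V - {x, y}" using w Q(2) by auto
  have nbrs_B: "card (nbrs E B w) \<le> card B" and nbrs_C: "card (nbrs E C w) \<le> card C"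
    using B(4) C(3) by (simp_all add: card_nbrs_le)
  have no_B: "card (nbrs E B w) = 0" if "E w x"
    using no_common_nbr[OF w'] that by (intro card_nbrs_eq_0) blast
  have "\<exists>c\<in>C. E w c"
  proof (rule ccontr)
    assume no_C: "\<not> (\<exists>c\<in>C. E w c)"
    then have "card (nbrs E C w) = 0" by (rule card_nbrs_eq_0)
    then have "card (nbrs E Q w) \<le> card B + card C - 2"
      using card_nbrs_Q[of w] no_B nbrs_B B(5) C(5) by (cases "E w x") auto
    then show False using heavy no_C unfolding light_def by simp
  qed
  then have many: "card B + card C \<le> card (nbrs E Q w)"
    using heavy B(5) C(5) unfolding light_def by simp
  show ?thesis
  proof (cases "E w x")
    case True
    then have "card B = 1" "card C \<le> card (nbrs E C w)"
      using many card_nbrs_Q[of w] no_B[OF True] nbrs_C B(5) by auto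
    then show ?thesis using that(2)[OF True] adjacent_if_card_nbrs_ge[OF C(3)] by blast
  next
    case False
    then have "card B \<le> card (nbrs E B w)" "card C \<le> card (nbrs E C w)"
      using many card_nbrs_Q[of w] nbrs_B nbrs_C by auto
    then show ?thesis
      using that(1)[OF False] adjacent_if_card_nbrs_ge[OF B(4)] adjacent_if_card_nbrs_ge[OF C(3)]
      by blast
  qed
qed

lemma heavy_nbrs_y:
  assumes w: "w \<in> V - Q - {y}" and heavy: "\<not> light Q C (card B + card C - 2) w"
  shows "nbrs E V y \<subseteq> insert w Q"
proof (rule ccontr)
  assume "\<not> ?thesis"
  then obtain z where z: "z \<in> V" "E z y" "z \<notin> insert w Q" using E_sym unfolding nbrs_def by blast
  have w': "w \<in> V - {x, y}" "w \<notin> B" "w \<notin> C" using w unfolding Q_def by auto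
  have "\<exists>B' C'. book B' C' \<and> card B + card C < card B' + card C'"
    using w heavy
  proof (cases rule: heavy_vertex_cases)
    case 1
    have "book B (insert w C)"
      unfolding book_def using 1(2) w' B C complete pairwise_insert_nbr[OF C(2), of w] E_sym z
      by (auto simp: Q_def card_insert_if)
    then show ?thesis using w' C(3) by (intro exI[of _ B] exI[of _ "insert w C"]) simp
  next
    case 2
    have "book (insert w B) C"
      unfolding book_def using 2 w' B C complete E_sym[OF 2(1)] z by (auto simp: Q_def)
    then show ?thesis using w' B(4) by (intro exI[of _ "insert w B"] exI[of _ C]) simp
  qed
  then show False using maximal by (meson not_le)
qed

lemma last_vertex_absurd:
  assumes w: "w \<in> V - Q - {y}" and heavy: "\<not> light Q C (card B + card C - 2) w" and "E w y"
    and nbrs_y: "nbrs E V y \<subseteq> insert w Q" and nbrs_w: "nbrs E V w \<subseteq> insert y Q"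
  shows False
  using w heavy
proof (cases rule: heavy_vertex_cases)
  case 1
  have "nbrs E V w \<subseteq> insert y (B \<union> C)" using nbrs_w 1(1) unfolding Q_def by auto
  then have "card (nbrs E V w) \<le> card (insert y (B \<union> C))" using B(4) C(3) by (intro card_mono) auto
  then have "k \<le> card B + card C"
    using degree[of w] w B(4) C(3) disjoint
    by (auto simp: Q_def card_insert_if card_Un_disjoint split: if_splits)
  moreover have "w \<notin> B" "w \<notin> C" "w \<noteq> x" using w unfolding Q_def by auto
  moreover have "pairwise E (insert w C)" "\<forall>b\<in>B. E b w"
    using 1(2) pairwise_insert_nbr[OF C(2), of w] E_sym by blast+
  ultimately have "2 + i \<in> path_lengths E (insert x (B \<union> insert w C)) x w" if "i < k" for i
    using B C complete disjoint that by (intro book_path_lengths) auto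
  then have "admissible k (path_lengths E (insert x (B \<union> insert w C)) x w)"
    by (rule admissible_step_1I)
  then show False
    using not_admissible_to_neighbour[OF \<open>E w y\<close>, of "insert x (B \<union> insert w C)"] w B(2) C(1) by auto
next
  case 2
  obtain b where b: "B = {b}" using 2(2) by (rule card_1_singletonE)
  have w': "w \<in> V - {x, y}" "w \<noteq> b" "w \<notin> C" using w Q(2-4) b by auto
  have "\<not> E w b" using no_common_nbr[OF w'(1)] 2(1) b by blast
  then have "nbrs E V w \<subseteq> {x, y} \<union> C" using nbrs_w b unfolding Q_def by auto
  then have "card (nbrs E V w) \<le> card ({x, y} \<union> C)" using C(3) by (intro card_mono) auto
  then have "k \<le> card C + 1"
    using degree[OF w'(1)] card_Un_le[of "{x, y}" C] by simp
  obtain u v where uv: "u \<in> V - {x}" "v \<in> V - {x}" "E u y" "E v y" "E u v"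
    using ex_triangle_at_y by blast
  then have "u \<in> {w, b} \<union> C" "v \<in> {w, b} \<union> C"
    using nbrs_y E_sym[OF uv(3)] E_sym[OF uv(4)] uv b unfolding Q_def by auto
  then have "u \<in> C \<or> v \<in> C" using uv(5) \<open>\<not> E w b\<close> E_sym[of b w] by auto
  then obtain c where c: "c \<in> C" "E c y" using uv by blast
  have "card {b, w} = 2" using w'(2) by simp
  then have "2 + i \<in> path_lengths E (insert x ({b, w} \<union> C)) x c" if "i < k" for i
    using that \<open>k \<le> card C + 1\<close> w' 2(3) E_sym[OF 2(1)] B C complete disjoint c(1) b
    by (intro book_path_lengths) auto
  then have "admissible k (path_lengths E (insert x ({b, w} \<union> C)) x c)" by (rule admissible_step_1I)
  then show False
    using not_admissible_to_neighbour[OF c(2), of "insert x ({b, w} \<union> C)"] w' B(2) C(1) b by auto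
qed

lemma wide_not_pendant:
  assumes "2 \<le> card B" shows "\<not> pendant Q C D c"
proof
  assume pendant: "pendant Q C D c"
  note D = pendantD[OF pendant]
  define U where "U = (Q - C - {x}) \<inter> boundary E V D"
  have "U \<subseteq> B" unfolding U_def using Q(5) by blast
  show False
  proof (rule wide_pendant_absurd[OF pendant C(1) _ _ U_def hub_B[OF \<open>U \<subseteq> B\<close> assms]])
    fix d assume d: "d \<in> D"
    have "d \<in> V - {x, y}" using d D(2) Q(2) by blast
    have "\<not> (\<exists>c'\<in>C. E d c')"
      using boundary_subsetD[OF D(5) d] C(1) D(2,4) Q(3) by blast
    then have nbrs_Q: "card (nbrs E Q d) = of_bool (E d x) + card (nbrs E B d)"
      using card_nbrs_Q[of d] by (simp add: card_nbrs_eq_0)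
    show "light Q U (card B + card C - 3) d"
    proof (cases "\<exists>b\<in>B. E d b")
      case True
      then obtain b where b: "b \<in> B" "E d b" by blast
      then have "b \<in> Q - C - {x}" "b \<in> boundary E V D"
        using d D(2) B(2) Q(4) disjoint by auto
      then have "\<exists>b\<in>U. E d b" using b(2) unfolding U_def by blast
      moreover have "\<not> E d x" using True no_common_nbr[OF \<open>d \<in> V - {x, y}\<close>] by blast
      ultimately show ?thesis
        using nbrs_Q card_nbrs_le[OF B(4), of E d] assms C(4) unfolding light_def by simp
    next
      case False
      then have "card (nbrs E Q d) \<le> 1" using nbrs_Q by (simp add: card_nbrs_eq_0)
      moreover have "1 \<le> card B + card C - 3" using assms C(4) by linarith
      ultimately show ?thesis unfolding light_def by linarith
    qed
  qed (use Q(3) C(5) in auto)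
qed

lemma singleton_B:
  assumes "card B = 1"
  obtains b where "b \<in> B" "Q - C = {x, b}" "b \<noteq> x"
proof -
  obtain b where "B = {b}" using assms by (rule card_1_singletonE)
  then show ?thesis using that Q(4,5) by auto
qed

lemma not_pendant:
  assumes "c \<noteq> y" shows "\<not> pendant Q C D c"
proof
  assume pendant: "pendant Q C D c"
  then have "card B = 1" using wide_not_pendant B(5) by fastforce
  then obtain b where b: "b \<in> B" "Q - C = {x, b}" "b \<noteq> x" by (rule singleton_B)
  show False
  proof (rule narrow_pendant_absurd[OF pendant assms Q(1) b(2,3)])
    show "\<not> (E d x \<and> E d b)" if "d \<in> D" for d
      using no_common_nbr[OF _ b(1)] pendantD(2)[OF pendant] that Q(2) by blast
    show "path_lengths E Q x b \<noteq> {}"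
      using b(1) B(3) Q by (intro path_lengths_edge_nonempty) auto
  qed
qed

lemma not_blocked:
  assumes W: "W \<subseteq> V - Q - {y}" "y \<in> boundary E V W" "boundary E V W \<subseteq> insert y (Q - C)"
  shows "y \<in> boundary E V (V - Q - {y} - W)"
proof (rule ccontr)
  assume unattached: "y \<notin> boundary E V (V - Q - {y} - W)"
  have "card B = 1"
  proof (rule ccontr)
    assume "card B \<noteq> 1"
    have "y \<notin> Q" using Q(1) by blast
    then obtain D where "pendant Q C D y" by (rule ex_pendant_at_y[OF W])
    then show False using wide_not_pendant \<open>card B \<noteq> 1\<close> B(5) by force
  qed
  then obtain b where b: "b \<in> B" "Q - C = {x, b}" "b \<noteq> x" by (rule singleton_B)
  show False
  proof (rule narrow_block_absurd[OF Q(1) b(2,3) _ _ W unattached])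
    fix z assume z: "z \<in> C" "E z y"
    show "3 \<le> k"
    proof (rule ccontr)
      assume "\<not> 3 \<le> k"
      then have "2 + i \<in> path_lengths E Q x z" if "i < k" for i
        using that z(1) B(5) C(5) by (intro path_lengths_C) auto
      then have "admissible k (path_lengths E Q x z)" by (rule admissible_step_1I)
      then show False using not_admissible_to_neighbour[OF z(2) Q(1)] by blast
    qed
  qed (use Q(3) C(5) in auto)
qed

lemma absurd: False
proof (rule maximal_hub_absurd[OF hub_C outside])
  show "k + 1 \<le> card (nbrs E V p)" if "p \<in> V - Q - {y}" for p
    using that Q(2) by (intro degree) auto
qed (use heavy_nbrs_y last_vertex_absurd not_pendant not_blocked in blast)+

end

context minimal_counterexample
begin

lemma no_book: "\<not> book B C"
proof
  assume book: "book B C"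
  have bound: "card (fst BC) + card (snd BC) < 2 * card V + 1" if "case_prod book BC" for BC
  proof -
    have "fst BC \<subseteq> V" "snd BC \<subseteq> V" using that unfolding book_def by (auto split: prod.splits)
    then have "card (fst BC) \<le> card V" "card (snd BC) \<le> card V" by (simp_all add: card_mono)
    then show ?thesis by simp
  qed
  obtain BC where "case_prod book BC"
    "\<And>BC'. case_prod book BC' \<Longrightarrow> card (fst BC') + card (snd BC') \<le> card (fst BC) + card (snd BC)"
    using ex_has_greatest_nat[of "case_prod book" "(B, C)" "\<lambda>BC. card (fst BC) + card (snd BC)"] book bound
    by (metis (mono_tags, lifting) case_prodI)
  then interpret maximal_book E V x y k "fst BC" "snd BC"
    by unfold_locales (auto split: prod.splits)
  show False by (rule absurd)
qed

lemma rooted_without_y: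
  assumes c: "c \<in> V - {x, y}" shows "rooted E (V - {y}) c x"
  unfolding rooted_def
proof (intro conjI allI impI notI)
  fix D b assume D: "D \<noteq> {}" "D \<subseteq> V - {y} - {c, x}" and sep: "boundary E (V - {y}) D \<subseteq> {b}"
  have Dxy: "D \<subseteq> V - {x, y}" using D(2) by auto
  have "c \<in> V - D - {x, y}" using c D(2) by auto
  then have "\<not> boundary E V D \<subseteq> {y, b'}" if "b' \<in> V - D" for b'
    using boundary_not_pair[OF D(1) Dxy _ _ that, of y] by blast
  moreover have "y \<in> V - D" using D(2) by auto
  moreover have "boundary E V D \<subseteq> {y, b}" using sep unfolding boundary_def by blast
  moreover from this have "boundary E V D \<subseteq> {y, y}" if "b \<notin> V - D"
    using that unfolding boundary_def by blast
  ultimately show False by blast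
qed (use c in auto)

lemma triangle_behind_x_absurd:
  assumes "b \<in> V - {x, y}" "c \<in> V - {x, y}" "d \<in> V - {x, y}" "E x b" "E b c" "E b d" "E c d" "E c y"
    and y_nbrs: "nbrs E V y \<subseteq> {x, b, c, d}"
  shows False
proof -
  have distinct: "b \<noteq> c" "b \<noteq> d" "c \<noteq> d" using assms by auto
  have not_adjacent: "\<not> E x c" "\<not> E x d"
    using no_triangle_at_x[of b c] no_triangle_at_x[of b d] assms by auto
  have "b \<in> nbrs E (V - {y}) x" using assms by auto
  then obtain z where z: "z \<in> V - {y}" "E x z" "z \<noteq> b"
    using nbrs_x_not_singleton[of b] unfolding nbrs_def by blast
  have "linked E (V - {y} - {c, x}) {c} {x} k"
  proof (rule ccontr)
    assume not_linked: "\<not> ?thesis"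
    have smaller: "card (V - {y}) < card V" by (rule card_Diff1_less) auto
    interpret M: minimal_unlinked E "V - {y}" c x k
    proof unfold_locales
      show "linked E' (V' - {x', y'}) {x'} {y'} k'"
        if "card V' < card (V - {y})" "rooted_graph E' V' x' y' k'"
        for E' :: "'a \<Rightarrow> 'a \<Rightarrow> bool" and V' x' y' k'
        by (rule linking) (use that smaller in auto)
      show "rooted E (V - {y}) c x" using assms(2) by (rule rooted_without_y)
    qed (use assms(1,2) distinct not_linked in auto)
    show False
    proof (rule M.clique_absurd[of "{b, c, d}" z])
      show "pairwise E {b, c, d}" using assms E_sym unfolding pairwise_def by blast
      show "k + 1 \<le> card (nbrs E (V - {y}) v)" if v: "v \<in> V - {y} - {b, c, d} - {x}" for v
      proof -
        have "\<not> E v y" using y_nbrs v E_sym[of v y] unfolding nbrs_def by blast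
        then have "nbrs E (V - {y}) v = nbrs E V v" by auto
        then show ?thesis using degree[of v] v by auto
      qed
    qed (use assms distinct not_adjacent z E_sym in auto)
  qed
  then have "admissible k (path_lengths E ({x} \<union> insert c (V - {y} - {c, x})) x c)"
    by (rule admissible_linked_reverse) (use assms(2) path_lengths_refl[of x "{x}" E] in auto)
  then show False
    using not_admissible_to_neighbour[OF \<open>E c y\<close>, of "{x} \<union> insert c (V - {y} - {c, x})"] assms(2)
    by auto
qed

lemma no_triangle_behind_x:
  assumes bcd: "b \<in> V - {x, y}" "c \<in> V - {x, y}" "d \<in> V - {x, y}" "E x b" "E b c" "E b d"
  shows "\<not> E c d"
proof
  assume "E c d"
  have distinct: "b \<noteq> c" "b \<noteq> d" "c \<noteq> d" using bcd \<open>E c d\<close> by auto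
  have y_nbrs: "nbrs E V y \<subseteq> {x, b, c, d}"
  proof
    fix z assume z: "z \<in> nbrs E V y"
    show "z \<in> {x, b, c, d}"
    proof (rule ccontr)
      assume "z \<notin> {x, b, c, d}"
      then have "book {b} {c, d}"
        unfolding book_def using z bcd \<open>E c d\<close> distinct E_sym by (auto simp: pairwise_def)
      then show False using no_book by blast
    qed
  qed
  obtain u v where uv: "u \<in> V - {x}" "v \<in> V - {x}" "E u y" "E v y" "E u v"
    using ex_triangle_at_y by blast
  then have "u \<in> {b, c, d}" "v \<in> {b, c, d}" "u \<noteq> v"
    using y_nbrs E_sym[OF uv(3)] E_sym[OF uv(4)] by auto
  then consider "E c y" | "E d y" using uv by auto
  then show False
  proof cases
    case 1
    then show False using triangle_behind_x_absurd[OF bcd \<open>E c d\<close> _ y_nbrs] by blast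
  next
    case 2
    then show False
      using triangle_behind_x_absurd[OF bcd(1,3,2,4,6,5) E_sym[OF \<open>E c d\<close>]] y_nbrs
      by (simp add: insert_commute)
  qed
qed

end

subsection \<open>Complete bipartite graphs at the root\<close>

context adjacency
begin

lemma biclique_path_lengths_even:
  assumes "finite A" "finite U" "x \<in> A" "A \<inter> U = {}" "\<forall>a\<in>A. \<forall>u\<in>U. E a u"
    "a \<in> A" "a \<noteq> x" "1 \<le> j" "j < card A" "j \<le> card U"
  shows "2 * j \<in> path_lengths E (A \<union> U) x a"
proof -
  have "j + j \<in> path_lengths E (insert x (U \<union> (A - {x}))) x a"
    by (rule alternating_path_lengths) (use assms E_sym in auto)
  moreover have "insert x (U \<union> (A - {x})) = A \<union> U" using assms(3) by auto
  ultimately show ?thesis by (simp add: mult_2)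
qed

lemma biclique_path_lengths_odd:
  assumes "finite A" "finite U" "x \<in> A" "A \<inter> U = {}" "\<forall>a\<in>A. \<forall>u\<in>U. E a u"
    "u \<in> U" "card A \<le> card U" "j < card A"
  shows "1 + 2 * j \<in> path_lengths E (A \<union> U) x u"
proof (cases "j = 0")
  case True
  have "1 \<in> path_lengths E {x, u} x u" by (rule path_lengths_edge) (use assms in auto)
  then show ?thesis using True assms(3,6) by (auto elim: path_lengths_mono)
next
  case False
  have "card (A - {x}) \<noteq> 0" using assms(1,3,8) False by simp
  then have "A - {x} \<noteq> {}" by force
  then obtain a where a: "a \<in> A" "a \<noteq> x" by blast
  have "2 * j \<in> path_lengths E (A \<union> (U - {u})) x a"
    by (rule biclique_path_lengths_even) (use assms a False in auto)
  then have "Suc (2 * j) \<in> path_lengths E (insert u (A \<union> (U - {u}))) x u"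
    by (rule path_lengths_snoc) (use assms a in auto)
  moreover have "insert u (A \<union> (U - {u})) = A \<union> U" using assms(6) by auto
  ultimately show ?thesis by simp
qed

end

context minimal_unlinked
begin

definition common_nbrs :: "'a set \<Rightarrow> 'a set" where
  "common_nbrs A = {b \<in> V - {y} - A. \<forall>a\<in>A. E a b}"

definition biclique :: "'a set \<Rightarrow> bool" where
  "biclique A \<longleftrightarrow> x \<in> A \<and> A \<subseteq> V - {y} \<and> card A \<le> card (common_nbrs A) \<and>
     (\<exists>z\<in>V - (A \<union> common_nbrs A). E z y)"

end

locale maximal_biclique = minimal_counterexample +
  fixes A :: "'a set"
  assumes biclique: "biclique A" and maximal: "\<And>A'. biclique A' \<Longrightarrow> card A' \<le> card A"
begin

definition B :: "'a set" where
  "B = common_nbrs A"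

lemma A: "x \<in> A" "A \<subseteq> V - {y}" "finite A" "1 \<le> card A"
proof -
  show "x \<in> A" "A \<subseteq> V - {y}" using biclique unfolding biclique_def by auto
  then show "finite A" using finite_subset[of A V] by auto
  then show "1 \<le> card A" using \<open>x \<in> A\<close> by (auto simp: Suc_le_eq card_gt_0_iff)
qed

lemma B: "B \<subseteq> V - {x, y}" "A \<inter> B = {}" "finite B" "card A \<le> card B"
  using biclique A(1) unfolding biclique_def B_def common_nbrs_def by auto

lemma complete: "\<forall>a\<in>A. \<forall>b\<in>B. E a b"
  unfolding B_def common_nbrs_def by blast

lemma outside: "\<exists>z\<in>V - (A \<union> B). E z y"
  using biclique unfolding biclique_def B_def by blast

lemma independent: "b \<in> B \<Longrightarrow> b' \<in> B \<Longrightarrow> \<not> E b b'"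
  using no_triangle_at_x[of b b'] complete A(1) B(1) by blast

lemma card_nbrs_A_less:
  assumes "w \<in> V - (A \<union> B) - {y}" shows "card (nbrs E A w) < card A"
proof -
  obtain a where "a \<in> A" "\<not> E a w" using assms unfolding B_def common_nbrs_def by blast
  then show ?thesis using card_nbrs_less[OF A(3), of a E w] E_sym by blast
qed

lemma no_triangle:
  assumes w: "w \<in> V - (A \<union> B) - {y}" and "a \<in> A" "b \<in> B"
  shows "\<not> (E w a \<and> E w b)"
proof (cases "a = x")
  case True
  then show ?thesis using no_triangle_at_x[of w b] w assms(3) complete A(1) B(1) E_sym by blast
next
  case False
  have "b \<in> V - {x, y}" "a \<in> V - {x, y}" "w \<in> V - {x, y}" "E x b" "E b a"
    using assms A(1,2) B(1) complete False E_sym by blast+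
  then show ?thesis using no_triangle_behind_x[of b a w] E_sym by blast
qed

lemma hub_right:
  assumes "U \<subseteq> B" "card A \<le> card U" shows "hub (A \<union> U) U (card A - 1)"
proof -
  have "finite U" using assms(1) B(3) finite_subset by blast
  have "1 + 2 * i \<in> (\<Inter>u\<in>U. path_lengths E (A \<union> U) x u)" if "i < card A - 1 + 1" for i
  proof
    fix u assume "u \<in> U"
    then show "1 + 2 * i \<in> path_lengths E (A \<union> U) x u"
      using that assms A(1,3,4) B(2) complete \<open>finite U\<close> by (intro biclique_path_lengths_odd) auto
  qed
  then have "admissible (card A - 1 + 1) (\<Inter>u\<in>U. path_lengths E (A \<union> U) x u)"
    by (rule admissible_step_2I)
  then show ?thesis unfolding hub_def using A(1,2) B(1) assms(1) by blast
qed

lemma hub_left: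
  assumes U: "U \<subseteq> B" "card A \<le> card U" and "T \<subseteq> A - {x}" "2 \<le> card A"
  shows "hub (A \<union> U) T (card A - 2)"
proof -
  have "finite U" using U(1) B(3) finite_subset by blast
  have "2 + 2 * i \<in> (\<Inter>a\<in>T. path_lengths E (A \<union> U) x a)" if "i < card A - 2 + 1" for i
  proof
    fix a assume "a \<in> T"
    then have "2 * (i + 1) \<in> path_lengths E (A \<union> U) x a"
      using that assms A(1,3) B(2) complete \<open>finite U\<close> by (intro biclique_path_lengths_even) auto
    then show "2 + 2 * i \<in> path_lengths E (A \<union> U) x a" by simp
  qed
  then have "admissible (card A - 2 + 1) (\<Inter>a\<in>T. path_lengths E (A \<union> U) x a)"
    by (rule admissible_step_2I)
  then show ?thesis unfolding hub_def using A(1,2) B(1) assms(1,3) by blast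
qed

lemma light_right:
  assumes p: "p \<in> V - (A \<union> B) - {y}" and few: "card (nbrs E B p) \<le> card A" and U: "U \<subseteq> B"
  shows "light (A \<union> U) U (card A - 1) p"
proof (cases "\<exists>u\<in>U. E p u")
  case True
  then have "nbrs E (A \<union> U) p \<subseteq> nbrs E B p" using no_triangle[OF p] U unfolding nbrs_def by blast
  then have "card (nbrs E (A \<union> U) p) \<le> card (nbrs E B p)" using B(3) by (intro card_mono) auto
  then show ?thesis using few True unfolding light_def by simp
next
  case False
  then have "nbrs E (A \<union> U) p = nbrs E A p" by auto
  then show ?thesis using card_nbrs_A_less[OF p] unfolding light_def by simp
qed

lemma many_nbrs_y:
  assumes w: "w \<in> V - (A \<union> B) - {y}" and many: "card A < card (nbrs E B w)"
  shows "nbrs E V y \<subseteq> insert w (A \<union> B)"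
proof (rule ccontr)
  assume "\<not> ?thesis"
  then obtain z where z: "z \<in> V" "E z y" "z \<notin> insert w (A \<union> B)"
    using E_sym unfolding nbrs_def by blast
  have common: "common_nbrs (insert w A) = nbrs E B w"
    using w unfolding B_def common_nbrs_def by (auto simp: nbrs_def)
  have "biclique (insert w A)"
    unfolding biclique_def common using z w A many by (auto simp: nbrs_def)
  then show False using maximal[of "insert w A"] w A(3) by auto
qed

lemma singleton_A: "card A = 1 \<Longrightarrow> A = {x}"
  using A(1) by (metis card_1_singletonE singletonD)

lemma pair_A:
  assumes "card A = 2" obtains a where "A = {x, a}" "a \<noteq> x"
  using assms A(1) unfolding card_2_iff by (metis insert_commute insert_iff singletonD)

lemma boundary_not_pair_outside:
  assumes "D \<noteq> {}" "D \<subseteq> V - (A \<union> B) - {y}" "c \<in> V - D"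
  shows "\<not> boundary E V D \<subseteq> {x, c}"
proof (rule boundary_not_pair)
  have "B \<noteq> {}" using A(4) B(4) by auto
  then show "V - D - {x, y} \<noteq> {}" using assms(2) B(1) by blast
qed (use assms A(1) in auto)

lemma wide_not_pendant:
  assumes U: "U \<subseteq> B" "card A \<le> card U" and D: "D \<inter> B = {}" and "3 \<le> card A"
  shows "\<not> pendant (A \<union> U) U D c"
proof
  assume pendant: "pendant (A \<union> U) U D c"
  note D' = pendantD[OF pendant]
  define T where "T = (A \<union> U - U - {x}) \<inter> boundary E V D"
  have T: "T \<subseteq> A - {x}" unfolding T_def by blast
  show False
  proof (rule wide_pendant_absurd[OF pendant _ _ _ T_def hub_left[OF U T]])
    fix d assume d: "d \<in> D"
    have dV: "d \<in> V - (A \<union> B) - {y}" using d D D'(2) by blast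
    have "\<not> E d u" if "u \<in> U" for u
      using boundary_subsetD[OF D'(5) d, of u] that U(1) B(1) D'(2,4) by blast
    then have nbrs_A: "nbrs E (A \<union> U) d = nbrs E A d" by auto
    show "light (A \<union> U) T (card A - 2) d"
    proof (cases "\<exists>a\<in>T. E d a")
      case True
      then show ?thesis
        using card_nbrs_A_less[OF dV] nbrs_A \<open>3 \<le> card A\<close> unfolding light_def by simp
    next
      case False
      have "a = x" if a: "a \<in> A" "E d a" for a
      proof (rule ccontr)
        assume "a \<noteq> x"
        moreover have "a \<in> boundary E V D" using a d D'(2) A(2) by auto
        ultimately have "a \<in> T" using a(1) B(2) U(1) unfolding T_def by blast
        then show False using False a(2) by blast
      qed
      then have "nbrs E A d \<subseteq> {x}" by auto
      then have "card (nbrs E A d) \<le> 1" using card_mono[of "{x}"] by fastforce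
      then show ?thesis using nbrs_A \<open>3 \<le> card A\<close> unfolding light_def by simp
    qed
  qed (use U B(1) A(4) \<open>3 \<le> card A\<close> in auto)
qed

lemma not_pendant:
  assumes U: "U \<subseteq> B" "card A \<le> card U" and D: "D \<inter> B = {}" and "c \<noteq> y"
  shows "\<not> pendant (A \<union> U) U D c"
proof
  assume pendant: "pendant (A \<union> U) U D c"
  note D' = pendantD[OF pendant]
  have outside_D: "D \<subseteq> V - (A \<union> B) - {y}" using D D'(2) by blast
  have A_eq: "A \<union> U - U = A" using U(1) B(2) by blast
  consider "card A = 1" | "card A = 2" | "3 \<le> card A" using A(4) by linarith
  then show False
  proof cases
    case 1
    then have "boundary E V D \<subseteq> {x, c}" using D'(5) singleton_A unfolding A_eq by auto
    then show False using boundary_not_pair_outside[OF D'(1) outside_D] D'(4) by blast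
  next
    case 2
    then obtain a where a: "A = {x, a}" "a \<noteq> x" by (rule pair_A)
    show False
    proof (rule narrow_pendant_absurd[OF pendant \<open>c \<noteq> y\<close> _ _ a(2)])
      show "\<not> (E d x \<and> E d a)" if "d \<in> D" for d
      proof
        assume common: "E d x \<and> E d a"
        have "d \<in> V - (A \<union> B) - {y}" using that outside_D by blast
        from card_nbrs_A_less[OF this] show False using common a by (simp add: card_nbrs_insert)
      qed
      have "finite U" using U(1) B(3) finite_subset by blast
      then have "2 * 1 \<in> path_lengths E (A \<union> U) x a"
        using U A(1,3) B(2) complete a 2 by (intro biclique_path_lengths_even) auto
      then show "path_lengths E (A \<union> U) x a \<noteq> {}" by blast
    qed (use A(2) B(1) U(1) A_eq a in auto)
  next
    case 3
    then show False using wide_not_pendant[OF U D] pendant by blast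
  qed
qed

lemma not_blocked:
  assumes W: "W \<subseteq> V - (A \<union> B) - {y}" "y \<in> boundary E V W" "boundary E V W \<subseteq> insert y (A \<union> B - B)"
  shows "y \<in> boundary E V (V - (A \<union> B) - {y} - W)"
proof (rule ccontr)
  assume unattached: "y \<notin> boundary E V (V - (A \<union> B) - {y} - W)"
  have A_eq: "A \<union> B - B = A" using B(2) by blast
  consider "card A = 1" | "card A = 2" | "3 \<le> card A" using A(4) by linarith
  then show False
  proof cases
    case 1
    then have "boundary E V W \<subseteq> {x, y}" using W(3) singleton_A unfolding A_eq by auto
    then show False using boundary_not_pair_outside[OF _ W(1), of y] W(1,2) by auto
  next
    case 2
    then obtain a where a: "A = {x, a}" "a \<noteq> x" by (rule pair_A)
    have Q: "A \<union> B \<subseteq> V - {y}" "A \<union> B - B = {x, a}" using A(2) B(1) A_eq a(1) by auto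
    show False
    proof (rule narrow_block_absurd[OF Q a(2) _ _ W unattached])
      fix z assume z: "z \<in> B" "E z y"
      show "3 \<le> k"
      proof (rule ccontr)
        assume "\<not> 3 \<le> k"
        then have "1 + 2 * i \<in> path_lengths E (A \<union> B) x z" if "i < k" for i
          using that z(1) A(1,3) B 2 complete by (intro biclique_path_lengths_odd) auto
        then have "admissible k (path_lengths E (A \<union> B) x z)" by (rule admissible_step_2I)
        then show False using not_admissible_to_neighbour[OF z(2) Q(1)] by blast
      qed
    qed (use 2 B(4) in auto)
  next
    case 3
    have "y \<notin> A \<union> B" using A(2) B(1) by blast
    then obtain D where pendant: "pendant (A \<union> B) B D y" by (rule ex_pendant_at_y[OF W])
    have "D \<inter> B = {}" using pendantD(2)[OF pendant] by blast
    then show False using wide_not_pendant[OF subset_refl B(4)] 3 pendant by blast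
  qed
qed

lemma last_edge_absurd:
  assumes w: "w \<in> V - (A \<union> B) - {y}" "card A < card (nbrs E B w)" "E w y" and b: "b \<in> B" "E w b"
    and nbrs_b: "nbrs E V b \<subseteq> A \<union> {y, w}"
  shows False
proof -
  have b': "b \<in> V - {x, y}" "b \<notin> A" "b \<noteq> w" "w \<notin> A" "w \<notin> B" using b w B(1,2) by auto
  show False
  proof (cases "E b y")
    case True
    have "card (nbrs E V b) \<le> card (A \<union> {y, w})" using nbrs_b A(3) by (intro card_mono) auto
    also have "\<dots> \<le> card A + card {y, w}" by (rule card_Un_le)
    also have "card {y, w} = 2" using w(1) by auto
    finally have "k \<le> card A + 1" using degree[OF b'(1)] by simp
    then have "1 + 2 * i \<in> path_lengths E (insert w A \<union> nbrs E B w) x b" if "i < k" for i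
      using that A(1,3) B b b' complete w(2) by (intro biclique_path_lengths_odd) auto
    then have "admissible k (path_lengths E (insert w A \<union> nbrs E B w) x b)"
      by (rule admissible_step_2I)
    moreover have "insert w A \<union> nbrs E B w \<subseteq> V - {y}" using w(1) A(2) B(1) by auto
    ultimately show False using not_admissible_to_neighbour[OF True] by blast
  next
    case False
    have "nbrs E V b \<subseteq> insert w A" using nbrs_b False by auto
    then have "card (nbrs E V b) \<le> card (insert w A)" using A(3) by (intro card_mono) auto
    then have k: "k \<le> card A" using degree[OF b'(1)] b'(4) A(3) by simp
    have "2 + 2 * i \<in> path_lengths E (insert w (A \<union> B)) x w" if "i < k" for i
    proof -
      have "1 + 2 * i \<in> path_lengths E (A \<union> B) x b"
        using that k A(1,3) B b(1) complete by (intro biclique_path_lengths_odd) auto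
      then have "Suc (1 + 2 * i) \<in> path_lengths E (insert w (A \<union> B)) x w"
        by (rule path_lengths_snoc) (use E_sym[OF b(2)] b' in auto)
      then show ?thesis by simp
    qed
    then have "admissible k (path_lengths E (insert w (A \<union> B)) x w)" by (rule admissible_step_2I)
    moreover have "insert w (A \<union> B) \<subseteq> V - {y}" using w(1) A(2) B(1) by auto
    ultimately show False using not_admissible_to_neighbour[OF w(3)] by blast
  qed
qed

lemma card_nbrs_B_other:
  assumes w: "w \<in> V - (A \<union> B)" "E w y" and p: "p \<in> V - (A \<union> B) - {y, w}"
  shows "card (nbrs E B p) \<le> card A"
proof (rule ccontr)
  assume "\<not> ?thesis"
  then have "nbrs E V y \<subseteq> insert p (A \<union> B)" using p by (intro many_nbrs_y) auto
  moreover have "w \<in> nbrs E V y" using w(1) E_sym[OF w(2)] by auto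
  ultimately show False using w(1) p by blast
qed

lemma last_vertex_absurd:
  assumes w: "w \<in> V - (A \<union> B) - {y}" "card A < card (nbrs E B w)" "E w y"
    and nbrs_y: "nbrs E V y \<subseteq> insert w (A \<union> B)" and nbrs_w: "nbrs E V w \<subseteq> insert y (A \<union> B)"
  shows False
proof -
  have "nbrs E B w \<noteq> {}" using w(2) by force
  then obtain b where b: "b \<in> B" "E w b" by auto
  have b': "b \<in> V - {x, y}" "b \<notin> A" "b \<noteq> w" using b w(1) B(1,2) by auto
  let ?R = "V - (A \<union> B) - {y, w}"
  have not_adjacent: "\<not> E p y" "\<not> E p w" if "p \<in> ?R" for p
    using that nbrs_y nbrs_w E_sym[of p y] E_sym[of p w] unfolding nbrs_def by blast+
  have closed: "boundary E V ?R \<subseteq> A \<union> B" using not_adjacent unfolding boundary_def by blast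
  show False
  proof (cases "\<exists>p\<in>?R. E p b")
    case False
    have "nbrs E V b \<subseteq> A \<union> {y, w}"
    proof
      fix v assume "v \<in> nbrs E V b"
      then have "v \<in> V" "E v b" "v \<notin> B" using independent[OF b(1)] E_sym by auto
      then show "v \<in> A \<union> {y, w}" using False by blast
    qed
    then show False by (rule last_edge_absurd[OF w b])
  next
    case True
    have smaller: "B - {b} \<subseteq> B" "card A \<le> card (B - {b})"
      using w(2) card_nbrs_le[OF B(3), of E w] b(1) B(3) by auto
    show False
    proof (rule region_absurd[OF hub_right[OF smaller], of ?R b])
      show "boundary E V ?R \<subseteq> insert b (A \<union> (B - {b}))" using closed by blast
      show "light (A \<union> (B - {b})) (B - {b}) (card A - 1) p" if p: "p \<in> ?R" for p
      proof (rule light_right)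
        show "card (nbrs E B p) \<le> card A" using w(1) by (intro card_nbrs_B_other[OF _ w(3) p]) auto
      qed (use p in auto)
      have "1 \<in> path_lengths E {w, y} w y" by (rule path_lengths_edge) (use w(1,3) in auto)
      then have "Suc 1 \<in> path_lengths E (insert b {w, y}) b y"
        by (rule path_lengths_Cons) (use E_sym[OF b(2)] b' in auto)
      then have "Suc 1 \<in> path_lengths E (V - (A \<union> (B - {b})) - ?R) b y"
        by (rule path_lengths_mono) (use b(1) b' w(1) A(2) B(1) in auto)
      then show "path_lengths E (V - (A \<union> (B - {b})) - ?R) b y \<noteq> {}" by blast
      show "\<not> pendant (A \<union> (B - {b})) (B - {b}) D c" if "D \<subseteq> ?R" "c \<noteq> y" for D c
        using not_pendant[OF smaller _ that(2)] that(1) by blast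
      show "k + 1 \<le> card (nbrs E V p)" if "p \<in> ?R" for p using that A(1) by (intro degree) auto
    qed (use True b(1) b' in auto)
  qed
qed

lemma absurd: False
proof (rule maximal_hub_absurd[OF hub_right[OF subset_refl B(4)] outside])
  have many: "card A < card (nbrs E B w)"
    if "w \<in> V - (A \<union> B) - {y}" "\<not> light (A \<union> B) B (card A - 1) w" for w
    using light_right[OF that(1) _ subset_refl] that(2) by (meson not_le)
  show "k + 1 \<le> card (nbrs E V p)" if "p \<in> V - (A \<union> B) - {y}" for p
    using that A(1) by (intro degree) auto
  show "nbrs E V y \<subseteq> insert w (A \<union> B)"
    if "w \<in> V - (A \<union> B) - {y}" "\<not> light (A \<union> B) B (card A - 1) w" for w
    using many_nbrs_y[OF that(1) many[OF that]] .
  show "\<not> nbrs E V w \<subseteq> insert y (A \<union> B)"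
    if "w \<in> V - (A \<union> B) - {y}" "\<not> light (A \<union> B) B (card A - 1) w" "E w y"
      "nbrs E V y \<subseteq> insert w (A \<union> B)" for w
    using last_vertex_absurd[OF that(1) many[OF that(1,2)] that(3,4)] by blast
  show "\<not> pendant (A \<union> B) B D c" if "c \<noteq> y" for D c
    using not_pendant[OF subset_refl B(4) _ that] pendantD(2)[of "A \<union> B" B D c] by blast
qed (rule not_blocked)

end

context minimal_counterexample
begin

lemma biclique_root: "biclique {x}"
proof -
  have "V - {x, y} \<noteq> {}" using nontrivial by auto
  from boundary_not_singleton[OF this, of y] obtain d where "d \<in> V - {x, y}" "E d x"
    unfolding boundary_def by blast
  then have "d \<in> common_nbrs {x}" using E_sym unfolding common_nbrs_def by auto
  moreover have "finite (common_nbrs {x})" unfolding common_nbrs_def by simp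
  ultimately have "1 \<le> card (common_nbrs {x})" by (auto simp: Suc_le_eq card_gt_0_iff)
  moreover obtain u v where uv: "u \<in> V - {x}" "v \<in> V - {x}" "E u y" "E v y" "E u v"
    using ex_triangle_at_y by blast
  then have "u \<noteq> y" "v \<noteq> y" by auto
  then have "\<not> (E x u \<and> E x v)" using no_triangle_at_x[of u v] uv by blast
  then have "\<exists>z\<in>V - ({x} \<union> common_nbrs {x}). E z y" using uv unfolding common_nbrs_def by auto
  ultimately show ?thesis unfolding biclique_def by auto
qed

lemma contradiction: False
proof -
  have "card A < card V + 1" if "biclique A" for A
  proof -
    have "A \<subseteq> V" using that unfolding biclique_def by blast
    then show ?thesis using card_mono[OF finite_V, of A] by simp
  qed
  then obtain A where "biclique A" "\<And>A'. biclique A' \<Longrightarrow> card A' \<le> card A"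
    using ex_has_greatest_nat[of biclique "{x}" card] biclique_root by blast
  then interpret maximal_biclique E V x y k A by unfold_locales
  show False by (rule absurd)
qed

end

theorem rooted_graph_linked:
  assumes "rooted_graph E V x y k" shows "linked E (V - {x, y}) {x} {y} k"
  using assms
proof (induction "card V" arbitrary: E V x y k rule: less_induct)
  case less
  then have adjacency: "adjacency E" and rooted: "rooted E V x y" "V \<noteq> {x, y}"
    and degree: "k \<le> 1 \<or> (\<forall>v\<in>V - {x, y}. k + 1 \<le> card (nbrs E V v))"
    unfolding rooted_graph_def by auto
  show ?case
  proof (rule ccontr)
    assume unlinked: "\<not> ?thesis"
    then have "\<not> k \<le> 1" using adjacency.linked_if_le_1[OF adjacency rooted] by blast
    then interpret minimal_counterexample E V x y k
      using adjacency rooted degree unlinked less.hyps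
      by (intro minimal_counterexample.intro minimal_unlinked.intro linking_below.intro
          linking_below_axioms.intro minimal_unlinked_axioms.intro minimal_counterexample_axioms.intro) auto
    show False by (rule contradiction)
  qed
qed

subsection \<open>Cycles through triangles\<close>

definition cycle_lengths :: "('a \<Rightarrow> 'a \<Rightarrow> bool) \<Rightarrow> 'a set \<Rightarrow> nat set" where
  "cycle_lengths E V = {n. 3 \<le> n \<and> (\<exists>xs. path_in E V xs \<and> E (last xs) (hd xs) \<and> length xs = n)}"

lemma cycle_lengths_mono: "n \<in> cycle_lengths E S \<Longrightarrow> S \<subseteq> T \<Longrightarrow> n \<in> cycle_lengths E T"
  unfolding cycle_lengths_def path_in_def by blast

lemma cycle_lengths_join:
  assumes "m \<in> path_lengths E S a b" "n \<in> path_lengths E T b a" "S \<inter> T \<subseteq> {a, b}" "a \<noteq> b" "3 \<le> m + n"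
  shows "m + n \<in> cycle_lengths E (S \<union> T)"
proof -
  obtain xs where xs: "path_in E S xs" "hd xs = a" "last xs = b" "length xs = Suc m"
    using assms(1) by (rule path_lengthsE)
  obtain ys where ys: "path_in E T ys" "hd ys = b" "last ys = a" "length ys = Suc n"
    using assms(2) by (rule path_lengthsE)
  obtain zs where zs: "ys = b # zs @ [a]"
  proof -
    obtain ws where ws: "ys = b # ws" using ys(1,2) unfolding path_in_def by (cases ys) auto
    have "ws \<noteq> []" using ws ys(3) assms(4) by auto
    then have "ws = butlast ws @ [a]" using ws ys(3) by (metis append_butlast_last_id last_ConsR)
    then show ?thesis using ws that by metis
  qed
  have nonempty: "xs \<noteq> []" using xs(1) unfolding path_in_def by simp
  have disjoint: "set xs \<inter> set zs = {}" using xs(1) ys(1) zs assms(3) unfolding path_in_def by auto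
  have steps: "successively E (b # zs @ [a])" using ys(1) zs unfolding path_in_def by simp
  have "path_in E (S \<union> T) (xs @ zs)"
    using xs ys zs disjoint steps nonempty unfolding path_in_def
    by (auto simp: successively_append_iff successively_Cons split: if_splits)
  moreover have "E (last (xs @ zs)) (hd (xs @ zs))"
    using steps xs nonempty
    by (cases "zs = []") (auto simp: successively_Cons successively_append_iff)
  moreover have "length (xs @ zs) = m + n" using xs(4) ys(4) zs by simp
  ultimately show ?thesis using assms(5) unfolding cycle_lengths_def by blast
qed

lemma clique_cycle_lengths:
  assumes "pairwise E Q" "finite Q" "3 \<le> n" "n \<le> card Q" shows "n \<in> cycle_lengths E Q"
proof -
  have "2 \<le> card Q" using assms by simp
  then obtain R where "R \<subseteq> Q" "card R = 2" using obtain_subset_with_card_n by metis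
  then obtain a b where ab: "a \<in> Q" "b \<in> Q" "a \<noteq> b" by (auto simp: card_2_iff)
  then have "n - 1 \<in> path_lengths E Q a b" using assms by (intro clique_path_lengths) auto
  moreover have "1 \<in> path_lengths E {b, a} b a"
    using assms(1) ab unfolding pairwise_def by (intro path_lengths_edge) auto
  ultimately have "n - 1 + 1 \<in> cycle_lengths E (Q \<union> {b, a})"
    using ab assms(3) by (intro cycle_lengths_join) auto
  then show ?thesis using ab assms(3) by (simp add: insert_absorb)
qed

locale three_connected_min_degree = adjacency E for E :: "'a \<Rightarrow> 'a \<Rightarrow> bool" +
  fixes V :: "'a set" and k :: nat
  assumes finite_V [simp]: "finite V"
    and no_separator: "\<And>D S. D \<noteq> {} \<Longrightarrow> D \<union> S \<subset> V \<Longrightarrow> D \<inter> S = {} \<Longrightarrow> card S < 3 \<Longrightarrow>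
      \<not> boundary E V D \<subseteq> S"
    and min_degree: "\<And>v. v \<in> V \<Longrightarrow> k \<le> card (nbrs E V v)" and k_ge_6: "6 \<le> k"

sublocale three_connected_min_degree \<subseteq> linking_below E "card V + 3"
  by unfold_locales (rule rooted_graph_linked)

context three_connected_min_degree
begin

lemma no_pair_separator:
  assumes "D \<noteq> {}" "D \<subseteq> V - {a, b}" "a \<in> V" "b \<in> V" "V - D - {a, b} \<noteq> {}"
  shows "\<not> boundary E V D \<subseteq> {a, b}"
  by (rule no_separator) (use assms in \<open>auto simp: card_insert_if\<close>)

lemma no_cutvertex:
  assumes "D \<noteq> {}" "D \<subseteq> V - {a}" "a \<in> V" "V - D - {a} \<noteq> {}"
  shows "\<not> boundary E V D \<subseteq> {a}"
  using no_pair_separator[of D a a] assms by simp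

lemma card_V: "v \<in> V \<Longrightarrow> k < card V"
proof -
  assume v: "v \<in> V"
  then have "card (nbrs E V v) < card V" using finite_V by (intro card_nbrs_less[of V v]) auto
  then show ?thesis using min_degree[OF v] by simp
qed

lemma linked_component:
  assumes XY: "X \<subseteq> V" "Y \<subseteq> V" "X \<inter> Y = {}" and P: "component E (V - (X \<union> Y)) P"
    and meets: "boundary E V P \<inter> X \<noteq> {}" "boundary E V P \<inter> Y \<noteq> {}"
    and degree: "\<And>p. p \<in> P \<Longrightarrow> c + 1 + card (nbrs E (X \<union> Y) p) \<le>
      k + of_bool (\<exists>v\<in>X. E p v) + of_bool (\<exists>v\<in>Y. E p v)"
  shows "linked E P X Y c"
proof -
  note P_props = componentD[OF P]
  have closed: "boundary E V P \<subseteq> X \<union> Y \<union> {}" using component_boundary_Diff[OF P] by simp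
  show ?thesis
  proof (rule linked_region[OF finite_V _ P_props(3) _ _ _ _ _ meets closed])
    have "card P \<le> card V" using P_props(2) by (intro card_mono) auto
    then show "card P + 2 < card V + 3" by simp
    show "\<not> boundary E V D \<subseteq> {e}" if D: "D \<noteq> {}" "D \<subseteq> P" "e \<in> P - D" for D e
    proof (rule no_cutvertex[OF D(1)])
      obtain a where "a \<in> X" using meets(1) by blast
      then have "a \<in> V - D - {e}" using D P_props(2) XY(1) by blast
      then show "V - D - {e} \<noteq> {}" by blast
    qed (use D P_props(2) in auto)
    show "c \<le> 1 \<or> c + 1 + card (nbrs E (X \<union> Y \<union> {}) p) \<le>
        card (nbrs E V p) + of_bool (\<exists>v\<in>X. E p v) + of_bool (\<exists>v\<in>Y. E p v)" if "p \<in> P" for p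
    proof -
      have "p \<in> V" using that P_props(2) by blast
      from degree[OF that] min_degree[OF this] show ?thesis unfolding Un_empty_right by linarith
    qed
  qed (use P_props(2) XY in auto)
qed

lemma consecutive_cycles_split:
  assumes XY: "X \<subseteq> V" "Y \<subseteq> V" "X \<inter> Y = {}" and P: "component E (V - (X \<union> Y)) P"
    and meets: "boundary E V P \<inter> X \<noteq> {}" "boundary E V P \<inter> Y \<noteq> {}"
    and degree: "\<And>p. p \<in> P \<Longrightarrow> c + 1 + card (nbrs E (X \<union> Y) p) \<le>
      k + of_bool (\<exists>v\<in>X. E p v) + of_bool (\<exists>v\<in>Y. E p v)"
    and "1 \<le> c" "1 \<le> l" "k \<le> c + l"
    and paths: "\<And>a b n. a \<in> X \<Longrightarrow> b \<in> Y \<Longrightarrow> 1 \<le> n \<Longrightarrow> n \<le> l + 1 \<Longrightarrow> n \<in> path_lengths E (X \<union> Y) b a"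
  shows "progression 1 k (cycle_lengths E V)"
proof -
  note P_props = componentD[OF P]
  have "linked E P X Y c" using XY P meets degree by (rule linked_component)
  then obtain p b where p: "p \<in> P" "b \<in> Y" "E p b"
    and adm: "admissible c (\<Union>a\<in>X. path_lengths E (insert a P) a p)"
    unfolding linked_def by blast
  have "progression 1 (l + 1) {2..l + 2}" by (rule progressionI[of _ 2]) auto
  then have "progression 1 (l + 1 + c - 1) (cycle_lengths E V)"
  proof (rule admissible_sum_interval[OF _ adm])
    fix m n assume m: "m \<in> {2..l + 2}" and n: "n \<in> (\<Union>a\<in>X. path_lengths E (insert a P) a p)"
    obtain a where a: "a \<in> X" "n \<in> path_lengths E (insert a P) a p" using n by blast
    have b: "b \<notin> insert a P" "a \<noteq> b" using p(2) a(1) P_props(2) XY by auto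
    have "Suc n \<in> path_lengths E (insert b (insert a P)) a b"
      by (rule path_lengths_snoc[OF a(2) p(3) b(1)])
    moreover have "m - 1 \<in> path_lengths E (X \<union> Y) b a" using m by (intro paths a(1) p(2)) auto
    moreover have "n \<noteq> 0" using path_lengths_0D[of E _ a p] a p(1) P_props(2)
      by (metis DiffD2 UnCI subsetD)
    ultimately have "Suc n + (m - 1) \<in> cycle_lengths E (insert b (insert a P) \<union> (X \<union> Y))"
      using P_props(2) b m by (intro cycle_lengths_join) auto
    then have "Suc n + (m - 1) \<in> cycle_lengths E V"
      by (rule cycle_lengths_mono) (use P_props(2) XY a(1) p(2) in auto)
    then show "m + n \<in> cycle_lengths E V" using m by (simp add: add.commute)
  qed (use assms(8,9) in auto)
  then show ?thesis by (rule progression_le) (use assms(10) in simp)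
qed

lemma ex_attached_component:
  assumes XY: "X \<subseteq> V" "Y \<subseteq> V" "X \<inter> Y = {}" "X \<noteq> {}" "Y \<noteq> {}" "card X < 3" "card Y < 3"
  obtains P where "component E (V - (X \<union> Y)) P" "boundary E V P \<inter> X \<noteq> {}" "boundary E V P \<inter> Y \<noteq> {}"
proof -
  obtain a where "a \<in> X" using XY(4) by blast
  then have "card (X \<union> Y) < card V"
    using card_V[of a] XY(1,6,7) k_ge_6 card_Un_le[of X Y] by auto
  then have "X \<union> Y \<noteq> V" by auto
  then obtain v where "v \<in> V - (X \<union> Y)" using XY(1,2) by blast
  then obtain P where P: "component E (V - (X \<union> Y)) P" by (rule ex_component[OF sym])
  note P_props = componentD[OF P]
  have "P \<union> X \<subset> V" "P \<inter> X = {}" "P \<union> Y \<subset> V" "P \<inter> Y = {}" using XY(1-5) P_props(2) by blast+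
  then have "\<not> boundary E V P \<subseteq> X" "\<not> boundary E V P \<subseteq> Y"
    using no_separator[OF P_props(1)] XY(6,7) by blast+
  then show ?thesis using that[OF P] component_boundary_Diff[OF P] by blast
qed

lemma card_nbrs_split_le:
  assumes XY: "X \<inter> Y = {}" "card X = 2" "2 \<le> card Y" and missed: "v \<in> X \<union> Y" "\<not> E p v"
  shows "card (nbrs E (X \<union> Y) p) + 3 \<le>
    card (X \<union> Y) + of_bool (\<exists>v\<in>X. E p v) + of_bool (\<exists>v\<in>Y. E p v)"
proof -
  have fin: "finite X" "finite Y" using XY(2,3) card.infinite by force+
  have "card (nbrs E (X \<union> Y) p) = card (nbrs E X p) + card (nbrs E Y p)"
    by (rule card_nbrs_Un_disjoint[OF fin XY(1)])
  moreover have "card (X \<union> Y) = card X + card Y" by (rule card_Un_disjoint[OF fin XY(1)])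
  moreover have "card (nbrs E (X \<union> Y) p) < card (X \<union> Y)"
    using fin missed card_nbrs_less[of "X \<union> Y" v E p] by simp
  moreover have "card (nbrs E X p) \<le> card X" "card (nbrs E Y p) \<le> card Y"
    by (simp_all add: card_nbrs_le fin)
  ultimately show ?thesis
    using XY(2,3) card_nbrs_eq_0[of X E p] card_nbrs_eq_0[of Y E p] by (auto split: if_splits)
qed

lemma consecutive_cycles_maximal_clique:
  assumes Q: "pairwise E Q" "Q \<subseteq> V" "Q \<noteq> V" "4 \<le> card Q" "card Q \<le> k + 1"
    and maximal: "\<And>w. w \<in> V - Q \<Longrightarrow> \<exists>q\<in>Q. \<not> E w q"
  shows "progression 1 k (cycle_lengths E V)"
proof -
  have finQ: "finite Q" using Q(2) finite_subset[OF _ finite_V] by blast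
  obtain v where "v \<in> V - Q" using Q(2,3) by blast
  then obtain P where P: "component E (V - Q) P" by (rule ex_component[OF sym])
  note P_props = componentD[OF P]
  have closed: "boundary E V P \<subseteq> Q" by (rule component_boundary_Diff[OF P])
  have large: "Q - {a, b} \<noteq> {}" for a b
  proof
    assume "Q - {a, b} = {}"
    then have "card Q \<le> card {a, b}" by (intro card_mono) auto
    then show False using Q(4) by (simp add: card_insert_if split: if_splits)
  qed
  have not_pair: "\<not> boundary E V P \<subseteq> {a, b}" if "a \<in> Q" "b \<in> Q" for a b
    using large[of a b] that P_props(1,2) Q(2) by (intro no_pair_separator) auto
  obtain q where q: "q \<in> Q" using large by blast
  obtain a where a: "a \<in> boundary E V P" using not_pair[OF q q] by blast
  then have "a \<in> Q" using closed by blast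
  obtain b where b: "b \<in> Q" "b \<noteq> a" using large[of a a] by blast
  define X where "X = {a, b}"
  define Y where "Y = Q - X"
  have XY: "X \<union> Y = Q" "X \<inter> Y = {}" unfolding X_def Y_def using \<open>a \<in> Q\<close> b by auto
  have card_X: "card X = 2" using b unfolding X_def by simp
  then have card_Y: "card Y = card Q - 2"
    unfolding Y_def using \<open>a \<in> Q\<close> b(1) by (subst card_Diff_subset) (auto simp: X_def)
  show ?thesis
  proof (rule consecutive_cycles_split[of X Y P "k + 2 - card Q" "card Q - 2"])
    show "boundary E V P \<inter> X \<noteq> {}" using a unfolding X_def by blast
    show "boundary E V P \<inter> Y \<noteq> {}"
      using not_pair[OF \<open>a \<in> Q\<close> b(1)] closed unfolding Y_def X_def by blast
    show "k + 2 - card Q + 1 + card (nbrs E (X \<union> Y) p) \<le>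
        k + of_bool (\<exists>v\<in>X. E p v) + of_bool (\<exists>v\<in>Y. E p v)" if p: "p \<in> P" for p
    proof -
      obtain d where d: "d \<in> X \<union> Y" "\<not> E p d" using maximal[of p] p P_props(2) XY(1) by blast
      have "2 \<le> card Y" using card_Y Q(4) by simp
      from card_nbrs_split_le[OF XY(2) card_X this d] show ?thesis
        using Q(4,5) unfolding XY(1) by linarith
    qed
    show "n \<in> path_lengths E (X \<union> Y) d c" if "c \<in> X" "d \<in> Y" "1 \<le> n" "n \<le> card Q - 2 + 1" for c d n
      unfolding XY(1) using that XY finQ Q(1,4) by (intro clique_path_lengths) auto
  qed (use XY Q P in auto)
qed

lemma consecutive_cycles_K4:
  assumes K: "pairwise E K" "K \<subseteq> V" "4 \<le> card K" and not_complete: "\<not> (pairwise E V \<and> card V = k + 1)"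
  shows "progression 1 k (cycle_lengths E V)"
proof -
  define cliques where "cliques = {Q. K \<subseteq> Q \<and> Q \<subseteq> V \<and> pairwise E Q}"
  have "finite cliques" by (rule finite_subset[of _ "Pow V"]) (auto simp: cliques_def)
  moreover have "K \<in> cliques" using K unfolding cliques_def by blast
  ultimately obtain Q where "Q \<in> cliques" and maximal: "\<And>Q'. Q' \<in> cliques \<Longrightarrow> Q \<subseteq> Q' \<Longrightarrow> Q = Q'"
    using finite_has_maximal2[of cliques K] by metis
  then have Q: "K \<subseteq> Q" "Q \<subseteq> V" "pairwise E Q" unfolding cliques_def by auto
  have finQ: "finite Q" using Q(2) finite_subset[OF _ finite_V] by blast
  have "4 \<le> card Q" using K(3) card_mono[OF finQ Q(1)] by simp
  show ?thesis
  proof (cases "k + 2 \<le> card Q")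
    case True
    then have "3 + 1 * i \<in> cycle_lengths E V" if "i < k" for i
      using that clique_cycle_lengths[OF Q(3) finQ, of "3 + i"] Q(2)
      by (auto elim: cycle_lengths_mono)
    then show ?thesis by (rule progressionI)
  next
    case False
    show ?thesis
    proof (rule consecutive_cycles_maximal_clique[OF Q(3,2) _ \<open>4 \<le> card Q\<close>])
      show "Q \<noteq> V"
      proof
        assume "Q = V"
        then have "k < card Q" using card_V \<open>4 \<le> card Q\<close> by fastforce
        then show False using not_complete Q(3) \<open>Q = V\<close> False by simp
      qed
      show "\<exists>q\<in>Q. \<not> E w q" if "w \<in> V - Q" for w
      proof (rule ccontr)
        assume "\<not> ?thesis"
        then have "insert w Q \<in> cliques"
          using that Q pairwise_insert_nbr[OF Q(3), of w] unfolding cliques_def by blast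
        then show False using maximal that by blast
      qed
    qed (use False in simp)
  qed
qed

lemma diamond_path_lengths:
  assumes "E a c" "E a d" "E b c" "E b d" "E c d" "a \<noteq> b" "1 \<le> n" "n \<le> 3"
  shows "n \<in> path_lengths E ({a, b} \<union> {c, d}) c a"
proof -
  have "path_in E ({a, b} \<union> {c, d}) [c, a]" "path_in E ({a, b} \<union> {c, d}) [c, d, a]"
    "path_in E ({a, b} \<union> {c, d}) [c, b, d, a]"
    using assms(1-6) E_sym unfolding path_in_def by auto
  from this[THEN path_lengthsI] have "n \<in> path_lengths E ({a, b} \<union> {c, d}) c a" if "n \<in> {1, 2, 3}"
    using that by (auto simp: numeral_eq_Suc)
  moreover have "n \<in> {1, 2, 3}" using assms(7,8) by auto
  ultimately show ?thesis by blast
qed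

lemma consecutive_cycles_diamond:
  assumes V: "{a, b, c, d} \<subseteq> V" and "E a c" "E a d" "E b c" "E b d" "E c d" "a \<noteq> b"
    and no_K4: "\<And>p. p \<in> V \<Longrightarrow> \<not> (E p a \<and> E p c \<and> E p d)"
  shows "progression 1 k (cycle_lengths E V)"
proof -
  define X where "X = {a, b}"
  define Y where "Y = {c, d}"
  have distinct: "distinct [a, b, c, d]" using assms(2-7) by auto
  have XY: "X \<subseteq> V" "Y \<subseteq> V" "X \<inter> Y = {}" "X \<noteq> {}" "Y \<noteq> {}" "card X < 3" "card Y < 3"
    using V distinct unfolding X_def Y_def by auto
  then obtain P
    where P: "component E (V - (X \<union> Y)) P" "boundary E V P \<inter> X \<noteq> {}" "boundary E V P \<inter> Y \<noteq> {}"
    by (rule ex_attached_component)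
  show ?thesis
  proof (rule consecutive_cycles_split[OF XY(1-3) P, of "k - 2" 2])
    show "k - 2 + 1 + card (nbrs E (X \<union> Y) p) \<le>
        k + of_bool (\<exists>v\<in>X. E p v) + of_bool (\<exists>v\<in>Y. E p v)" if "p \<in> P" for p
    proof -
      have "p \<in> V" using that componentD(2)[OF P(1)] by blast
      moreover have "X \<union> Y = {a, b, c, d}" unfolding X_def Y_def by auto
      then have "card (nbrs E (X \<union> Y) p) = of_bool (E p a) + of_bool (E p b) + of_bool (E p c) + of_bool (E p d)"
        using distinct by (simp add: card_nbrs_insert)
      ultimately show ?thesis using no_K4[of p] k_ge_6 unfolding X_def Y_def by auto
    qed
    show "n \<in> path_lengths E (X \<union> Y) v u" if "u \<in> X" "v \<in> Y" "1 \<le> n" "n \<le> 2 + 1" for u v n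
    proof -
      define u' where "u' = (if u = a then b else a)"
      define v' where "v' = (if v = c then d else c)"
      have XY_eq: "X = {u, u'}" "Y = {v, v'}" "u \<noteq> u'"
        using that(1,2) \<open>a \<noteq> b\<close> unfolding X_def Y_def u'_def v'_def by auto
      have "E u v" "E u v'" "E u' v" "E u' v'" "E v v'"
        using that(1,2) assms(2-6) E_sym unfolding X_def Y_def u'_def v'_def by auto
      then show ?thesis unfolding XY_eq(1,2) using that(3,4) XY_eq(3)
        by (intro diamond_path_lengths) auto
    qed
  qed (use k_ge_6 in auto)
qed

lemma consecutive_cycles_no_diamond:
  assumes V: "{a, b, c} \<subseteq> V" and "E a b" "E a c" "E b c"
    and no_diamond: "\<And>p. p \<in> V - {a} \<Longrightarrow> \<not> (E p b \<and> E p c)"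
  shows "progression 1 k (cycle_lengths E V)"
proof -
  define X where "X = {a}"
  define Y where "Y = {b, c}"
  have distinct: "distinct [a, b, c]" using assms(2-4) by auto
  have XY: "X \<subseteq> V" "Y \<subseteq> V" "X \<inter> Y = {}" "X \<noteq> {}" "Y \<noteq> {}" "card X < 3" "card Y < 3"
    using V distinct unfolding X_def Y_def by auto
  then obtain P
    where P: "component E (V - (X \<union> Y)) P" "boundary E V P \<inter> X \<noteq> {}" "boundary E V P \<inter> Y \<noteq> {}"
    by (rule ex_attached_component)
  have card_XY: "card (X \<union> Y) = 3" using distinct unfolding X_def Y_def by auto
  show ?thesis
  proof (rule consecutive_cycles_split[OF XY(1-3) P, of "k - 1" 1])
    show "k - 1 + 1 + card (nbrs E (X \<union> Y) p) \<le>
        k + of_bool (\<exists>v\<in>X. E p v) + of_bool (\<exists>v\<in>Y. E p v)" if "p \<in> P" for p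
    proof -
      have "p \<in> V - {a}" using that componentD(2)[OF P(1)] unfolding X_def by blast
      moreover have "X \<union> Y = {a, b, c}" unfolding X_def Y_def by auto
      then have "card (nbrs E (X \<union> Y) p) = of_bool (E p a) + of_bool (E p b) + of_bool (E p c)"
        using distinct by (simp add: card_nbrs_insert)
      ultimately show ?thesis using no_diamond[of p] k_ge_6 unfolding X_def Y_def by auto
    qed
    have "pairwise E (X \<union> Y)" using assms(2-4) E_sym unfolding X_def Y_def pairwise_def by auto
    then show "n \<in> path_lengths E (X \<union> Y) v u" if "u \<in> X" "v \<in> Y" "1 \<le> n" "n \<le> 1 + 1" for u v n
      using that card_XY XY(3) by (intro clique_path_lengths) (auto simp: X_def Y_def)
  qed (use k_ge_6 in auto)
qed

lemma consecutive_cycles_triangle: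
  assumes V: "{a, b, c} \<subseteq> V" and abc: "E a b" "E a c" "E b c"
    and not_complete: "\<not> (pairwise E V \<and> card V = k + 1)"
  shows "progression 1 k (cycle_lengths E V)"
proof (cases "\<exists>p\<in>V. E p a \<and> E p b \<and> E p c")
  case True
  then obtain p where p: "p \<in> V" "E p a" "E p b" "E p c" by blast
  have "pairwise E {p, a, b, c}" using p abc E_sym unfolding pairwise_def by auto
  moreover have "p \<notin> {a, b, c}" "a \<notin> {b, c}" "b \<noteq> c" using p abc by auto
  then have "card {p, a, b, c} = 4" by simp
  ultimately show ?thesis
    using consecutive_cycles_K4[OF _ _ _ not_complete, of "{p, a, b, c}"] V p(1) by simp
next
  case no_K4: False
  show ?thesis
  proof (cases "\<exists>d\<in>V - {a}. E d b \<and> E d c")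
    case True
    then obtain d where d: "d \<in> V - {a}" "E d b" "E d c" by blast
    show ?thesis
      by (rule consecutive_cycles_diamond[of a d b c]) (use d V abc no_K4 in auto)
  next
    case False
    then show ?thesis using consecutive_cycles_no_diamond[OF V abc] by blast
  qed
qed

end

subsection \<open>Odd cycles and two-colourings\<close>

text \<open>Cycles are indexed periodically by the integers, so that arcs are images of integer intervals.\<close>

definition periodic_cycle :: "('a \<Rightarrow> 'a \<Rightarrow> bool) \<Rightarrow> int \<Rightarrow> (int \<Rightarrow> 'a) \<Rightarrow> bool" where
  "periodic_cycle E n w \<longleftrightarrow>
     3 \<le> n \<and> (\<forall>i j. w i = w j \<longleftrightarrow> i mod n = j mod n) \<and> (\<forall>i. E (w i) (w (i + 1)))"

lemma periodic_cycle_eq_iff: "periodic_cycle E n w \<Longrightarrow> w i = w j \<longleftrightarrow> i mod n = j mod n"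
  unfolding periodic_cycle_def by blast

lemma periodic_cycle_add_period: "periodic_cycle E n w \<Longrightarrow> w (i + n) = w i"
  by (simp add: periodic_cycle_eq_iff)

lemma periodic_cycle_inj:
  assumes "periodic_cycle E n w" "w s = w t" "\<bar>s - t\<bar> < n" shows "s = t"
proof -
  have "n dvd s - t" using assms(1,2) by (simp add: periodic_cycle_eq_iff mod_eq_dvd_iff)
  then show ?thesis using assms(3) dvd_imp_le_int[of "s - t" n] by (cases "s = t") auto
qed

lemma periodic_cycle_offset:
  assumes "periodic_cycle E n w" "v \<in> range w"
  obtains d where "0 \<le> d" "d < n" "v = w (i + d)"
proof -
  obtain j where j: "v = w j" using assms(2) by blast
  have "0 < n" using assms(1) unfolding periodic_cycle_def by simp
  moreover have "w j = w (i + (j - i) mod n)"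
    using assms(1) by (simp add: periodic_cycle_eq_iff mod_add_right_eq)
  ultimately show ?thesis using j by (intro that[of "(j - i) mod n"]) auto
qed

lemma cycle_list_step:
  assumes "path_in E V xs" "E (last xs) (hd xs)" "j < length xs"
  shows "E (xs ! j) (xs ! (Suc j mod length xs))"
proof (cases "Suc j < length xs")
  case True
  then show ?thesis using assms(1) successively_nth[of E xs j] unfolding path_in_def by simp
next
  case False
  then have "Suc j = length xs" using assms(3) by simp
  moreover have "xs \<noteq> []" using assms(1) unfolding path_in_def by simp
  ultimately show ?thesis
    using assms(2) by (metis diff_Suc_1 hd_conv_nth last_conv_nth mod_self)
qed

lemma periodic_cycle_of_list:
  assumes path: "path_in E V xs" "E (last xs) (hd xs)" and "3 \<le> length xs"
  obtains w where "periodic_cycle E (int (length xs)) w" "range w = set xs"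
proof -
  let ?m = "int (length xs)"
  define w where "w i = xs ! nat (i mod ?m)" for i
  have pos: "0 < ?m" using assms(3) by linarith
  then have index: "nat (i mod ?m) < length xs" for i by (simp add: nat_less_iff)
  have "w i = w j \<longleftrightarrow> i mod ?m = j mod ?m" for i j
  proof -
    have "distinct xs" using path(1) unfolding path_in_def by simp
    then have "w i = w j \<longleftrightarrow> nat (i mod ?m) = nat (j mod ?m)"
      unfolding w_def using index by (simp add: nth_eq_iff_index_eq)
    then show ?thesis using pos by (simp add: eq_nat_nat_iff)
  qed
  moreover have "E (w i) (w (i + 1))" for i
  proof -
    have "int (Suc (nat (i mod ?m)) mod length xs) = (i mod ?m + 1) mod ?m"
      using pos by (simp add: zmod_int add.commute)
    then have "nat ((i + 1) mod ?m) = Suc (nat (i mod ?m)) mod length xs"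
      by (metis mod_add_left_eq nat_int)
    then show ?thesis unfolding w_def using cycle_list_step[OF path index[of i]] by simp
  qed
  ultimately have "periodic_cycle E ?m w" using assms(3) unfolding periodic_cycle_def by auto
  moreover have "range w = set xs"
  proof
    show "range w \<subseteq> set xs" unfolding w_def using index by auto
    show "set xs \<subseteq> range w"
    proof
      fix v assume "v \<in> set xs"
      then obtain i where "i < length xs" "v = xs ! i" by (auto simp: in_set_conv_nth)
      then have "v = w (int i)" unfolding w_def by simp
      then show "v \<in> range w" by blast
    qed
  qed
  ultimately show ?thesis by (rule that)
qed

lemma cycle_lengths_periodicE:
  assumes "n \<in> cycle_lengths E S"
  obtains w where "periodic_cycle E (int n) w" "range w \<subseteq> S"
proof -
  obtain xs where xs: "3 \<le> n" "path_in E S xs" "E (last xs) (hd xs)" "length xs = n"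
    using assms unfolding cycle_lengths_def by blast
  then obtain w where "periodic_cycle E (int n) w" "range w = set xs"
    using periodic_cycle_of_list[OF xs(2,3)] by auto
  then show ?thesis using that xs(2) unfolding path_in_def by blast
qed

lemma periodic_cycle_arc:
  assumes w: "periodic_cycle E n w" and d: "0 \<le> d" "d < n"
  shows "nat d \<in> path_lengths E (w ` {i..i + d}) (w i) (w (i + d))"
proof -
  define xs where "xs = map w [i..i + d]"
  have len: "length xs = Suc (nat d)" unfolding xs_def using d by simp
  have "inj_on w {i..i + d}"
    by (rule inj_onI, rule periodic_cycle_inj[OF w]) (use d in auto)
  then have "distinct xs" unfolding xs_def by (simp add: distinct_map)
  moreover have "successively E xs"
    unfolding successively_conv_nth
  proof (intro allI impI)
    fix j assume "Suc j < length xs"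
    then have "i + int (Suc j) \<le> i + d" using len d by auto
    then have "xs ! j = w (i + int j)" "xs ! Suc j = w (i + int j + 1)"
      unfolding xs_def by (simp_all add: nth_upto ac_simps)
    then show "E (xs ! j) (xs ! Suc j)" using w unfolding periodic_cycle_def by simp
  qed
  ultimately have path: "path_in E (w ` {i..i + d}) xs"
    unfolding path_in_def using len by (auto simp: xs_def)
  have "hd xs = w i" unfolding xs_def using d by (simp add: upto_rec1)
  moreover have "last xs = w (i + d)" unfolding xs_def using d by (simp add: upto_rec2)
  ultimately show ?thesis using path_lengthsI[OF path len] by simp
qed

lemma periodic_cycle_length:
  assumes w: "periodic_cycle E n w" shows "nat n \<in> cycle_lengths E (range w)"
proof -
  have n: "3 \<le> n" using w unfolding periodic_cycle_def by simp
  have "w (n - 1 + 1) = w 0" using w by (simp add: periodic_cycle_eq_iff)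
  moreover have "E (w (n - 1)) (w (n - 1 + 1))" using w unfolding periodic_cycle_def by blast
  moreover have ends: "w 0 \<noteq> w (n - 1)" using periodic_cycle_inj[OF w, of 0 "n - 1"] n by auto
  ultimately have "1 \<in> path_lengths E {w (n - 1), w 0} (w (n - 1)) (w 0)"
    by (intro path_lengths_edge) auto
  moreover have "nat (n - 1) \<in> path_lengths E (range w) (w 0) (w (n - 1))"
    using periodic_cycle_arc[OF w, of "n - 1" 0] n by (auto elim: path_lengths_mono)
  ultimately have "nat (n - 1) + 1 \<in> cycle_lengths E (range w \<union> {w (n - 1), w 0})"
    using n ends by (intro cycle_lengths_join) auto
  moreover have "nat (n - 1) + 1 = nat n" "range w \<union> {w (n - 1), w 0} = range w" using n by auto
  ultimately show ?thesis by simp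
qed

definition two_colouring :: "('a \<Rightarrow> 'a \<Rightarrow> bool) \<Rightarrow> 'a set \<Rightarrow> ('a \<Rightarrow> bool) \<Rightarrow> bool" where
  "two_colouring E S f \<longleftrightarrow> (\<forall>a\<in>S. \<forall>b\<in>S. E a b \<longrightarrow> f a \<noteq> f b)"

lemma two_colouring_path_parity:
  assumes f: "two_colouring E S f" and "n \<in> path_lengths E S a b"
  shows "f a = f b \<longleftrightarrow> even n"
  using assms(2)
proof (induction n arbitrary: b)
  case 0
  then show ?case using path_lengths_0D by fastforce
next
  case (Suc n)
  then have "a \<noteq> b" using path_lengths_sameD by fastforce
  with Suc.prems obtain c where c: "E c b" "c \<in> S" "n \<in> path_lengths E (S - {b}) a c"
    by (rule path_lengths_penultimate) auto
  then have "f a = f c \<longleftrightarrow> even n" using Suc.IH path_lengths_mono[of n E "S - {b}" a c S] by blast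
  moreover have "f c \<noteq> f b" using f c(1,2) path_lengths_endpoints(2)[OF Suc.prems]
    unfolding two_colouring_def by blast
  ultimately show ?case by auto
qed

context adjacency
begin

lemma periodic_cycle_arcs:
  assumes w: "periodic_cycle E n w" and d: "0 \<le> d" "d < n"
  shows "nat d \<in> path_lengths E (range w) (w i) (w (i + d))"
    "nat d \<in> path_lengths E (range w) (w (i + d)) (w i)"
proof -
  show "nat d \<in> path_lengths E (range w) (w i) (w (i + d))"
    using periodic_cycle_arc[OF w d] by (rule path_lengths_mono) auto
  then show "nat d \<in> path_lengths E (range w) (w (i + d)) (w i)" by (rule path_lengths_rev[OF sym])
qed

lemma two_colouring_common_nbr:
  assumes f: "two_colouring E K f" and K: "connected_in E K" and z: "z \<notin> K"
    and no_odd: "\<And>m. m \<in> cycle_lengths E (insert z K) \<Longrightarrow> even m"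
    and ab: "a \<in> K" "b \<in> K" "E a z" "E b z"
  shows "f a = f b"
proof (rule ccontr)
  assume different: "f a \<noteq> f b"
  obtain n where n: "n \<in> path_lengths E K a b" using connected_in_path[OF K ab(1,2)] by blast
  have "odd n" using two_colouring_path_parity[OF f n] different by simp
  have "a \<noteq> b" using different by auto
  have "path_in E {b, z, a} [b, z, a]" using ab z \<open>a \<noteq> b\<close> E_sym unfolding path_in_def by auto
  from path_lengthsI[OF this, of 2] have "2 \<in> path_lengths E {b, z, a} b a" by simp
  then have "n + 2 \<in> cycle_lengths E (K \<union> {b, z, a})"
    using z \<open>a \<noteq> b\<close> \<open>odd n\<close> by (intro cycle_lengths_join[OF n]) (auto elim: oddE)
  moreover have "K \<union> {b, z, a} = insert z K" using ab(1,2) by auto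
  ultimately show False using no_odd[of "n + 2"] \<open>odd n\<close> by simp
qed

lemma ex_two_colouring:
  assumes S: "finite S" "connected_in E S" "S \<noteq> {}" and no_odd: "\<And>m. m \<in> cycle_lengths E S \<Longrightarrow> even m"
  shows "\<exists>f. two_colouring E S f"
proof -
  define coloured
    where "coloured = {K. K \<subseteq> S \<and> K \<noteq> {} \<and> connected_in E K \<and> (\<exists>f. two_colouring E K f)}"
  obtain r where r: "r \<in> S" using S(3) by blast
  then have "{r} \<in> coloured" unfolding coloured_def two_colouring_def by auto
  moreover have "finite coloured" by (rule finite_subset[of _ "Pow S"]) (auto simp: coloured_def S)
  ultimately obtain K where "K \<in> coloured" and maximal: "\<And>K'. K' \<in> coloured \<Longrightarrow> K \<subseteq> K' \<Longrightarrow> K = K'"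
    using finite_has_maximal2[of coloured "{r}"] by metis
  then obtain f where K: "K \<subseteq> S" "K \<noteq> {}" "connected_in E K" and f: "two_colouring E K f"
    unfolding coloured_def by blast
  have "K = S"
  proof (rule ccontr)
    assume "K \<noteq> S"
    then obtain d z where dz: "d \<in> K" "z \<in> S - K" "E d z"
      by (rule connected_in_boundaryE[OF S(2) K(2,1)])
    have even: "even m" if "m \<in> cycle_lengths E (insert z K)" for m
      using no_odd cycle_lengths_mono[OF that, of S] K(1) dz(2) by blast
    have same: "f a = f d" if "a \<in> K" "E a z" for a
      using two_colouring_common_nbr[OF f K(3) _ even that(1) dz(1) that(2) dz(3)] dz(2) by blast
    have "two_colouring E (insert z K) (f(z := \<not> f d))"
      unfolding two_colouring_def
    proof (intro ballI impI)
      fix a b assume ab: "a \<in> insert z K" "b \<in> insert z K" "E a b"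
      then have "a \<noteq> b" by auto
      then show "(f(z := \<not> f d)) a \<noteq> (f(z := \<not> f d)) b"
        using ab f same[of a] same[of b] E_sym[OF ab(3)] dz(2) unfolding two_colouring_def by auto
    qed
    then have "insert z K \<in> coloured"
      using connected_in_insert[OF sym K(3) dz(1,3)] K(1) dz(2) unfolding coloured_def by blast
    then show False using maximal dz(2) by blast
  qed
  then show ?thesis using f by blast
qed

lemma path_lengths_parity:
  assumes no_odd: "\<And>m. m \<in> cycle_lengths E S \<Longrightarrow> even m"
    and "p \<in> path_lengths E S a b" "q \<in> path_lengths E S a b"
  shows "even p \<longleftrightarrow> even q"
proof -
  obtain xs where xs: "path_in E S xs" "hd xs = a" "last xs = b" "length xs = Suc p"
    using assms(2) by (rule path_lengthsE)
  obtain ys where ys: "path_in E S ys" "hd ys = a" "last ys = b" "length ys = Suc q"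
    using assms(3) by (rule path_lengthsE)
  let ?K = "set xs \<union> set ys"
  have K: "?K \<subseteq> S" "a \<in> set xs" "a \<in> set ys"
    using xs ys hd_in_set[of xs] hd_in_set[of ys] unfolding path_in_def by auto
  then have "connected_in E ?K"
    using connected_in_path_set[OF sym xs(1)] connected_in_path_set[OF sym ys(1)]
    by (intro connected_in_Un[OF sym]) auto
  moreover have "even m" if "m \<in> cycle_lengths E ?K" for m
    using no_odd cycle_lengths_mono[OF that K(1)] by blast
  moreover have "finite ?K" "?K \<noteq> {}" using K(2) by auto
  ultimately obtain f where f: "two_colouring E ?K f"
    using ex_two_colouring[of ?K] by blast
  have "path_in E ?K xs" "path_in E ?K ys" using xs(1) ys(1) unfolding path_in_def by auto
  then have "p \<in> path_lengths E ?K a b" "q \<in> path_lengths E ?K a b"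
    using path_lengthsI xs(2-) ys(2-) by metis+
  then show ?thesis using two_colouring_path_parity[OF f] by blast
qed

lemma even_chord_cycle:
  assumes w: "periodic_cycle E n w" and d: "2 \<le> d" "d \<le> n - 2" "even d"
    and chord: "E (w (s + d)) (w s)"
  obtains m v where "odd m" "int m < n" "v \<in> range w" "m \<in> cycle_lengths E (range w - {v})"
proof -
  have ends: "w (s + d) \<noteq> w s" using periodic_cycle_inj[OF w, of "s + d" s] d by auto
  have arc: "nat d \<in> path_lengths E (w ` {s..s + d}) (w s) (w (s + d))"
    using periodic_cycle_arc[OF w] d by simp
  have "nat d + 1 \<in> cycle_lengths E (w ` {s..s + d} \<union> {w (s + d), w s})"
    by (rule cycle_lengths_join[OF arc path_lengths_edge[of E, OF chord ends]]) (use d ends in auto)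
  moreover have "w (s + d + 1) \<notin> w ` {s..s + d}"
  proof
    assume "w (s + d + 1) \<in> w ` {s..s + d}"
    then obtain t where "t \<in> {s..s + d}" "w (s + d + 1) = w t" by blast
    then show False using periodic_cycle_inj[OF w, of "s + d + 1" t] d by auto
  qed
  moreover have "{w (s + d), w s} \<subseteq> w ` {s..s + d}" using d by auto
  ultimately have "nat d + 1 \<in> cycle_lengths E (range w - {w (s + d + 1)})"
    by (elim cycle_lengths_mono) blast
  then show thesis
    by (intro that[of "nat d + 1" "w (s + d + 1)"]) (use d in \<open>auto simp: even_nat_iff\<close>)
qed

lemma odd_cycle_chord:
  assumes w: "periodic_cycle E n w" "odd n"
    and chord: "E (w i) v" "v \<in> range w" "v \<noteq> w (i + 1)" "v \<noteq> w (i - 1)"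
  obtains m v where "odd m" "int m < n" "v \<in> range w" "m \<in> cycle_lengths E (range w - {v})"
proof -
  obtain d where d: "0 \<le> d" "d < n" "v = w (i + d)"
    using periodic_cycle_offset[OF w(1) chord(2)] by metis
  note add_period = periodic_cycle_add_period[OF w(1)]
  have "d \<noteq> 0" "d \<noteq> 1" using chord(1,3) d by auto
  moreover have "d \<noteq> n - 1" using chord(4) d add_period[of "i - 1"] by (auto simp: algebra_simps)
  ultimately have bounds: "2 \<le> d" "d \<le> n - 2" using d by auto
  show ?thesis
  proof (cases "even d")
    case True
    have "E (w (i + d)) (w i)" using E_sym[OF chord(1)] d(3) by simp
    then show ?thesis by (rule even_chord_cycle[OF w(1) bounds True]) (rule that)
  next
    case False
    then have "2 \<le> n - d" "n - d \<le> n - 2" "even (n - d)" using bounds w(2) by auto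
    moreover have "E (w (i + d + (n - d))) (w (i + d))" using chord(1) d add_period[of i] by simp
    ultimately show ?thesis by (rule even_chord_cycle[OF w(1)]) (rule that)
  qed
qed

end

subsection \<open>Largest connected sets disjoint from an odd cycle\<close>

context three_connected_min_degree
begin

lemma connected_V: "connected_in E V"
  unfolding connected_in_def
proof (intro allI impI notI)
  fix D assume D: "D \<noteq> {}" "D \<subset> V" and sep: "boundary E V D = {}"
  then obtain a where a: "a \<in> V - D" by blast
  have "D \<subseteq> V - {a}" "a \<in> V" "boundary E V D \<subseteq> {a}" using D a sep by auto
  then have only_a: "V - D - {a} = {}" using no_cutvertex[OF D(1)] by metis
  have "\<not> E a v" if "v \<in> V" for v
  proof
    assume "E a v"
    then have "v \<in> D" using that only_a by auto
    then have "a \<in> boundary E V D" using a E_sym[OF \<open>E a v\<close>] by auto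
    then show False using sep by blast
  qed
  then have "nbrs E V a = {}" by auto
  then show False using min_degree[of a] a k_ge_6 by simp
qed

definition remainder :: "'a set \<Rightarrow> bool" where
  "remainder D \<longleftrightarrow> D \<noteq> {} \<and> D \<subseteq> V \<and> connected_in E D \<and> (\<exists>m\<in>cycle_lengths E (V - D). odd m)"

lemma ex_remainder:
  assumes "\<nexists>f. two_colouring E V f" obtains r where "remainder {r}"
proof -
  have "V \<noteq> {}" using assms unfolding two_colouring_def by auto
  then have ex: "\<exists>m. m \<in> cycle_lengths E V \<and> odd m"
    using ex_two_colouring[OF finite_V connected_V] assms by blast
  define m where "m = (LEAST m. m \<in> cycle_lengths E V \<and> odd m)"
  have m: "m \<in> cycle_lengths E V" "odd m" using LeastI_ex[OF ex] unfolding m_def by auto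
  have least: "m \<le> j" if "j \<in> cycle_lengths E V" "odd j" for j
    unfolding m_def by (rule Least_le) (use that in simp)
  obtain w where w: "periodic_cycle E (int m) w" "range w \<subseteq> V"
    using m(1) by (rule cycle_lengths_periodicE)
  have "range w \<noteq> V"
  proof
    assume spanning: "range w = V"
    have "\<not> nbrs E V (w 0) \<subseteq> {w 1, w (- 1)}"
    proof
      assume "nbrs E V (w 0) \<subseteq> {w 1, w (- 1)}"
      then have "card (nbrs E V (w 0)) \<le> card {w 1, w (- 1)}" by (intro card_mono) auto
      then show False
        using min_degree[of "w 0"] spanning k_ge_6 by (auto simp: card_insert_if split: if_splits)
    qed
    then obtain v where v: "E (w 0) v" "v \<in> range w" "v \<noteq> w 1" "v \<noteq> w (- 1)"
      using spanning unfolding nbrs_def by blast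
    then have "v \<noteq> w (0 + 1)" "v \<noteq> w (0 - 1)" "odd (int m)" using m(2) by simp_all
    then obtain j u where "odd j" "int j < int m" "j \<in> cycle_lengths E (range w - {u})"
      using odd_cycle_chord[OF w(1) _ v(1,2)] by metis
    then show False using least[of j] cycle_lengths_mono[of j E "range w - {u}" V] w(2) by auto
  qed
  then obtain r where r: "r \<in> V" "r \<notin> range w" using w(2) by blast
  have "m \<in> cycle_lengths E (range w)" using periodic_cycle_length[OF w(1)] by simp
  then have "m \<in> cycle_lengths E (V - {r})" by (rule cycle_lengths_mono) (use w(2) r in blast)
  then have "remainder {r}" unfolding remainder_def using m(2) r(1) by auto
  then show ?thesis by (rule that)
qed

end

locale maximal_remainder = three_connected_min_degree +
  fixes D :: "'a set"
  assumes remainder: "remainder D" and maximal: "\<And>D'. remainder D' \<Longrightarrow> card D' \<le> card D"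
begin

lemma D: "D \<noteq> {}" "D \<subseteq> V" "connected_in E D" "finite D"
  using remainder finite_subset[of D V] unfolding remainder_def by auto

definition attachments :: "'a set" where
  "attachments = boundary E V D"

lemma attachments: "attachments \<subseteq> V - D" "\<And>e. e \<in> attachments \<Longrightarrow> \<exists>d\<in>D. E d e"
  unfolding attachments_def boundary_def by auto

lemma no_odd_cycle_without_attachment:
  assumes e: "e \<in> attachments" and j: "j \<in> cycle_lengths E (V - D - {e})" shows "even j"
proof (rule ccontr)
  assume "odd j"
  obtain d where d: "d \<in> D" "E d e" using attachments(2)[OF e] by blast
  have "V - insert e D = V - D - {e}" by blast
  then have "remainder (insert e D)"
    unfolding remainder_def
    using connected_in_insert[OF sym D(3) d] D(2) e attachments(1) j \<open>odd j\<close> by auto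
  then show False using maximal[of "insert e D"] D(4) e attachments(1) by auto
qed

lemma path_lengths_parity_without_attachment:
  assumes "e \<in> attachments" "p \<in> path_lengths E (V - D - {e}) a b" "q \<in> path_lengths E (V - D - {e}) a b"
  shows "even p \<longleftrightarrow> even q"
  using no_odd_cycle_without_attachment[OF assms(1)] assms(2,3) by (rule path_lengths_parity)

lemma attachments_subset_odd_cycle:
  assumes w: "periodic_cycle E n w" "range w \<subseteq> V - D" "odd n" shows "attachments \<subseteq> range w"
proof
  fix e assume e: "e \<in> attachments"
  show "e \<in> range w"
  proof (rule ccontr)
    assume "e \<notin> range w"
    then have "nat n \<in> cycle_lengths E (V - D - {e})"
      using w(2) by (intro cycle_lengths_mono[OF periodic_cycle_length[OF w(1)]]) blast
    then have "even (nat n)" by (rule no_odd_cycle_without_attachment[OF e])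
    moreover have "3 \<le> n" using w(1) unfolding periodic_cycle_def by blast
    ultimately show False using w(3) by (simp add: even_nat_iff)
  qed
qed

lemma arc_parity:
  assumes w: "periodic_cycle E n w" "range w \<subseteq> V - D"
    and Z: "Z \<subseteq> V - D - attachments"
    and attached: "w s \<in> attachments" "w t \<in> attachments" "w r \<in> attachments"
    and order: "s < t" "t < r" "r < s + n"
    and uv: "E (w s) u" "E (w t) v" "p \<in> path_lengths E Z u v"
  shows "even (t - s) \<longleftrightarrow> even p"
proof -
  have distinct: "w s \<noteq> w t" "w s \<noteq> w r" "w t \<noteq> w r"
    using periodic_cycle_inj[OF w(1), of s t] periodic_cycle_inj[OF w(1), of s r]
      periodic_cycle_inj[OF w(1), of t r] order by auto
  have "w r \<notin> w ` {s..t}"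
  proof
    assume "w r \<in> w ` {s..t}"
    then obtain i where "i \<in> {s..t}" "w r = w i" by blast
    then show False using periodic_cycle_inj[OF w(1), of r i] order by auto
  qed
  then have sub: "w ` {s..t} \<subseteq> V - D - {w r}" using w(2) by blast
  have "nat (t - s) \<in> path_lengths E (w ` {s..t}) (w s) (w t)"
    using periodic_cycle_arc[OF w(1), of "t - s" s] order by simp
  then have arc: "nat (t - s) \<in> path_lengths E (V - D - {w r}) (w s) (w t)"
    using sub by (rule path_lengths_mono)
  have "Suc p \<in> path_lengths E (insert (w s) Z) (w s) v"
    by (rule path_lengths_Cons[of p E Z u v "w s", OF uv(3,1)]) (use Z attached in blast)
  then have "Suc (Suc p) \<in> path_lengths E (insert (w t) (insert (w s) Z)) (w s) (w t)"
    by (rule path_lengths_snoc[of _ E _ "w s" v "w t", OF _ E_sym[OF uv(2)]]) (use Z attached distinct in auto)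
  then have "Suc (Suc p) \<in> path_lengths E (V - D - {w r}) (w s) (w t)"
    by (rule path_lengths_mono) (use Z attached distinct attachments(1) in auto)
  then show ?thesis
    using path_lengths_parity_without_attachment[OF attached(3) arc] order by (simp add: even_nat_iff)
qed

text \<open>The three arcs between the attachments of \<open>Z\<close> have the parities of paths in \<open>Z\<close> closing up to a walk
  in a bipartite graph, so the odd cycle would have even length.\<close>

lemma three_attachments_absurd:
  assumes w: "periodic_cycle E n w" "range w \<subseteq> V - D" "odd n"
    and Z: "Z \<subseteq> V - D - attachments" "connected_in E Z"
    and attached: "w i \<in> attachments" "w j \<in> attachments" "w l \<in> attachments"
    and order: "i < j" "j < l" "l < i + n"
    and nbrs: "nbrs E Z (w i) \<noteq> {}" "nbrs E Z (w j) \<noteq> {}" "nbrs E Z (w l) \<noteq> {}"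
  shows False
proof -
  obtain a b c where a: "a \<in> Z" "E (w i) a" and b: "b \<in> Z" "E (w j) b" and c: "c \<in> Z" "E (w l) c"
    using nbrs unfolding nbrs_def by blast
  obtain p q r where p: "p \<in> path_lengths E Z a b" and q: "q \<in> path_lengths E Z b c"
    and r: "r \<in> path_lengths E Z c a"
    using connected_in_path[OF Z(2) a(1) b(1)] connected_in_path[OF Z(2) b(1) c(1)]
      connected_in_path[OF Z(2) c(1) a(1)] by blast
  have periods: "w (i + n) = w i" "w (j + n) = w j"
    using periodic_cycle_add_period[OF w(1)] by auto
  have arcs: "even (j - i) \<longleftrightarrow> even p" "even (l - j) \<longleftrightarrow> even q" "even (i + n - l) \<longleftrightarrow> even r"
    using arc_parity[OF w(1,2) Z(1) attached order a(2) b(2) p]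
      arc_parity[OF w(1,2) Z(1), of j l "i + n", OF _ _ _ _ _ _ b(2) c(2) q]
      arc_parity[OF w(1,2) Z(1), of l "i + n" "j + n", OF _ _ _ _ _ _ c(2) _ r]
      attached order periods a(2) by auto
  have "finite Z" "Z \<noteq> {}" using Z(1) finite_subset[of Z V] a(1) by auto
  moreover have "even m" if "m \<in> cycle_lengths E Z" for m
  proof -
    have "Z \<subseteq> V - D - {w i}" using Z(1) attached(1) by blast
    then show ?thesis
      using no_odd_cycle_without_attachment[OF attached(1)] cycle_lengths_mono[OF that] by blast
  qed
  ultimately obtain f where f: "two_colouring E Z f" using ex_two_colouring Z(2) by blast
  have "even (p + q + r)"
    using two_colouring_path_parity[OF f p] two_colouring_path_parity[OF f q]
      two_colouring_path_parity[OF f r] by auto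
  moreover have "n = (j - i) + (l - j) + (i + n - l)" by simp
  ultimately show False using arcs w(3) by (metis even_add)
qed

lemma ex_three_attachments:
  assumes Z: "component E (V - D - attachments) Z"
  obtains e f g where "e \<in> attachments" "f \<in> attachments" "g \<in> attachments" "e \<noteq> f" "e \<noteq> g" "f \<noteq> g"
    "nbrs E Z e \<noteq> {}" "nbrs E Z f \<noteq> {}" "nbrs E Z g \<noteq> {}"
proof -
  note Z_props = componentD[OF Z]
  have "V - D - attachments = V - (D \<union> attachments)" by blast
  then have "boundary E V Z \<subseteq> D \<union> attachments"
    using component_boundary_Diff[of E V "D \<union> attachments" Z] Z by simp
  moreover have "v \<notin> boundary E V Z" if "v \<in> D" for v
    using that Z_props(2) E_sym unfolding attachments_def boundary_def by blast
  ultimately have closed: "boundary E V Z \<subseteq> attachments" by blast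
  have "\<not> card (boundary E V Z) < 3"
  proof
    assume "card (boundary E V Z) < 3"
    moreover have "Z \<union> boundary E V Z \<subset> V" using Z_props(2) closed attachments(1) D(1,2) by blast
    moreover have "Z \<inter> boundary E V Z = {}" by auto
    ultimately show False using no_separator[OF Z_props(1)] by blast
  qed
  then obtain S where S: "S \<subseteq> boundary E V Z" "card S = 3"
    using obtain_subset_with_card_n[of 3 "boundary E V Z"] by (metis not_less)
  then obtain e f g where efg: "S = {e, f, g}" "e \<noteq> f" "e \<noteq> g" "f \<noteq> g"
    unfolding card_3_iff by blast
  have "nbrs E Z v \<noteq> {}" if "v \<in> boundary E V Z" for v
    using that E_sym unfolding boundary_def nbrs_def by blast
  then show ?thesis using that[of e f g] efg S(1) closed by blast
qed

lemma complement_attached: "V - D = attachments"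
proof (rule ccontr)
  assume "V - D \<noteq> attachments"
  then obtain z where "z \<in> V - D - attachments" using attachments(1) by blast
  then obtain Z where Z: "component E (V - D - attachments) Z" by (rule ex_component[OF sym])
  obtain m where m: "m \<in> cycle_lengths E (V - D)" "odd m"
    using remainder unfolding remainder_def by blast
  obtain w where w: "periodic_cycle E (int m) w" "range w \<subseteq> V - D"
    using m(1) by (rule cycle_lengths_periodicE)
  have odd: "odd (int m)" using m(2) by simp
  obtain e f g where attached: "e \<in> attachments" "f \<in> attachments" "g \<in> attachments"
    and distinct: "e \<noteq> f" "e \<noteq> g" "f \<noteq> g"
    and nbrs: "nbrs E Z e \<noteq> {}" "nbrs E Z f \<noteq> {}" "nbrs E Z g \<noteq> {}"
    by (rule ex_three_attachments[OF Z])
  then have range: "e \<in> range w" "f \<in> range w" "g \<in> range w"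
    using attachments_subset_odd_cycle[OF w odd] by auto
  obtain i where i: "e = w i" using range(1) by blast
  obtain s where s: "0 \<le> s" "s < int m" "f = w (i + s)"
    using periodic_cycle_offset[OF w(1) range(2)] .
  obtain t where t: "0 \<le> t" "t < int m" "g = w (i + t)"
    using periodic_cycle_offset[OF w(1) range(3)] .
  have "s \<noteq> 0" "t \<noteq> 0" "s \<noteq> t" using distinct i s(3) t(3) by auto
  then consider "0 < s" "s < t" | "0 < t" "t < s" using s(1) t(1) by linarith
  then show False
  proof cases
    case 1
    show False
      by (rule three_attachments_absurd[OF w odd componentD(2,3)[OF Z], of i "i + s" "i + t"])
        (use 1 attached nbrs i s t in auto)
  next
    case 2
    show False
      by (rule three_attachments_absurd[OF w odd componentD(2,3)[OF Z], of i "i + t" "i + s"])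
        (use 2 attached nbrs i s t in auto)
  qed
qed

end

subsection \<open>Triangle-free graphs\<close>

context adjacency
begin

lemma admissible_rooted_path_lengths:
  assumes rooted: "rooted E S x y" and degree: "\<And>v. v \<in> S - {y} \<Longrightarrow> c + 1 \<le> card (nbrs E S v)"
    and "2 \<le> c"
  shows "admissible c (path_lengths E S x y)"
proof -
  have xy: "x \<in> S - {y}" "y \<in> S" using rooted unfolding rooted_def by auto
  have "S \<noteq> {x, y}"
  proof
    assume "S = {x, y}"
    then have "nbrs E S x \<subseteq> {y}" by auto
    then have "card (nbrs E S x) \<le> card {y}" by (intro card_mono) auto
    then show False using degree[OF xy(1)] \<open>2 \<le> c\<close> by simp
  qed
  then have "rooted_graph E S x y c"
    unfolding rooted_graph_def using rooted degree adjacency_axioms by blast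
  then obtain p where p: "E p y" and adm: "admissible c (path_lengths E (insert x (S - {x, y})) x p)"
    unfolding linked_def using rooted_graph_linked[of E S x y c] by (auto simp: linked_def)
  have S: "insert x (S - {x, y}) = S - {y}" "insert y (S - {y}) = S" using xy by auto
  show ?thesis
  proof (rule admissible_shift[OF adm[unfolded S(1)]])
    fix n assume "n \<in> path_lengths E (S - {y}) x p"
    then have "Suc n \<in> path_lengths E (insert y (S - {y})) x y"
      by (rule path_lengths_snoc[of n E "S - {y}" x p y, OF _ p]) simp
    then show "n + 1 \<in> path_lengths E S x y" using S(2) by simp
  qed
qed

end

locale triangle_free_frame = maximal_remainder +
  fixes w :: "int \<Rightarrow> 'a" and q :: int
  assumes cycle: "periodic_cycle E (2 * q + 1) w" and cycle_outside: "range w \<subseteq> V - D"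
    and triangle_free: "\<And>a b c. {a, b, c} \<subseteq> V \<Longrightarrow> \<not> (E a b \<and> E b c \<and> E c a)"
begin

lemma range_w: "range w = V - D"
  using cycle_outside attachments_subset_odd_cycle[OF cycle cycle_outside] complement_attached by auto

lemma w_in: "w i \<in> V" "w i \<notin> D"
  using cycle_outside by auto

lemma w_add_period: "w (i + (2 * q + 1)) = w i"
  by (rule periodic_cycle_add_period[OF cycle])

lemma cycle_attached: "\<exists>d\<in>D. E d (w i)"
proof -
  have "w i \<in> attachments" using range_w complement_attached by auto
  then show ?thesis using attachments(2) by blast
qed

lemma cycle_induced:
  assumes "E (w i) v" "v \<in> range w" shows "v = w (i + 1) \<or> v = w (i - 1)"
proof (rule ccontr)
  assume "\<not> ?thesis"
  then have chord: "v \<noteq> w (i + 1)" "v \<noteq> w (i - 1)" by auto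
  have "odd (2 * q + 1)" by simp
  then obtain m e where "odd m" "e \<in> range w" "m \<in> cycle_lengths E (range w - {e})"
    by (rule odd_cycle_chord[OF cycle _ assms chord])
  then show False using no_odd_cycle_without_attachment[of e m] range_w complement_attached by auto
qed

lemma q_ge_2: "2 \<le> q"
proof (rule ccontr)
  assume "\<not> 2 \<le> q"
  moreover have "1 \<le> q" using cycle unfolding periodic_cycle_def by simp
  ultimately have "q = 1" by simp
  then have "w (2 + 1) = w 0" using w_add_period[of 0] by simp
  moreover have "E (w 0) (w (0 + 1))" "E (w 1) (w (1 + 1))" "E (w 2) (w (2 + 1))"
    using cycle unfolding periodic_cycle_def by blast+
  ultimately show False using triangle_free[of "w 0" "w 1" "w 2"] w_in by simp
qed

lemma ex_nbr_avoiding: "\<exists>d\<in>D. d \<noteq> u \<and> E d (w i)"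
proof (rule ccontr)
  assume avoid: "\<not> ?thesis"
  have "nbrs E V (w i) \<subseteq> {u, w (i + 1), w (i - 1)}"
  proof
    fix v assume v: "v \<in> nbrs E V (w i)"
    show "v \<in> {u, w (i + 1), w (i - 1)}"
    proof (cases "v \<in> D")
      case True
      then show ?thesis using v avoid E_sym[of "w i" v] by auto
    next
      case False
      then show ?thesis using v cycle_induced[of i v] range_w by auto
    qed
  qed
  then have "card (nbrs E V (w i)) \<le> card {u, w (i + 1), w (i - 1)}" by (intro card_mono) auto
  also have "\<dots> \<le> 3" by (simp add: card_insert_if)
  finally show False using min_degree[OF w_in(1)[of i]] k_ge_6 by simp
qed

definition arc_lengths :: "'a \<Rightarrow> 'a \<Rightarrow> nat set" where
  "arc_lengths x y = {r. \<exists>i j. E x (w i) \<and> E y (w j) \<and> r \<in> path_lengths E (range w) (w j) (w i)}"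

lemma arc_lengthsI:
  assumes "E x (w i)" "E y (w (i + d))" "0 \<le> d" "d \<le> 2 * q"
  shows "nat d \<in> arc_lengths x y" "1 \<le> d \<Longrightarrow> nat (2 * q + 1 - d) \<in> arc_lengths x y"
proof -
  show "nat d \<in> arc_lengths x y"
    unfolding arc_lengths_def using assms periodic_cycle_arcs(2)[OF cycle, of d i] by auto
  have "w (i + d + (2 * q + 1 - d)) = w i" using w_add_period[of i] by simp
  then show "nat (2 * q + 1 - d) \<in> arc_lengths x y" if "1 \<le> d"
    unfolding arc_lengths_def
    using assms that periodic_cycle_arcs(1)[OF cycle, of "2 * q + 1 - d" "i + d"] by auto
qed

lemma arc_lengths_nonempty:
  assumes "E x (w i)" "E y (w j)" shows "arc_lengths x y \<noteq> {}"
proof -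
  obtain d where "0 \<le> d" "d < 2 * q + 1" "w j = w (i + d)"
    using periodic_cycle_offset[OF cycle, of "w j" i] by (metis rangeI)
  then show ?thesis using arc_lengthsI(1)[of x i y d] assms by auto
qed

lemma cycle_lengths_arc_path:
  assumes "x \<noteq> y" and p: "p \<in> path_lengths E D x y" and r: "r \<in> arc_lengths x y"
  shows "r + p + 2 \<in> cycle_lengths E V"
proof -
  obtain i j where e: "E x (w i)" "E y (w j)" and arc: "r \<in> path_lengths E (range w) (w j) (w i)"
    using r unfolding arc_lengths_def by blast
  have xy: "x \<in> D" "y \<in> D" using path_lengths_endpoints[OF p] by auto
  have outside: "x \<notin> range w" "y \<notin> range w" using xy range_w by auto
  have "Suc r \<in> path_lengths E (insert y (range w)) y (w i)"
    by (rule path_lengths_Cons[of r E "range w" "w j" "w i" y, OF arc e(2) outside(2)])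
  then have closing: "Suc (Suc r) \<in> path_lengths E (insert x (insert y (range w))) y x"
    by (rule path_lengths_snoc[of _ E _ y "w i" x, OF _ E_sym[OF e(1)]]) (use outside \<open>x \<noteq> y\<close> in auto)
  have "p \<noteq> 0" using path_lengths_0D p \<open>x \<noteq> y\<close> by metis
  then have "p + Suc (Suc r) \<in> cycle_lengths E (D \<union> insert x (insert y (range w)))"
    using range_w \<open>x \<noteq> y\<close> by (intro cycle_lengths_join[OF p closing]) auto
  then have "p + Suc (Suc r) \<in> cycle_lengths E V"
    by (rule cycle_lengths_mono) (use range_w xy D(2) in auto)
  then show ?thesis by (simp add: add.commute)
qed

lemma arc_cycle_length:
  assumes u: "u \<in> D" "E u (w s)" "E u (w (s + t))" and t: "0 < t" "t \<le> 2 * q"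
  shows "nat t + 2 \<in> cycle_lengths E (insert u (w ` {s..s + t}))"
proof -
  have outside: "u \<notin> range w" using u(1) range_w by auto
  have arc: "nat t \<in> path_lengths E (w ` {s..s + t}) (w s) (w (s + t))"
    using periodic_cycle_arc[OF cycle] t by simp
  have "Suc (nat t) \<in> path_lengths E (insert u (w ` {s..s + t})) u (w (s + t))"
    by (rule path_lengths_Cons[of _ E _ "w s" _ u, OF arc u(2)]) (use outside in auto)
  moreover have "1 \<in> path_lengths E {w (s + t), u} (w (s + t)) u"
    by (rule path_lengths_edge[of E, OF E_sym[OF u(3)]]) (use outside in auto)
  ultimately have "Suc (nat t) + 1 \<in> cycle_lengths E (insert u (w ` {s..s + t}) \<union> {w (s + t), u})"
    by (rule cycle_lengths_join) (use outside t in auto)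
  moreover have "w (s + t) \<in> w ` {s..s + t}" using t by simp
  ultimately show ?thesis by (simp add: insert_absorb)
qed

text \<open>Otherwise \<open>u\<close> and the odd arc between its two neighbours form an odd cycle, and the rest of
  the graph contains a connected set larger than \<open>D\<close>.\<close>

lemma nbrs_odd_offset:
  assumes u: "u \<in> D" "connected_in E (D - {u})"
    and t: "odd t" "0 < t" "t \<le> 2 * q" "E u (w s)" "E u (w (s + t))"
  shows "t = 2 * q - 1"
proof -
  define X where "X = w ` {s + t + 1..s + 2 * q}"
  have "inj_on w {s + t + 1..s + 2 * q}"
    by (rule inj_onI, rule periodic_cycle_inj[OF cycle]) (use t in auto)
  then have card_X: "card X = nat (2 * q - t)" unfolding X_def using card_image t by fastforce
  have X: "X \<subseteq> V - D" unfolding X_def using cycle_outside by auto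
  have connected: "connected_in E (D - {u} \<union> X)"
  proof (rule connected_in_attach[OF sym u(2)])
    fix v assume "v \<in> X"
    then obtain j where "v = w j" unfolding X_def by blast
    then show "\<exists>a\<in>D - {u}. E v a" using ex_nbr_avoiding[of u j] E_sym by blast
  qed
  have "nat t + 2 \<in> cycle_lengths E (insert u (w ` {s..s + t}))"
    by (rule arc_cycle_length[OF u(1) t(4,5,2,3)])
  moreover have "w ` {s..s + t} \<inter> X = {}"
  proof (rule ccontr)
    assume "w ` {s..s + t} \<inter> X \<noteq> {}"
    then obtain a b where "a \<in> {s..s + t}" "b \<in> {s + t + 1..s + 2 * q}" "w a = w b"
      unfolding X_def by blast
    then show False using periodic_cycle_inj[OF cycle, of a b] by auto
  qed
  moreover have "w ` {s..s + t} \<subseteq> V - D" using cycle_outside by auto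
  ultimately have "nat t + 2 \<in> cycle_lengths E (V - (D - {u} \<union> X))"
    using u(1) D(2) X by (elim cycle_lengths_mono) auto
  moreover have "odd (nat t + 2)" using t by (simp add: even_nat_iff)
  moreover have "D - {u} \<noteq> {}" using ex_nbr_avoiding[of u 0] by blast
  ultimately have "remainder (D - {u} \<union> X)" unfolding remainder_def using connected D(2) X by blast
  then have "card (D - {u} \<union> X) \<le> card D" by (rule maximal)
  moreover have "finite X" unfolding X_def by simp
  then have "card (D - {u} \<union> X) = card D - 1 + card X"
    using D(4) u(1) X by (subst card_Un_disjoint) auto
  moreover have "card D \<noteq> 0" using D(1,4) by simp
  ultimately have "card X \<le> 1" by linarith
  then have "2 * q - t \<le> 1" using card_X by simp
  then show ?thesis using t(1-3) by presburger
qed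

lemma nbrs_offset:
  assumes u: "u \<in> D" "connected_in E (D - {u})" and e: "E u (w i)" "E u (w (i + d))"
    and d: "0 < d" "d \<le> 2 * q"
  shows "d = 2 \<or> d = 2 * q - 1"
proof (cases "odd d")
  case True
  then show ?thesis using nbrs_odd_offset[OF u True d e] by simp
next
  case False
  have "w (i + d + (2 * q + 1 - d)) = w i" using w_add_period[of i] by simp
  then have "2 * q + 1 - d = 2 * q - 1"
    using nbrs_odd_offset[OF u, of "2 * q + 1 - d" "i + d"] False d e by simp
  then show ?thesis by simp
qed

definition twin :: "'a \<Rightarrow> int \<Rightarrow> bool" where
  "twin u i \<longleftrightarrow> E u (w (i - 1)) \<and> E u (w (i + 1))"

lemma nbrs_cycle_cases:
  assumes u: "u \<in> D" "connected_in E (D - {u})" and e: "E u (w i)" "v \<in> nbrs E (range w) u"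
  shows "v = w i \<or> v = w (i + 2) \<and> twin u (i + 1) \<or> v = w (i - 2) \<and> twin u (i - 1)"
proof -
  have v: "v \<in> range w" "E u v" using e(2) by auto
  obtain d where d: "0 \<le> d" "d < 2 * q + 1" "v = w (i + d)"
    using periodic_cycle_offset[OF cycle v(1)] by metis
  have "d = 0 \<or> d = 2 \<or> d = 2 * q - 1"
    using nbrs_offset[OF u e(1), of d] v(2) d by (cases "d = 0") auto
  moreover have "w (i + (2 * q - 1)) = w (i - 2)"
    using w_add_period[of "i - 2"] by (simp add: algebra_simps)
  ultimately have "v = w i \<or> v = w (i + 2) \<or> v = w (i - 2)" using d(3) by auto
  then show ?thesis using e(1) v(2) unfolding twin_def by (auto simp: algebra_simps)
qed

lemma card_nbrs_cycle:
  assumes u: "u \<in> D" "connected_in E (D - {u})"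
  shows "card (nbrs E (range w) u) \<le> 2" "(\<And>i. \<not> twin u i) \<Longrightarrow> card (nbrs E (range w) u) \<le> 1"
proof -
  consider "nbrs E (range w) u = {}" | i where "E u (w i)" unfolding nbrs_def by blast
  then have "card (nbrs E (range w) u) \<le> 2 \<and> ((\<forall>i. \<not> twin u i) \<longrightarrow> card (nbrs E (range w) u) \<le> 1)"
  proof cases
    case (2 i)
    have cases: "v = w i \<or> v = w (i + 2) \<and> twin u (i + 1) \<or> v = w (i - 2) \<and> twin u (i - 1)"
      if "v \<in> nbrs E (range w) u" for v using nbrs_cycle_cases[OF u 2 that] .
    have "\<not> (E u (w (i + 2)) \<and> E u (w (i - 2)))"
    proof
      assume "E u (w (i + 2)) \<and> E u (w (i - 2))"
      moreover have "w (i - 2 + 4) = w (i + 2)" by (simp add: algebra_simps)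
      ultimately have "4 = (2 :: int) \<or> 4 = 2 * q - 1"
        using nbrs_offset[OF u, of "i - 2" 4] q_ge_2 by simp
      then show False by presburger
    qed
    then have "\<exists>v. nbrs E (range w) u \<subseteq> {w i, v}"
    proof (cases "E u (w (i + 2))")
      case True
      then have "nbrs E (range w) u \<subseteq> {w i, w (i + 2)}" using cases \<open>\<not> (_ \<and> _)\<close> by fastforce
      then show ?thesis ..
    next
      case False
      then have "nbrs E (range w) u \<subseteq> {w i, w (i - 2)}" using cases by fastforce
      then show ?thesis ..
    qed
    then obtain v where v: "nbrs E (range w) u \<subseteq> {w i, v}" by blast
    then have "card (nbrs E (range w) u) \<le> card {w i, v}" by (intro card_mono) auto
    also have "\<dots> \<le> 2" by (simp add: card_insert_if)
    finally have "card (nbrs E (range w) u) \<le> 2" .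
    moreover have "card (nbrs E (range w) u) \<le> 1" if "\<forall>i. \<not> twin u i"
    proof -
      have "nbrs E (range w) u \<subseteq> {w i}" using cases that by blast
      then show ?thesis using card_mono[of "{w i}"] by fastforce
    qed
    ultimately show ?thesis by blast
  qed simp
  then show "card (nbrs E (range w) u) \<le> 2"
    "(\<And>i. \<not> twin u i) \<Longrightarrow> card (nbrs E (range w) u) \<le> 1" by auto
qed

lemma card_nbrs_noncut:
  assumes u: "u \<in> D" "connected_in E (D - {u})"
  shows "k - 2 \<le> card (nbrs E D u)" "(\<And>i. \<not> twin u i) \<Longrightarrow> k - 1 \<le> card (nbrs E D u)"
proof -
  have "finite (range w)" using range_w by simp
  moreover have "V = D \<union> range w" "D \<inter> range w = {}" using range_w D(2) by auto
  ultimately have "card (nbrs E V u) = card (nbrs E D u) + card (nbrs E (range w) u)"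
    using card_nbrs_Un_disjoint[OF D(4)] by metis
  moreover have "u \<in> V" using u(1) D(2) by blast
  then have "k \<le> card (nbrs E V u)" by (rule min_degree)
  ultimately have bound: "k \<le> card (nbrs E D u) + card (nbrs E (range w) u)" by simp
  then show "k - 2 \<le> card (nbrs E D u)" using card_nbrs_cycle(1)[OF u] by linarith
  show "k - 1 \<le> card (nbrs E D u)" if "\<And>i. \<not> twin u i"
    using bound card_nbrs_cycle(2)[OF u that] by linarith
qed

lemma arc_lengths_twin:
  assumes "twin x i" "E y (w (i + q))" "j < 4" shows "nat (q - 1) + j \<in> arc_lengths x y"
proof -
  have near: "E x (w (i + 1))" "E y (w (i + 1 + (q - 1)))"
    and far: "E x (w (i - 1))" "E y (w (i - 1 + (q + 1)))"
    using assms(1,2) unfolding twin_def by simp_all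
  note lengths = arc_lengthsI[OF near] arc_lengthsI[OF far]
  have "nat (q - 1) + j \<in> {nat (q - 1), nat (2 * q + 1 - (q + 1)), nat (q + 1), nat (2 * q + 1 - (q - 1))}"
    using assms(3) q_ge_2 by auto
  then show ?thesis using lengths q_ge_2 by auto
qed

lemma arc_lengths_two_twins:
  assumes "twin x i" "twin y j"
  obtains r where "r \<in> arc_lengths x y" "r + 2 \<in> arc_lengths x y"
proof -
  obtain d where d: "0 \<le> d" "d < 2 * q + 1" "w j = w (i + d)"
    using periodic_cycle_offset[OF cycle, of "w j" i] by (metis rangeI)
  have shift: "w (j + a) = w (i + d + a)" for a
    using d(3) periodic_cycle_eq_iff[OF cycle] by (metis mod_add_left_eq)
  have ends: "E x (w (i - 1))" "E x (w (i + 1))" "E y (w (i - 1 + d))" "E y (w (i - 1 + (d + 2)))"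
    using assms shift[of "- 1"] shift[of 1] unfolding twin_def by (simp_all add: algebra_simps)
  show ?thesis
  proof (cases "d + 2 \<le> 2 * q")
    case True
    then have "nat d \<in> arc_lengths x y" "nat (d + 2) \<in> arc_lengths x y"
      using arc_lengthsI(1)[OF ends(1,3)] arc_lengthsI(1)[OF ends(1,4)] d by auto
    then show ?thesis using that[of "nat d"] d(1) by (simp add: nat_add_distrib)
  next
    case False
    have "E y (w (i + 1 + (d - 2)))" using ends(3) by (simp add: algebra_simps)
    then have "nat (d - 2) \<in> arc_lengths x y" "nat d \<in> arc_lengths x y"
      using arc_lengthsI(1)[OF ends(2)] arc_lengthsI(1)[OF ends(1,3)] d False q_ge_2 by auto
    moreover have "nat d = nat (d - 2) + 2" using False q_ge_2 by linarith
    ultimately show ?thesis using that[of "nat (d - 2)"] by simp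
  qed
qed

lemma consecutive_cycles_sum:
  assumes "x \<noteq> y" "progression 1 k (arc_lengths x y + path_lengths E D x y)"
  shows "progression 1 k (cycle_lengths E V)"
proof (rule progression_mono[OF progression_add[OF assms(2)]])
  show "2 \<in> {2 :: nat}" by simp
  show "arc_lengths x y + path_lengths E D x y + {2} \<subseteq> cycle_lengths E V"
    using cycle_lengths_arc_path[OF assms(1)] unfolding set_plus_def by auto
qed

lemma rooted_D:
  assumes "\<And>u. u \<in> D \<Longrightarrow> connected_in E (D - {u})" and xy: "x \<in> D" "y \<in> D" "x \<noteq> y"
  shows "rooted E D x y"
  unfolding rooted_def
proof (intro conjI allI impI notI)
  fix S c assume S: "S \<noteq> {}" "S \<subseteq> D - {x, y}" and sep: "boundary E D S \<subseteq> {c}"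
  have "connected_in E (D - {c})" using assms(1)[of c] D(3) by (cases "c \<in> D") auto
  moreover have "c \<notin> S"
  proof
    assume "c \<in> S"
    then have "boundary E D S = {}" using sep by (auto simp: boundary_def)
    moreover have "S \<subseteq> D" "S \<noteq> D" using S(2) xy(1) by blast+
    then obtain d v where "d \<in> S" "v \<in> D - S" "E d v"
      by (rule connected_in_boundaryE[OF D(3) S(1)])
    ultimately show False using boundary_nonemptyI[of d S v D E] by blast
  qed
  moreover have "D - {c} - S \<noteq> {}" using S(2) xy by blast
  moreover have "S \<subseteq> D - {c}" using \<open>c \<notin> S\<close> S(2) by blast
  ultimately obtain d v where "d \<in> S" "v \<in> D - {c} - S" "E d v"
    using connected_in_boundaryE[of E "D - {c}" S] S(1) by blast
  then show False using boundary_subsetD[OF sep, of d v] by blast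
qed (use D(4) xy in auto)

lemma consecutive_cycles_twin:
  assumes noncut: "\<And>u. u \<in> D \<Longrightarrow> connected_in E (D - {u})" and x: "x \<in> D" "twin x i"
  shows "progression 1 k (cycle_lengths E V)"
proof -
  obtain y where y: "y \<in> D" "y \<noteq> x" "E y (w (i + q))" using ex_nbr_avoiding[of x "i + q"] by blast
  have paths: "admissible (k - 3) (path_lengths E D x y)"
  proof (rule admissible_rooted_path_lengths[OF rooted_D[OF noncut]])
    fix v assume "v \<in> D - {y}"
    then have "k - 2 \<le> card (nbrs E D v)" by (intro card_nbrs_noncut(1) noncut) auto
    then show "k - 3 + 1 \<le> card (nbrs E D v)" using k_ge_6 by simp
  qed (use x y k_ge_6 in auto)
  have arcs: "progression 1 4 (arc_lengths x y)"
    using arc_lengths_twin[OF x(2) y(3)] by (intro progressionI[of _ "nat (q - 1)"]) simp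
  show ?thesis
  proof (rule consecutive_cycles_sum)
    have "progression 1 (4 + (k - 3) - 1) (arc_lengths x y + path_lengths E D x y)"
      using k_ge_6 by (intro admissible_sum_interval[OF arcs paths] set_plus_intro) auto
    then show "progression 1 k (arc_lengths x y + path_lengths E D x y)"
      using k_ge_6 by simp
  qed (use y(2) in simp)
qed

lemma consecutive_cycles_no_twin:
  assumes noncut: "\<And>u. u \<in> D \<Longrightarrow> connected_in E (D - {u})" and no_twin: "\<And>u i. u \<in> D \<Longrightarrow> \<not> twin u i"
  shows "progression 1 k (cycle_lengths E V)"
proof -
  obtain x where x: "x \<in> D" "E x (w 0)" using cycle_attached by blast
  obtain y where y: "y \<in> D" "y \<noteq> x" "E y (w (0 + (q - 1)))" using ex_nbr_avoiding by blast
  have paths: "admissible (k - 2) (path_lengths E D x y)"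
  proof (rule admissible_rooted_path_lengths[OF rooted_D[OF noncut]])
    fix v assume "v \<in> D - {y}"
    then have "k - 1 \<le> card (nbrs E D v)" using no_twin by (intro card_nbrs_noncut(2) noncut) auto
    then show "k - 2 + 1 \<le> card (nbrs E D v)" using k_ge_6 by simp
  qed (use x y k_ge_6 in auto)
  have "nat (q + 2) = nat (q - 1) + 3" using q_ge_2 by simp
  moreover have "2 * q + 1 - (q - 1) = q + 2" by simp
  ultimately have arcs: "nat (q - 1) \<in> arc_lengths x y" "nat (q - 1) + 3 \<in> arc_lengths x y"
    using arc_lengthsI[OF x(2) y(3)] q_ge_2 by auto
  show ?thesis
  proof (rule consecutive_cycles_sum)
    have "progression 1 (k - 2 + 2) (arc_lengths x y + path_lengths E D x y)"
      using k_ge_6 arcs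
      by (intro admissible_sum_gap_3[OF paths, of "nat (q - 1)"] set_plus_intro) auto
    then show "progression 1 k (arc_lengths x y + path_lengths E D x y)"
      by (rule progression_le) simp
  qed (use y(2) in simp)
qed

lemma consecutive_cycles_2_connected:
  assumes "\<And>u. u \<in> D \<Longrightarrow> connected_in E (D - {u})"
  shows "progression 1 k (cycle_lengths E V)"
  using consecutive_cycles_twin[OF assms] consecutive_cycles_no_twin[OF assms] by blast

subsection \<open>End pieces\<close>

definition piece :: "'a \<Rightarrow> 'a set \<Rightarrow> bool" where
  "piece c P \<longleftrightarrow> c \<in> D \<and> P \<noteq> {} \<and> P \<subset> D - {c} \<and> boundary E D P \<subseteq> {c}"

definition end_piece :: "'a \<Rightarrow> 'a set \<Rightarrow> bool" where
  "end_piece c P \<longleftrightarrow> piece c P \<and> connected_in E P \<and> (\<forall>u\<in>P. connected_in E (D - {u}))"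

abbreviation exit_lengths :: "'a \<Rightarrow> 'a set \<Rightarrow> 'a \<Rightarrow> nat set" where
  "exit_lengths c P x \<equiv> path_lengths E (insert c P) x c"

lemma pieceD:
  assumes "piece c P" shows "c \<in> D" "P \<noteq> {}" "P \<subseteq> D" "c \<notin> P" "D - {c} - P \<noteq> {}"
  using assms unfolding piece_def by auto

lemma piece_closed: "piece c P \<Longrightarrow> p \<in> P \<Longrightarrow> v \<in> D \<Longrightarrow> E p v \<Longrightarrow> v = c \<or> v \<in> P"
  unfolding piece_def boundary_def by blast

lemma pieceI:
  assumes "c \<in> D" "P \<noteq> {}" "P \<subseteq> D - {c}" "D - {c} - P \<noteq> {}"
    and "\<And>p v. p \<in> P \<Longrightarrow> v \<in> D \<Longrightarrow> E p v \<Longrightarrow> v = c \<or> v \<in> P"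
  shows "piece c P"
proof -
  have "boundary E D P \<subseteq> {c}" using assms(5) unfolding boundary_def by blast
  then show ?thesis unfolding piece_def using assms(1-4) by blast
qed

lemma piece_complement:
  assumes "piece c P" shows "piece c (D - {c} - P)"
proof (rule pieceI)
  fix p v assume "p \<in> D - {c} - P" "v \<in> D" "E p v"
  then show "v = c \<or> v \<in> D - {c} - P" using piece_closed[OF assms, of v p] E_sym[of p v] by blast
qed (use pieceD[OF assms] in auto)

lemma piece_of_cut:
  assumes "u \<in> D" "\<not> connected_in E (D - {u})" obtains P where "piece u P"
proof -
  obtain P where P: "P \<noteq> {}" "P \<subset> D - {u}" "boundary E (D - {u}) P = {}"
    using assms(2) unfolding connected_in_def by blast
  then have "boundary E D P \<subseteq> {u}" unfolding boundary_def by blast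
  then show ?thesis using that P assms(1) unfolding piece_def by blast
qed

lemma piece_Int:
  assumes P: "piece c P" and S: "piece u S" and u: "u \<in> P" and c: "c \<notin> S"
  shows "piece u (S \<inter> P)"
proof (rule pieceI)
  note P_props = pieceD[OF P] and S_props = pieceD[OF S]
  show "u \<in> D" "S \<inter> P \<subseteq> D - {u}" using S_props by auto
  have "c \<in> D - {u}" using P_props(1,4) u by auto
  then show "D - {u} - S \<inter> P \<noteq> {}" using c by blast
  show "v = u \<or> v \<in> S \<inter> P" if "p \<in> S \<inter> P" "v \<in> D" "E p v" for p v
    using piece_closed[OF P, of p v] piece_closed[OF S, of p v] that c by blast
  show "S \<inter> P \<noteq> {}"
  proof
    assume disjoint: "S \<inter> P = {}"
    have "S \<noteq> D" using S_props(1,4) by blast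
    then obtain d v where dv: "d \<in> S" "v \<in> D - S" "E d v"
      by (rule connected_in_boundaryE[OF D(3) S_props(2,3)])
    then have "v = u" using piece_closed[OF S, of d v] by blast
    then have "d = c \<or> d \<in> P" using piece_closed[OF P u, of d] E_sym[OF dv(3)] dv(1) S_props(3)
      by blast
    then show False using disjoint dv(1) c by blast
  qed
qed

lemma minimal_end_piece:
  assumes P: "piece c P" and minimal: "\<And>d S. piece d S \<Longrightarrow> \<not> S \<subset> P"
  shows "end_piece c P"
  unfolding end_piece_def
proof (intro conjI ballI P)
  note P_props = pieceD[OF P]
  show "connected_in E P"
    unfolding connected_in_def
  proof (intro allI impI notI)
    fix S assume S: "S \<noteq> {}" "S \<subset> P" and sep: "boundary E P S = {}"
    have "piece c S"
    proof (rule pieceI)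
      fix p v assume "p \<in> S" "v \<in> D" "E p v"
      then show "v = c \<or> v \<in> S"
        using piece_closed[OF P, of p v] S(2) boundary_nonemptyI[of p S v P E] sep by blast
    qed (use S P_props in auto)
    then show False using minimal S(2) by blast
  qed
  fix u assume u: "u \<in> P"
  show "connected_in E (D - {u})"
  proof (rule ccontr)
    assume "\<not> connected_in E (D - {u})"
    moreover have "u \<in> D" using u P_props(3) by blast
    ultimately obtain R where R: "piece u R" using piece_of_cut by blast
    obtain S where S: "piece u S" "c \<notin> S"
    proof (cases "c \<in> R")
      case True
      then show ?thesis by (intro that[OF piece_complement[OF R]]) simp
    next
      case False
      then show ?thesis by (rule that[OF R])
    qed
    then have "piece u (S \<inter> P)" by (intro piece_Int[OF P S(1) u])
    moreover have "u \<notin> S \<inter> P" using pieceD(4)[OF S(1)] by blast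
    ultimately show False using minimal[of u "S \<inter> P"] u by blast
  qed
qed

lemma ex_end_piece:
  assumes "piece b Q" obtains c P where "end_piece c P" "P \<subseteq> Q"
proof -
  define pieces where "pieces = {P. \<exists>c. piece c P}"
  have "finite pieces"
    by (rule finite_subset[of _ "Pow D"]) (use D(4) pieceD(3) in \<open>auto simp: pieces_def\<close>)
  moreover have "Q \<in> pieces" using assms unfolding pieces_def by blast
  ultimately obtain P where "P \<in> pieces" "P \<subseteq> Q" and minimal: "\<And>S. S \<in> pieces \<Longrightarrow> S \<subseteq> P \<Longrightarrow> P = S"
    using finite_has_minimal2[of pieces Q] by metis
  then obtain c where "piece c P" unfolding pieces_def by blast
  then have "end_piece c P"
    by (rule minimal_end_piece) (use minimal in \<open>auto simp: pieces_def\<close>)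
  then show ?thesis using that \<open>P \<subseteq> Q\<close> by blast
qed

lemma ex_disjoint_end_pieces:
  assumes "piece b Q"
  obtains c P c' P' where "end_piece c P" "end_piece c' P'" "P \<inter> P' = {}" "c \<notin> P'" "c' \<notin> P"
proof -
  obtain c P where P: "end_piece c P" using ex_end_piece[OF assms] by metis
  then have pieceP: "piece c P" unfolding end_piece_def by blast
  obtain c' P' where P': "end_piece c' P'" "P' \<subseteq> D - {c} - P"
    using ex_end_piece[OF piece_complement[OF pieceP]] by metis
  then have pieceP': "piece c' P'" unfolding end_piece_def by blast
  have "c' \<notin> P"
  proof
    assume c': "c' \<in> P"
    have "P' \<noteq> D" using pieceD(1,4)[OF pieceP'] by blast
    then obtain d v where dv: "d \<in> P'" "v \<in> D - P'" "E d v"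
      by (rule connected_in_boundaryE[OF D(3) pieceD(2,3)[OF pieceP']])
    then have "v = c'" using piece_closed[OF pieceP', of d v] by blast
    then have "d = c \<or> d \<in> P"
      using piece_closed[OF pieceP c', of d] E_sym[OF dv(3)] dv(1) pieceD(3)[OF pieceP'] by blast
    then show False using P'(2) dv(1) by blast
  qed
  then show ?thesis using that P P' by blast
qed

lemma end_piece_rooted:
  assumes P: "end_piece c P" and x: "x \<in> P" shows "rooted E (insert c P) x c"
  unfolding rooted_def
proof (intro conjI allI impI notI)
  have piece: "piece c P" using P unfolding end_piece_def by blast
  note P_props = pieceD[OF piece]
  show "finite (insert c P)" using P_props(3) D(4) finite_subset by blast
  show False if "x = c" using P_props(4) x that by blast
  fix S e assume S: "S \<noteq> {}" "S \<subseteq> insert c P - {x, c}" and sep: "boundary E (insert c P) S \<subseteq> {e}"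
  have leave: "v = e" if "d \<in> S" "v \<in> insert c P - S" "E d v" for d v
    using boundary_subsetD[OF sep that(1) _ that(3)] that(2) by blast
  have "connected_in E P" "S \<subseteq> P" "S \<noteq> P" using P S x unfolding end_piece_def by auto
  then obtain d v where "d \<in> S" "v \<in> P - S" "E d v"
    using connected_in_boundaryE[OF _ S(1)] by metis
  then have e: "e \<in> P" "e \<notin> S" using leave[of d v] by auto
  then have "connected_in E (D - {e})" using P unfolding end_piece_def by blast
  moreover have "S \<subseteq> D - {e}" "S \<noteq> D - {e}" using S(2) P_props e by auto
  ultimately obtain d v where dv: "d \<in> S" "v \<in> D - {e} - S" "E d v"
    using connected_in_boundaryE[OF _ S(1)] by metis
  moreover have "d \<in> P" using dv(1) S(2) by blast
  ultimately have "v \<in> insert c P - S" using piece_closed[OF piece, of d v] by blast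
  then show False using leave dv by blast
qed (use x in auto)

lemma admissible_exit_lengths:
  assumes P: "end_piece c P" "x \<in> P" and n: "2 \<le> n" "\<And>u. u \<in> P \<Longrightarrow> n + 1 \<le> card (nbrs E D u)"
  shows "admissible n (exit_lengths c P x)"
proof (rule admissible_rooted_path_lengths[OF end_piece_rooted[OF P] _ n(1)])
  fix u assume "u \<in> insert c P - {c}"
  then have u: "u \<in> P" by blast
  have piece: "piece c P" using P(1) unfolding end_piece_def by blast
  then have "nbrs E D u = nbrs E (insert c P) u"
    using piece_closed[OF piece u] pieceD(1,3)[OF piece] by auto
  then show "n + 1 \<le> card (nbrs E (insert c P) u)" using n(2)[OF u] by simp
qed

lemma end_piece_admissible:
  assumes P: "end_piece c P" "x \<in> P"
  shows "admissible (k - 3) (exit_lengths c P x)"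
    "(\<And>u i. u \<in> P \<Longrightarrow> \<not> twin u i) \<Longrightarrow> admissible (k - 2) (exit_lengths c P x)"
proof -
  have noncut: "u \<in> D" "connected_in E (D - {u})" if "u \<in> P" for u
    using P(1) that pieceD(3)[of c P] unfolding end_piece_def by auto
  have "k - 3 + 1 \<le> card (nbrs E D u)" if "u \<in> P" for u
    using card_nbrs_noncut(1)[OF noncut[OF that]] k_ge_6 by simp
  then show "admissible (k - 3) (exit_lengths c P x)"
    using k_ge_6 by (intro admissible_exit_lengths[OF P]) auto
  assume no_twin: "\<And>u i. u \<in> P \<Longrightarrow> \<not> twin u i"
  have "k - 2 + 1 \<le> card (nbrs E D u)" if "u \<in> P" for u
    using card_nbrs_noncut(2)[OF noncut[OF that] no_twin[OF that]] k_ge_6 by simp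
  then show "admissible (k - 2) (exit_lengths c P x)"
    using k_ge_6 by (intro admissible_exit_lengths[OF P]) auto
qed

lemma piece_attached:
  assumes P: "piece c P" obtains x i where "x \<in> P" "E x (w i)"
proof -
  note P_props = pieceD[OF P]
  have "P \<union> {c} \<subset> V" "P \<inter> {c} = {}" using P_props D(2) by auto
  then have "\<not> boundary E V P \<subseteq> {c}" using no_separator[OF P_props(2), of "{c}"] by simp
  then obtain x v where xv: "x \<in> P" "v \<in> V - P" "v \<noteq> c" "E x v" unfolding boundary_def by blast
  then have "v \<in> V - D" using piece_closed[OF P, of x v] by blast
  then have "v \<in> range w" using range_w by simp
  then show ?thesis using that xv by blast
qed

text \<open>The positions of the neighbours of \<open>P\<close> would be closed under adding \<open>q\<close>, hence under subtracting 1,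
  as \<open>2 * q\<close> is \<open>- 1\<close> modulo the period.\<close>

lemma piece_antipodal:
  assumes P: "piece c P"
  obtains x y i where "x \<in> P" "E x (w i)" "y \<in> D - P" "E y (w (i + q))"
proof (rule ccontr)
  assume "\<not> thesis"
  with that have none: "\<not> (x \<in> P \<and> E x (w i) \<and> y \<in> D - P \<and> E y (w (i + q)))" for x y i by blast
  define touched where "touched i \<longleftrightarrow> (\<exists>x\<in>P. E x (w i))" for i
  have antipodal: "touched (i + q)" if i: "touched i" for i
  proof -
    obtain x where x: "x \<in> P" "E x (w i)" using i unfolding touched_def by blast
    obtain y where y: "y \<in> D" "E y (w (i + q))" using cycle_attached by blast
    then have "y \<in> P" using none[of x i y] x by blast
    then show ?thesis using y(2) unfolding touched_def by blast
  qed
  have predecessor: "touched (i - 1)" if "touched i" for i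
  proof -
    have "touched (i - 1 + (2 * q + 1))"
      using antipodal[OF antipodal[OF that]] by (simp add: algebra_simps)
    then show ?thesis unfolding touched_def w_add_period .
  qed
  have predecessors: "touched (i - int m)" if "touched i" for i m
  proof (induction m)
    case (Suc m)
    then show ?case using predecessor[of "i - int m"] by (simp add: algebra_simps)
  qed (use that in simp)
  obtain y j where y: "y \<in> D - {c} - P" "E y (w j)" using piece_attached[OF piece_complement[OF P]] .
  obtain x i where x: "x \<in> P" "E x (w i)" using piece_attached[OF P] .
  obtain d where d: "0 \<le> d" "w i = w (j - q + d)"
    using periodic_cycle_offset[OF cycle, of "w i" "j - q"] by (metis rangeI)
  then have "touched (j - q + d)" using x unfolding touched_def by auto
  then have "touched (j - q + d - int (nat d))" by (rule predecessors)
  then obtain z where "z \<in> P" "E z (w (j - q))" unfolding touched_def using d(1) by auto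
  then show False using none[of z "j - q" y] y by simp
qed

lemma connected_without_piece: "piece c P \<Longrightarrow> connected_in E (D - P)"
  using connected_in_remove[OF sym D(3), of c P]
  unfolding piece_def by (simp add: Int_absorb1 psubset_eq subset_Diff_insert)

lemma consecutive_cycles_exit_step_2:
  assumes P: "piece c P" and x: "x \<in> P" "E x (w i)" and y: "y \<in> D - P" "E y (w (i + q))"
    and exits: "progression 2 (k - 3) (exit_lengths c P x)"
  shows "progression 1 k (cycle_lengths E V)"
proof (rule consecutive_cycles_sum)
  show "x \<noteq> y" using x(1) y(1) by blast
  have "c \<in> D - P" using pieceD[OF P] by blast
  then obtain h where h: "h \<in> path_lengths E (D - P) c y"
    using connected_in_path[OF connected_without_piece[OF P] _ y(1)] by blast
  have join: "n + h \<in> path_lengths E D x y" if "n \<in> exit_lengths c P x" for n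
  proof -
    have "n + h \<in> path_lengths E (insert c P \<union> (D - P)) x y"
      by (rule path_lengths_join[OF that h]) blast
    then show ?thesis by (rule path_lengths_mono) (use pieceD[OF P] in auto)
  qed
  have "nat (q + 1) = nat q + 1" using q_ge_2 by simp
  then have arcs: "nat q + r \<in> arc_lengths x y" if "r < 2" for r
    using arc_lengthsI[OF x(2) y(2)] that q_ge_2 by (auto simp: less_2_cases_iff)
  have "progression 1 2 (arc_lengths x y)" using arcs by (intro progressionI[of _ "nat q"]) simp
  then have "progression 1 (2 + 2 * (k - 3 - 1)) (arc_lengths x y + exit_lengths c P x)"
    by (rule progression_sum[OF _ exits]) (use k_ge_6 set_plus_intro in auto)
  then have "progression 1 (2 + 2 * (k - 3 - 1)) (arc_lengths x y + exit_lengths c P x + {h})"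
    by (rule progression_add) simp
  moreover have "exit_lengths c P x + {h} \<subseteq> path_lengths E D x y"
    using join by (auto simp: set_plus_def)
  then have "arc_lengths x y + exit_lengths c P x + {h} \<subseteq> arc_lengths x y + path_lengths E D x y"
    unfolding add.assoc by (rule set_plus_mono2[OF order_refl])
  ultimately have "progression 1 (2 + 2 * (k - 3 - 1)) (arc_lengths x y + path_lengths E D x y)"
    by (rule progression_mono)
  then show "progression 1 k (arc_lengths x y + path_lengths E D x y)"
    by (rule progression_le) (use k_ge_6 in simp)
qed

end

locale two_end_pieces = triangle_free_frame +
  fixes c P c' P'
  assumes end_pieces: "end_piece c P" "end_piece c' P'"
    and disjoint: "P \<inter> P' = {}" "c \<notin> P'" "c' \<notin> P"
begin

lemma pieces: "piece c P" "piece c' P'"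
  using end_pieces unfolding end_piece_def by auto

lemma connecting_path:
  obtains g where "\<And>x x'. exit_lengths c P x + exit_lengths c' P' x' + {g} \<subseteq> path_lengths E D x x'"
proof -
  note P = pieceD[OF pieces(1)] and P' = pieceD[OF pieces(2)]
  have "(D - P) \<inter> P' = P'" using P'(3) disjoint(1) by blast
  moreover have "boundary E (D - P) P' \<subseteq> boundary E D P'" by (auto simp: boundary_def)
  moreover have "boundary E D P' \<subseteq> {c'}" using pieces(2) unfolding piece_def by blast
  moreover have c': "c' \<in> D - P - P'" using P'(1,4) disjoint(3) by blast
  ultimately have "connected_in E (D - P - P')"
    using connected_in_remove[OF sym connected_without_piece[OF pieces(1)], of c' P'] by simp
  then obtain g where g: "g \<in> path_lengths E (D - P - P') c c'"
    using connected_in_path[of E "D - P - P'" c c'] P(1,4) c' disjoint(2) by blast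
  have "n + n' + g \<in> path_lengths E D x x'"
    if n: "n \<in> exit_lengths c P x" and n': "n' \<in> exit_lengths c' P' x'" for x x' n n'
  proof -
    have "n + g \<in> path_lengths E (insert c P \<union> (D - P - P')) x c'"
      by (rule path_lengths_join[OF n g]) blast
    then have "n + g + n' \<in> path_lengths E (insert c P \<union> (D - P - P') \<union> insert c' P') x x'"
      by (rule path_lengths_join[OF _ path_lengths_rev[OF sym n']]) (use disjoint in blast)
    then have "n + g + n' \<in> path_lengths E D x x'" by (rule path_lengths_mono) (use P P' in auto)
    then show ?thesis by (simp add: ac_simps)
  qed
  then show ?thesis by (intro that) (auto simp: set_plus_def)
qed

lemma consecutive_cycles_join:
  assumes x: "x \<in> P" "x' \<in> P'"
    and sums: "progression 1 k (arc_lengths x x' + (exit_lengths c P x + exit_lengths c' P' x'))"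
  shows "progression 1 k (cycle_lengths E V)"
proof (rule consecutive_cycles_sum)
  show "x \<noteq> x'" using x disjoint(1) by blast
  obtain g where "\<And>x x'. exit_lengths c P x + exit_lengths c' P' x' + {g} \<subseteq> path_lengths E D x x'"
    by (rule connecting_path) blast
  then have "arc_lengths x x' + (exit_lengths c P x + exit_lengths c' P' x') + {g}
    \<subseteq> arc_lengths x x' + path_lengths E D x x'"
    unfolding add.assoc by (rule set_plus_mono2[OF order_refl])
  then show "progression 1 k (arc_lengths x x' + path_lengths E D x x')"
    by (rule progression_mono[OF progression_add[OF sums, of g "{g}"], rotated]) simp
qed

lemma consecutive_cycles_wide:
  assumes x: "x \<in> P" "E x (w i)" and x': "x' \<in> P'" "E x' (w j)"
    and wide: "progression 1 k (exit_lengths c P x + exit_lengths c' P' x')"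
  shows "progression 1 k (cycle_lengths E V)"
proof (rule consecutive_cycles_join[OF x(1) x'(1)])
  obtain r where "r \<in> arc_lengths x x'" using arc_lengths_nonempty[OF x(2) x'(2)] by blast
  then show "progression 1 k (arc_lengths x x' + (exit_lengths c P x + exit_lengths c' P' x'))"
    using progression_add[OF wide] by (metis add.commute)
qed

lemma consecutive_cycles_two_twins:
  assumes x: "x \<in> P" "twin x i" and x': "x' \<in> P'" "twin x' j"
    and exits: "progression 1 (k - 3) (exit_lengths c P x)" "progression 1 (k - 3) (exit_lengths c' P' x')"
  shows "progression 1 k (cycle_lengths E V)"
proof (rule consecutive_cycles_join[OF x(1) x'(1)])
  obtain r where r: "r \<in> arc_lengths x x'" "r + 2 \<in> arc_lengths x x'"
    by (rule arc_lengths_two_twins[OF x(2) x'(2)])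
  then have arcs: "progression 2 2 (arc_lengths x x')"
    by (intro progressionI[of _ r]) (auto simp: less_2_cases_iff)
  have "progression 1 (k - 3 + (k - 3) - 1) (exit_lengths c P x + exit_lengths c' P' x')"
    by (rule progression_sum_same[OF exits]) (use k_ge_6 set_plus_intro in auto)
  then have "progression 1 (k - 3 + (k - 3) - 1 + 2 * (2 - 1))
      (exit_lengths c P x + exit_lengths c' P' x' + arc_lengths x x')"
    by (rule progression_sum[OF _ arcs]) (use k_ge_6 set_plus_intro in auto)
  then have "progression 1 k (exit_lengths c P x + exit_lengths c' P' x' + arc_lengths x x')"
    by (rule progression_le) (use k_ge_6 in linarith)
  then show "progression 1 k (arc_lengths x x' + (exit_lengths c P x + exit_lengths c' P' x'))"
    by (simp only: add.commute)
qed

lemma consecutive_cycles_step_1_step_2: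
  assumes x: "x \<in> P" "E x (w i)" and x': "x' \<in> P'" "E x' (w j)"
    and exits: "progression 1 (k - 3) (exit_lengths c P x) \<and> progression 2 (k - 3) (exit_lengths c' P' x') \<or>
      progression 2 (k - 3) (exit_lengths c P x) \<and> progression 1 (k - 3) (exit_lengths c' P' x')"
  shows "progression 1 k (cycle_lengths E V)"
proof (rule consecutive_cycles_wide[OF x x'])
  have "progression 1 k (A + B)" if "progression 1 (k - 3) A" "progression 2 (k - 3) B" for A B
  proof -
    have "progression 1 (k - 3 + 2 * (k - 3 - 1)) (A + B)"
      by (rule progression_sum[OF that]) (use k_ge_6 set_plus_intro in auto)
    then show ?thesis by (rule progression_le) (use k_ge_6 in linarith)
  qed
  then show "progression 1 k (exit_lengths c P x + exit_lengths c' P' x')"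
    using exits by (metis add.commute)
qed

lemma consecutive_cycles_steps_1:
  assumes x: "x \<in> P" "E x (w i)" and x': "x' \<in> P'" "E x' (w j)"
    and exits: "progression 1 m (exit_lengths c P x)" "progression 1 n (exit_lengths c' P' x')"
    and "k < m + n" "1 \<le> m" "1 \<le> n"
  shows "progression 1 k (cycle_lengths E V)"
proof (rule consecutive_cycles_wide[OF x x'])
  have "progression 1 (m + n - 1) (exit_lengths c P x + exit_lengths c' P' x')"
    by (rule progression_sum_same[OF exits]) (use assms set_plus_intro in auto)
  then show "progression 1 k (exit_lengths c P x + exit_lengths c' P' x')"
    by (rule progression_le) (use assms in simp)
qed

lemma consecutive_cycles_twins:
  assumes x: "x \<in> P" "E x (w i)" "progression 1 (k - 3) (exit_lengths c P x)"
    and x': "x' \<in> P'" "E x' (w j)" "progression 1 (k - 3) (exit_lengths c' P' x')"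
    and u: "u \<in> P" "twin u s" and u': "u' \<in> P'" "twin u' t"
  shows "progression 1 k (cycle_lengths E V)"
proof -
  have attached: "E u (w (s + 1))" "E u' (w (t + 1))" using u(2) u'(2) unfolding twin_def by auto
  consider "progression 2 (k - 3) (exit_lengths c P u)" | "progression 2 (k - 3) (exit_lengths c' P' u')"
    | "progression 1 (k - 3) (exit_lengths c P u)" "progression 1 (k - 3) (exit_lengths c' P' u')"
    using end_piece_admissible(1)[OF end_pieces(1) u(1)] end_piece_admissible(1)[OF end_pieces(2) u'(1)]
    unfolding admissible_def by blast
  then show ?thesis
  proof cases
    case 1
    then show ?thesis using consecutive_cycles_step_1_step_2[OF u(1) attached(1) x'(1,2)] x'(3)
      by blast
  next
    case 2
    then show ?thesis using consecutive_cycles_step_1_step_2[OF x(1,2) u'(1) attached(2)] x(3)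
      by blast
  next
    case 3
    then show ?thesis by (rule consecutive_cycles_two_twins[OF u u'])
  qed
qed

lemma consecutive_cycles_two_end_pieces: "progression 1 k (cycle_lengths E V)"
proof (rule ccontr)
  assume none: "\<not> ?thesis"
  obtain x y i where x: "x \<in> P" "E x (w i)" and y: "y \<in> D - P" "E y (w (i + q))"
    using piece_antipodal[OF pieces(1)] .
  obtain x' y' j where x': "x' \<in> P'" "E x' (w j)" and y': "y' \<in> D - P'" "E y' (w (j + q))"
    using piece_antipodal[OF pieces(2)] .
  have step_1: "progression 1 n (exit_lengths c P x)"
    if "admissible n (exit_lengths c P x)" "k - 3 \<le> n" for n
    using consecutive_cycles_exit_step_2[OF pieces(1) x y] progression_le[of 2 n] none that
    unfolding admissible_def by blast
  have step_1': "progression 1 n (exit_lengths c' P' x')"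
    if "admissible n (exit_lengths c' P' x')" "k - 3 \<le> n" for n
    using consecutive_cycles_exit_step_2[OF pieces(2) x' y'] progression_le[of 2 n] none that
    unfolding admissible_def by blast
  have exits: "progression 1 (k - 3) (exit_lengths c P x)" "progression 1 (k - 3) (exit_lengths c' P' x')"
    using step_1 step_1' end_piece_admissible(1) end_pieces x(1) x'(1) by auto
  consider u s u' t where "u \<in> P" "twin u s" "u' \<in> P'" "twin u' t"
    | "\<And>u s. u \<in> P \<Longrightarrow> \<not> twin u s" | "\<And>u s. u \<in> P' \<Longrightarrow> \<not> twin u s" by blast
  then show False
  proof cases
    case 1
    then show False using consecutive_cycles_twins x x' exits none by blast
  next
    case 2
    then have "progression 1 (k - 2) (exit_lengths c P x)"
      by (intro step_1 end_piece_admissible(2)[OF end_pieces(1) x(1)]) auto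
    then show False using consecutive_cycles_steps_1[OF x x' _ exits(2)] none k_ge_6 by simp
  next
    case 3
    then have "progression 1 (k - 2) (exit_lengths c' P' x')"
      by (intro step_1' end_piece_admissible(2)[OF end_pieces(2) x'(1)]) auto
    then show False using consecutive_cycles_steps_1[OF x x' exits(1)] none k_ge_6 by simp
  qed
qed

end

lemma (in triangle_free_frame) consecutive_cycles_triangle_free: "progression 1 k (cycle_lengths E V)"
proof (cases "\<exists>u\<in>D. \<not> connected_in E (D - {u})")
  case True
  then obtain u Q where "piece u Q" using piece_of_cut by metis
  then obtain c P c' P' where "end_piece c P" "end_piece c' P'" "P \<inter> P' = {}" "c \<notin> P'" "c' \<notin> P"
    by (rule ex_disjoint_end_pieces)
  then interpret two_end_pieces E V k D w q c P c' P' by unfold_locales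
  show ?thesis by (rule consecutive_cycles_two_end_pieces)
next
  case False
  then show ?thesis by (intro consecutive_cycles_2_connected) blast
qed

theorem (in three_connected_min_degree) consecutive_cycles:
  assumes "\<nexists>f. two_colouring E V f" and "\<not> (pairwise E V \<and> card V = k + 1)"
  shows "progression 1 k (cycle_lengths E V)"
proof (cases "\<exists>a b c. {a, b, c} \<subseteq> V \<and> E a b \<and> E b c \<and> E c a")
  case True
  then obtain a b c where abc: "{a, b, c} \<subseteq> V" "E a b" "E b c" "E c a" by blast
  then show ?thesis using consecutive_cycles_triangle[OF abc(1,2) E_sym[OF abc(4)] abc(3) assms(2)]
    by simp
next
  case False
  obtain r where r: "remainder {r}" by (rule ex_remainder[OF assms(1)])
  have "\<forall>S. remainder S \<longrightarrow> card S < Suc (card V)"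
    using card_mono[OF finite_V] unfolding remainder_def less_Suc_eq_le by blast
  from ex_has_greatest_nat[OF r this] obtain D
    where D: "remainder D" "\<And>S. remainder S \<Longrightarrow> card S \<le> card D" by blast
  obtain m where m: "m \<in> cycle_lengths E (V - D)" "odd m" using D(1) unfolding remainder_def by blast
  then obtain w where w: "periodic_cycle E (int m) w" "range w \<subseteq> V - D"
    by (elim cycle_lengths_periodicE)
  have "odd (int m)" using m(2) by simp
  then obtain q where q: "int m = 2 * q + 1" by (rule oddE)
  interpret triangle_free_frame E V k D w q
  proof
    show "periodic_cycle E (2 * q + 1) w" using w(1) q by simp
    show "\<not> (E a b \<and> E b c \<and> E c a)" if "{a, b, c} \<subseteq> V" for a b c using False that by blast
  qed (fact D w(2))+
  show ?thesis by (rule consecutive_cycles_triangle_free)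
qed

subsection \<open>Digraph representation\<close>

context graph
begin

abbreviation adj :: "'a \<Rightarrow> 'a \<Rightarrow> bool" where
  "adj u v \<equiv> u \<rightarrow>\<^bsub>G\<^esub> v"

lemma adjE:
  assumes "adj u v" obtains e where "e \<in> arcs G" "tail G e = u" "head G e = v"
  using assms by (auto simp: arcs_ends_def arc_to_ends_def)

lemma adjacency_adj: "adjacency adj"
proof
  show "symp adj" using arcs_ends_symmetric[OF sym_arcs] by (intro sympI)
  show "irreflp adj" using adj_not_same by (auto intro: irreflpI)
qed

lemma awalk_of_path:
  assumes "xs \<noteq> []" "set xs \<subseteq> verts G" "successively adj xs"
  obtains p where "awalk (hd xs) p (last xs)" "awalk_verts (hd xs) p = xs"
  using assms
proof (induction xs arbitrary: thesis)
  case (Cons v xs)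
  show ?case
  proof (cases "xs = []")
    case True
    then show ?thesis using Cons.prems(1)[of "[]"] Cons.prems(3) by (simp add: awalk_def)
  next
    case False
    then have step: "successively adj xs" "adj v (hd xs)"
      using Cons.prems(4) by (auto simp: successively_Cons)
    obtain p where p: "awalk (hd xs) p (last xs)" "awalk_verts (hd xs) p = xs"
      using Cons.IH[OF _ False _ step(1)] Cons.prems(3) by auto
    obtain e where "e \<in> arcs G" "tail G e = v" "head G e = hd xs" using step(2) by (rule adjE)
    then show ?thesis
      by (intro Cons.prems(1)[of "e # p"]) (use p False in \<open>auto simp: awalk_Cons_iff\<close>)
  qed
qed simp

lemma has_cycle_of_length_if_cycle_lengths:
  assumes "n \<in> cycle_lengths adj (verts G)" shows "has_cycle_of_length G n"
proof -
  obtain xs where xs: "3 \<le> n" "path_in adj (verts G) xs" "adj (last xs) (hd xs)" "length xs = n"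
    using assms unfolding cycle_lengths_def by blast
  then have path: "xs \<noteq> []" "distinct xs" "set xs \<subseteq> verts G" "successively adj xs"
    unfolding path_in_def by auto
  obtain p where p: "awalk (hd xs) p (last xs)" "awalk_verts (hd xs) p = xs"
    using awalk_of_path[OF path(1,3,4)] .
  obtain e where e: "e \<in> arcs G" "tail G e = last xs" "head G e = hd xs" using xs(3) by (rule adjE)
  have "awalk (last xs) (e # p) (last xs)" using p(1) e by (simp add: awalk_Cons_iff)
  moreover have "awalk_verts (last xs) (e # p) = last xs # xs" using p(2) e by simp
  ultimately have "cycle (e # p)" unfolding cycle_def using path(2) by force
  moreover have "length (e # p) = n" using length_awalk_verts[of "hd xs" p] p(2) xs(4) by simp
  ultimately show ?thesis unfolding has_cycle_of_length_def using xs(1) by blast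
qed

lemma card_nbrs_adj: "card (nbrs adj (verts G) v) = out_degree G v"
proof -
  have "head G ` out_arcs G v = nbrs adj (verts G) v"
    by (auto simp: arcs_ends_def arc_to_ends_def out_arcs_def image_iff)
  moreover have "inj_on (head G) (out_arcs G v)"
    using no_multi_arcs by (auto intro!: inj_onI simp: arc_to_ends_def)
  ultimately show ?thesis unfolding out_degree_def by (metis card_image)
qed

lemma boundary_not_subset_if_connected:
  assumes conn: "connected (G \<restriction> (verts G - X))"
    and D: "D \<noteq> {}" "D \<subseteq> verts G - X" "D \<noteq> verts G - X"
  shows "\<not> boundary adj (verts G) D \<subseteq> X"
proof
  assume sep: "boundary adj (verts G) D \<subseteq> X"
  obtain d v where dv: "d \<in> D" "v \<in> verts G - X" "v \<notin> D" using D by blast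
  then have "(d, v) \<in> rtrancl_on (verts G - X) (parcs (mk_symmetric (G \<restriction> (verts G - X))))"
    using conn D(2) unfolding connected_def strongly_connected_def reachable_def by auto
  then have "v \<in> D"
  proof (induction rule: rtrancl_on_induct)
    case (step y z)
    then obtain e
      where e: "e \<in> arcs G" "(y, z) = (tail G e, head G e) \<or> (y, z) = (head G e, tail G e)"
      by (auto simp: parcs_mk_symmetric)
    then have "adj (tail G e) (head G e)" by (auto simp: arcs_ends_def arc_to_ends_def)
    then have "adj y z" using e(2) arcs_ends_symmetric[OF sym_arcs] by auto
    then show ?case using boundary_subsetD[OF sep, of y z] step by blast
  qed (use dv in simp)
  then show False using dv by blast
qed

lemma three_connected_min_degree_adj:
  assumes "6 \<le> k" "vertex_connected 3 G" "k \<le> min_degree G"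
  shows "three_connected_min_degree adj (verts G) k"
proof -
  interpret adjacency adj by (rule adjacency_adj)
  show ?thesis
  proof
    fix D S :: "'a set" assume D: "D \<noteq> {}" "D \<union> S \<subset> verts G" "D \<inter> S = {}" "card S < 3"
    then have "connected (G \<restriction> (verts G - S))" using assms(2) unfolding vertex_connected_def by blast
    then show "\<not> boundary adj (verts G) D \<subseteq> S"
      by (rule boundary_not_subset_if_connected) (use D in auto)
  next
    fix v assume "v \<in> verts G"
    then have "min_degree G \<le> out_degree G v" unfolding min_degree_def by (intro Min_le) auto
    then show "k \<le> card (nbrs adj (verts G) v)" using assms(3) by (simp add: card_nbrs_adj)
  qed (use assms(1) in auto)
qed

lemma bipartite_of_two_colouring:
  assumes "two_colouring adj (verts G) f" shows "bipartite G"
proof -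
  have "u \<in> verts G \<and> v \<in> verts G \<and> f u \<noteq> f v" if "adj u v" for u v
    using adj_in_verts[OF that] assms that unfolding two_colouring_def by blast
  then show ?thesis
    unfolding bipartite_def
    by (intro exI[of _ "{v \<in> verts G. f v}"] exI[of _ "{v \<in> verts G. \<not> f v}"]) auto
qed

lemma complete_digraph_of_pairwise:
  assumes "pairwise adj (verts G)" shows "complete_digraph (card (verts G)) G"
proof -
  have "adj u v \<longleftrightarrow> u \<in> verts G \<and> v \<in> verts G \<and> u \<noteq> v" for u v
    using assms adj_in_verts[of u v] adj_not_same unfolding pairwise_def by blast
  then have "arcs_ends G = {(u, v). (u, v) \<in> verts G \<times> verts G \<and> u \<noteq> v}" by auto
  then show ?thesis unfolding complete_digraph_def using graph_axioms by blast
qed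

end

theorem theorem1p3:
  fixes G :: "('a, 'b) pre_digraph" and k :: nat
  assumes "6 \<le> k"
    and "graph G"
    and "vertex_connected 3 G"
    and "\<not> bipartite G"
    and "k \<le> min_degree G"
    and "\<not> complete_digraph (k + 1) G"
  shows "\<exists>l. \<forall>i \<in> {0..k - 1}. has_cycle_of_length G (l + i)"
proof -
  interpret graph G by fact
  interpret three_connected_min_degree adj "verts G" k
    using assms(1,3,5) by (rule three_connected_min_degree_adj)
  have "\<nexists>f. two_colouring adj (verts G) f" using assms(4) bipartite_of_two_colouring by blast
  moreover have "\<not> (pairwise adj (verts G) \<and> card (verts G) = k + 1)"
    using assms(6) complete_digraph_of_pairwise by metis
  ultimately have "progression 1 k (cycle_lengths adj (verts G))" by (rule consecutive_cycles)
  then obtain l where "\<forall>i<k. l + i \<in> cycle_lengths adj (verts G)" unfolding progression_def by auto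
  then show ?thesis using assms(1)
    by (intro exI[of _ l]) (auto intro!: has_cycle_of_length_if_cycle_lengths)
qed

end
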